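(* Let $(\mathcal{C},\mathcal{M})$ be an AECat with the amalgamation property, and let $\mathop{\perp\!\!\!\perp}$ be a basic independence relation that also satisfies 3-amalgamation. Then for any model $M$ and arrows $a,b:A\to M$, $c:C\to M$ the following are equivalent: (i) $\mathrm{Lgtp}(a/c;M)=\mathrm{Lgtp}(b/c;M)$; (ii) $a\equiv^B_cb$; (iii) $a\equiv^2_cb$.
   Context: An AECat is a pair $(\mathcal{C},\mathcal{M})$ of accessible categories with $\mathcal{M}$ a full subcategory of $\mathcal{C}$, $\mathcal{M}$ having directed colimits preserved by the inclusion, and every arrow of $\mathcal{C}$ a monomorphism; objects of $\mathcal{M}$ are models. AP: every span of models completes to a commutative square into a model. An extension of a model $M$ is an arrow $M\to N$ with $N$ a model; given it and $a:A\to M$ we also write $a$ for $A\to M\to N$. $\mathrm{gtp}((a_i)_i;M)=\mathrm{gtp}((a_i')_i;M')$ means $\mathrm{dom}(a_i)=\mathrm{dom}(a_i')$ and there are extensions $f:M\to N$, $f':M'\to N$ with $fa_i=f'a_i'$ for all $i$. $(a/c;M)\sim(b/c;M)$ if there are an extension $M\to N$ and $m_0:M_0\to N$ with $M_0$ a model, $c$ factoring through $m_0$, and $\mathrm{gtp}(a,m_0;N)=\mathrm{gtp}(b,m_0;N)$; its transitive closure is $\mathrm{Lgtp}(a/c;M)=\mathrm{Lgtp}(b/c;M)$. An independence relation is a relation on triples of subobjects of a model $M$, written $A\mathop{\perp\!\!\!\perp}_C^MB$ (arrows may replace the subobjects they represent), with a base class $\mathrm{base}(\mathop{\perp\!\!\!\perp})$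 (a collection of objects containing all models) such that $A\mathop{\perp\!\!\!\perp}_C^MB$ implies $\mathrm{dom}(C)\in\mathrm{base}(\mathop{\perp\!\!\!\perp})$. Basic means: Invariance ($a\mathop{\perp\!\!\!\perp}_c^Mb$, $\mathrm{gtp}(a,b,c;M)=\mathrm{gtp}(a',b',c';M')$ imply $a'\mathop{\perp\!\!\!\perp}_{c'}^{M'}b'$); Monotonicity ($A\mathop{\perp\!\!\!\perp}_C^MB$, $A'\le A$ imply $A'\mathop{\perp\!\!\!\perp}_C^MB$); Transitivity ($A\mathop{\perp\!\!\!\perp}_B^MC$, $A\mathop{\perp\!\!\!\perp}_C^MD$, $B\le C$ imply $A\mathop{\perp\!\!\!\perp}_B^MD$); Symmetry; Existence ($A\mathop{\perp\!\!\!\perp}_C^MC$ for $C$ with domain in the base class); Extension (if $a\mathop{\perp\!\!\!\perp}_c^Mb$ and $b$ factors through $(b';M)$, there are an extension $M\to N$ and $(a';N)$ with $\mathrm{gtp}(a',b,c;N)=\mathrm{gtp}(a,b,c;M)$, $a'\mathop{\perp\!\!\!\perp}_c^Nb'$); Union (if $(B_i)_{i\in I}$ is directed with a cocone into a model $M$ and $B=\mathrm{colim}_iB_i$ exists, $A\mathop{\perp\!\!\!\perp}_C^MB_i$ for all $i$ implies $A\mathop{\perp\!\!\!\perp}_C^MB$). 3-amalgamation: whenever $M,N_1,N_2,N_3$ are models and $a_1:A\to N_1$, $a_3:A\to N_3$, $b_1:B\to N_1$, $b_2:B\to N_2$, $c_2:C\to N_2$, $c_3:C\to N_3$, $m_k:M\to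 N_k$ are arrows with $a_1\mathop{\perp\!\!\!\perp}_{m_1}^{N_1}b_1$, $b_2\mathop{\perp\!\!\!\perp}_{m_2}^{N_2}c_2$, $c_3\mathop{\perp\!\!\!\perp}_{m_3}^{N_3}a_3$, $\mathrm{gtp}(a_1,m_1;N_1)=\mathrm{gtp}(a_3,m_3;N_3)$, $\mathrm{gtp}(b_1,m_1;N_1)=\mathrm{gtp}(b_2,m_2;N_2)$, $\mathrm{gtp}(c_2,m_2;N_2)=\mathrm{gtp}(c_3,m_3;N_3)$, there are a model $N$ and $f_k:N_k\to N$ with $f_1m_1=f_2m_2=f_3m_3$, $f_1a_1=f_3a_3$, $f_1b_1=f_2b_2$, $f_2c_2=f_3c_3$ and $f_1a_1\mathop{\perp\!\!\!\perp}_{f_1m_1}^Nf_2$. Fix objects $A,C$. An equivalence relation over $C$ assigns to every model $M$ and $c:C\to M$ an equivalence relation $\equiv_{c,M}$ on $\mathrm{Hom}(A,M)$; it is bounded if there is a cardinal $\lambda$ such that every $\equiv_{c,M}$ has at most $\lambda$ classes, and invariant if $\mathrm{gtp}(a,b,c;M)=\mathrm{gtp}(a',b',c';M')$ implies ($a\equiv_{c,M}b\iff a'\equiv_{c',M'}b'$). $a\equiv^B_cb$ means $a\equiv_{c,M}b$ for every bounded invariant equivalence relation over $C$. A sequence $(a_i)_{i<\delta}$ of arrows with domain $A$ into a model $N$ is 2-$c$-indiscernible if for all $i_1<i_2<\delta$ and $j_1<j_2<\delta$, $\mathrm{gtp}(a_{i_1},c;N)=\mathrm{gtp}(a_{i_2},c;N)$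 and $\mathrm{gtp}(a_{i_1},a_{i_2},c;N)=\mathrm{gtp}(a_{j_1},a_{j_2},c;N)$; it is strongly 2-$c$-indiscernible if for every ordinal $\gamma$ it extends, in some extension of $N$, to a 2-$c$-indiscernible sequence of length at least $\gamma$. $a\sim^2_cb$ means $a$ and $b$ both occur on some strongly 2-$c$-indiscernible sequence (in some extension of $M$); $\equiv^2_c$ is the transitive closure of $\sim^2_c$. *)

theory Defs
  imports Main
begin

unbundle cardinal_syntax

section \<open>Size\<close>

text \<open>
  Sets and classes are told apart by a Grothendieck universe: a type \<open>'u\<close> whose cardinality is
  an uncountable strongly inaccessible cardinal. A set (of any type) is small if it has fewer
  elements than \<open>'u\<close>; objects and arrows of a category live in arbitrary types and may form large
  collections. Every small set is equinumerous to a subset of \<open>'u\<close>, so small index posets,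
  cardinals and ordinals can all be taken to be relations on \<open>'u\<close> with a small field.
\<close>

definition Grothendieck_universe :: "'u itself \<Rightarrow> bool" where
  "Grothendieck_universe _ \<longleftrightarrow>
     natLeq <o |UNIV :: 'u set| \<and>
     regularCard |UNIV :: 'u set| \<and>
     (\<forall>X :: 'u set. |X| <o |UNIV :: 'u set| \<longrightarrow> |Pow X| <o |UNIV :: 'u set| )"

definition small :: "'u itself \<Rightarrow> 'x set \<Rightarrow> bool" where
  "small _ X \<longleftrightarrow> |X| <o |UNIV :: 'u set|"

definition small_regular_cardinal :: "'u rel \<Rightarrow> bool" where
  "small_regular_cardinal l \<longleftrightarrow>
     Card_order l \<and> \<not> finite (Field l) \<and> regularCard l \<and> small TYPE('u) (Field l)"

definition small_ordinal :: "'u rel \<Rightarrow> bool" where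
  "small_ordinal r \<longleftrightarrow> Well_order r \<and> small TYPE('u) (Field r)"

text \<open>Small \<open>l\<close>-directed posets; \<open>l\<close> is a cardinal and the poset is the reflexive order \<open>r\<close> on
  \<open>Field r\<close>. Plain directedness is the case of \<open>natLeq\<close>, that is, of aleph-zero.\<close>

definition directed_poset :: "'l rel \<Rightarrow> 'u rel \<Rightarrow> bool" where
  "directed_poset l r \<longleftrightarrow>
     Partial_order r \<and> small TYPE('u) (Field r) \<and>
     (\<forall>S \<subseteq> Field r. |S| <o l \<longrightarrow> (\<exists>u \<in> Field r. \<forall>i \<in> S. (i, u) \<in> r))"


section \<open>Categories\<close>

record ('o, 'a) cat =
  Obj :: "'o set"
  Arr :: "'a set"
  Dom :: "'a \<Rightarrow> 'o"
  Cod :: "'a \<Rightarrow> 'o"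
  Id :: "'o \<Rightarrow> 'a"
  Comp :: "'a \<Rightarrow> 'a \<Rightarrow> 'a" 

definition hom :: "('o, 'a) cat \<Rightarrow> 'o \<Rightarrow> 'o \<Rightarrow> 'a set" where
  "hom \<C> X Y = {f \<in> Arr \<C>. Dom \<C> f = X \<and> Cod \<C> f = Y}"

definition category :: "('o, 'a) cat \<Rightarrow> bool" where
  "category \<C> \<longleftrightarrow>
     (\<forall>f \<in> Arr \<C>. Dom \<C> f \<in> Obj \<C> \<and> Cod \<C> f \<in> Obj \<C>) \<and>
     (\<forall>X \<in> Obj \<C>. Id \<C> X \<in> hom \<C> X X) \<and>
     (\<forall>f \<in> Arr \<C>. \<forall>g \<in> Arr \<C>. Cod \<C> f = Dom \<C> g \<longrightarrow> Comp \<C> g f \<in> hom \<C> (Dom \<C> f) (Cod \<C> g)) \<and>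
     (\<forall>f \<in> Arr \<C>. Comp \<C> f (Id \<C> (Dom \<C> f)) = f \<and> Comp \<C> (Id \<C> (Cod \<C> f)) f = f) \<and>
     (\<forall>f \<in> Arr \<C>. \<forall>g \<in> Arr \<C>. \<forall>h \<in> Arr \<C>. Cod \<C> f = Dom \<C> g \<and> Cod \<C> g = Dom \<C> h \<longrightarrow>
        Comp \<C> (Comp \<C> h g) f = Comp \<C> h (Comp \<C> g f))"

definition locally_small :: "'u itself \<Rightarrow> ('o, 'a) cat \<Rightarrow> bool" where
  "locally_small U \<C> \<longleftrightarrow> (\<forall>X \<in> Obj \<C>. \<forall>Y \<in> Obj \<C>. small U (hom \<C> X Y))"

definition mono_arr :: "('o, 'a) cat \<Rightarrow> 'a \<Rightarrow> bool" where
  "mono_arr \<C> f \<longleftrightarrow>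
     f \<in> Arr \<C> \<and>
     (\<forall>X \<in> Obj \<C>. \<forall>g \<in> hom \<C> X (Dom \<C> f). \<forall>h \<in> hom \<C> X (Dom \<C> f).
        Comp \<C> f g = Comp \<C> f h \<longrightarrow> g = h)"

definition full_subcat :: "('o, 'a) cat \<Rightarrow> 'o set \<Rightarrow> ('o, 'a) cat" where
  "full_subcat \<C> \<M> =
     \<C>\<lparr>Obj := \<M>, Arr := {f \<in> Arr \<C>. Dom \<C> f \<in> \<M> \<and> Cod \<C> f \<in> \<M>}\<rparr>"

text \<open>Diagrams indexed by a poset \<open>r\<close>: objects \<open>D i\<close> and transition arrows \<open>d i j\<close> for \<open>i \<le> j\<close>.\<close>

definition diagram ::
  "('o, 'a) cat \<Rightarrow> 'u rel \<Rightarrow> ('u \<Rightarrow> 'o) \<Rightarrow> ('u \<Rightarrow> 'u \<Rightarrow> 'a) \<Rightarrow> bool" where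
  "diagram \<C> r D d \<longleftrightarrow>
     (\<forall>i \<in> Field r. D i \<in> Obj \<C> \<and> d i i = Id \<C> (D i)) \<and>
     (\<forall>i j. (i, j) \<in> r \<longrightarrow> d i j \<in> hom \<C> (D i) (D j)) \<and>
     (\<forall>i j k. (i, j) \<in> r \<and> (j, k) \<in> r \<longrightarrow> Comp \<C> (d j k) (d i j) = d i k)"

definition cocone ::
  "('o, 'a) cat \<Rightarrow> 'u rel \<Rightarrow> ('u \<Rightarrow> 'o) \<Rightarrow> ('u \<Rightarrow> 'u \<Rightarrow> 'a) \<Rightarrow> 'o \<Rightarrow> ('u \<Rightarrow> 'a) \<Rightarrow> bool" where
  "cocone \<C> r D d X x \<longleftrightarrow>
     X \<in> Obj \<C> \<and> (\<forall>i \<in> Field r. x i \<in> hom \<C> (D i) X) \<and>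
     (\<forall>i j. (i, j) \<in> r \<longrightarrow> Comp \<C> (x j) (d i j) = x i)"

definition colimit ::
  "('o, 'a) cat \<Rightarrow> 'u rel \<Rightarrow> ('u \<Rightarrow> 'o) \<Rightarrow> ('u \<Rightarrow> 'u \<Rightarrow> 'a) \<Rightarrow> 'o \<Rightarrow> ('u \<Rightarrow> 'a) \<Rightarrow> bool" where
  "colimit \<C> r D d L l \<longleftrightarrow>
     cocone \<C> r D d L l \<and>
     (\<forall>X x. cocone \<C> r D d X x \<longrightarrow>
        (\<exists>!h. h \<in> hom \<C> L X \<and> (\<forall>i \<in> Field r. Comp \<C> h (l i) = x i)))"

definition has_directed_colimits ::
  "'u itself \<Rightarrow> 'l rel \<Rightarrow> ('o, 'a) cat \<Rightarrow> bool" where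
  "has_directed_colimits _ l \<C> \<longleftrightarrow>
     (\<forall>(r :: 'u rel) D d. directed_poset l r \<and> diagram \<C> r D d \<longrightarrow>
        (\<exists>L x. colimit \<C> r D d L x))"

text \<open>\<open>X\<close> is \<open>l\<close>-presentable if \<open>Hom(X, -)\<close> preserves \<open>l\<close>-directed colimits, which for directed
  colimits of sets says: every arrow from \<open>X\<close> into the colimit factors through the diagram, and
  any two factorizations through the same vertex are identified at a later one.\<close>

definition presentable :: "'u rel \<Rightarrow> ('o, 'a) cat \<Rightarrow> 'o \<Rightarrow> bool" where
  "presentable l \<C> X \<longleftrightarrow>
     X \<in> Obj \<C> \<and>
     (\<forall>(r :: 'u rel) D d L x.
        directed_poset l r \<and> diagram \<C> r D d \<and> colimit \<C> r D d L x \<longrightarrow>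
          (\<forall>f \<in> hom \<C> X L. \<exists>i \<in> Field r. \<exists>g \<in> hom \<C> X (D i). f = Comp \<C> (x i) g) \<and>
          (\<forall>i \<in> Field r. \<forall>g \<in> hom \<C> X (D i). \<forall>h \<in> hom \<C> X (D i).
             Comp \<C> (x i) g = Comp \<C> (x i) h \<longrightarrow>
             (\<exists>j. (i, j) \<in> r \<and> Comp \<C> (d i j) g = Comp \<C> (d i j) h)))"

definition accessible :: "'u itself \<Rightarrow> ('o, 'a) cat \<Rightarrow> bool" where
  "accessible U \<C> \<longleftrightarrow>
     category \<C> \<and> locally_small U \<C> \<and>
     (\<exists>l :: 'u rel. small_regular_cardinal l \<and>
        has_directed_colimits U l \<C> \<and>
        (\<exists>P. small U P \<and> (\<forall>X \<in> P. presentable l \<C> X) \<and>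
           (\<forall>X \<in> Obj \<C>. \<exists>(r :: 'u rel) D d x.
              directed_poset l r \<and> diagram \<C> r D d \<and> (\<forall>i \<in> Field r. D i \<in> P) \<and>
              colimit \<C> r D d X x)))"


section \<open>AECats and Galois types\<close>

definition AECat :: "'u itself \<Rightarrow> ('o, 'a) cat \<Rightarrow> 'o set \<Rightarrow> bool" where
  "AECat U \<C> \<M> \<longleftrightarrow>
     accessible U \<C> \<and> \<M> \<subseteq> Obj \<C> \<and> accessible U (full_subcat \<C> \<M>) \<and>
     has_directed_colimits U natLeq (full_subcat \<C> \<M>) \<and>
     (\<forall>(r :: 'u rel) D d L x.
        directed_poset natLeq r \<and> diagram (full_subcat \<C> \<M>) r D d \<and>
        colimit (full_subcat \<C> \<M>) r D d L x \<longrightarrow> colimit \<C> r D d L x) \<and>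
     (\<forall>f \<in> Arr \<C>. mono_arr \<C> f)"

definition amalgamation_property :: "('o, 'a) cat \<Rightarrow> 'o set \<Rightarrow> bool" where
  "amalgamation_property \<C> \<M> \<longleftrightarrow>
     (\<forall>M \<in> \<M>. \<forall>N1 \<in> \<M>. \<forall>N2 \<in> \<M>. \<forall>f1 \<in> hom \<C> M N1. \<forall>f2 \<in> hom \<C> M N2.
        \<exists>N \<in> \<M>. \<exists>g1 \<in> hom \<C> N1 N. \<exists>g2 \<in> hom \<C> N2 N. Comp \<C> g1 f1 = Comp \<C> g2 f2)"

text \<open>\<open>gtp_eq \<C> \<M> as M bs M'\<close> is \<open>gtp(as; M) = gtp(bs; M')\<close>, for finite tuples.\<close>

definition gtp_eq ::
  "('o, 'a) cat \<Rightarrow> 'o set \<Rightarrow> 'a list \<Rightarrow> 'o \<Rightarrow> 'a list \<Rightarrow> 'o \<Rightarrow> bool" where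
  "gtp_eq \<C> \<M> as M bs M' \<longleftrightarrow>
     M \<in> \<M> \<and> M' \<in> \<M> \<and>
     (\<forall>a \<in> set as. a \<in> Arr \<C> \<and> Cod \<C> a = M) \<and> (\<forall>b \<in> set bs. b \<in> Arr \<C> \<and> Cod \<C> b = M') \<and>
     map (Dom \<C>) as = map (Dom \<C>) bs \<and>
     (\<exists>N \<in> \<M>. \<exists>f \<in> hom \<C> M N. \<exists>f' \<in> hom \<C> M' N. map (Comp \<C> f) as = map (Comp \<C> f') bs)"

text \<open>\<open>sub_le \<C> x y\<close>: \<open>x\<close> factors through \<open>y\<close>, i.e. \<open>x \<le> y\<close> as subobjects. All arrows of an
  AECat being monomorphisms, a subobject of \<open>M\<close> is a class of mutually factoring arrows into \<open>M\<close>.\<close>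

definition sub_le :: "('o, 'a) cat \<Rightarrow> 'a \<Rightarrow> 'a \<Rightarrow> bool" where
  "sub_le \<C> x y \<longleftrightarrow>
     x \<in> Arr \<C> \<and> y \<in> Arr \<C> \<and> Cod \<C> x = Cod \<C> y \<and>
     (\<exists>h \<in> hom \<C> (Dom \<C> x) (Dom \<C> y). x = Comp \<C> y h)"

definition subobj :: "('o, 'a) cat \<Rightarrow> 'a \<Rightarrow> 'a set" where
  "subobj \<C> x = {y. sub_le \<C> x y \<and> sub_le \<C> y x}"

definition subobjects :: "('o, 'a) cat \<Rightarrow> 'o \<Rightarrow> 'a set set" where
  "subobjects \<C> M = {subobj \<C> x |x. x \<in> Arr \<C> \<and> Cod \<C> x = M}"


section \<open>Independence relations\<close>

text \<open>For \<open>I :: ('o, 'a) indep\<close>, \<open>I M A C B\<close> says that \<open>A\<close> is independent from \<open>B\<close> over \<open>C\<close> in \<open>M\<close>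
  (the base is the middle argument).\<close>

type_synonym ('o, 'a) indep = "'o \<Rightarrow> 'a set \<Rightarrow> 'a set \<Rightarrow> 'a set \<Rightarrow> bool"

definition ind :: "('o, 'a) cat \<Rightarrow> ('o, 'a) indep \<Rightarrow> 'o \<Rightarrow> 'a \<Rightarrow> 'a \<Rightarrow> 'a \<Rightarrow> bool" where
  "ind \<C> I M a c b \<longleftrightarrow> I M (subobj \<C> a) (subobj \<C> c) (subobj \<C> b)"

definition independence_relation ::
  "('o, 'a) cat \<Rightarrow> 'o set \<Rightarrow> ('o, 'a) indep \<Rightarrow> 'o set \<Rightarrow> bool" where
  "independence_relation \<C> \<M> I base \<longleftrightarrow>
     (\<forall>M A C B. I M A C B \<longrightarrow>
        M \<in> \<M> \<and> A \<in> subobjects \<C> M \<and> C \<in> subobjects \<C> M \<and> B \<in> subobjects \<C> M) \<and>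
     \<M> \<subseteq> base \<and> base \<subseteq> Obj \<C> \<and>
     (\<forall>M a c b. a \<in> Arr \<C> \<and> b \<in> Arr \<C> \<and> c \<in> Arr \<C> \<and> ind \<C> I M a c b \<longrightarrow> Dom \<C> c \<in> base)"

definition ind_invariance :: "('o, 'a) cat \<Rightarrow> 'o set \<Rightarrow> ('o, 'a) indep \<Rightarrow> bool" where
  "ind_invariance \<C> \<M> I \<longleftrightarrow>
     (\<forall>M M' a b c a' b' c'.
        ind \<C> I M a c b \<and> gtp_eq \<C> \<M> [a, b, c] M [a', b', c'] M' \<longrightarrow> ind \<C> I M' a' c' b')"

definition ind_monotonicity :: "('o, 'a) cat \<Rightarrow> ('o, 'a) indep \<Rightarrow> bool" where
  "ind_monotonicity \<C> I \<longleftrightarrow>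
     (\<forall>M a a' b c. ind \<C> I M a c b \<and> sub_le \<C> a' a \<longrightarrow> ind \<C> I M a' c b)"

definition ind_transitivity :: "('o, 'a) cat \<Rightarrow> ('o, 'a) indep \<Rightarrow> bool" where
  "ind_transitivity \<C> I \<longleftrightarrow>
     (\<forall>M a b c d. ind \<C> I M a b c \<and> ind \<C> I M a c d \<and> sub_le \<C> b c \<longrightarrow> ind \<C> I M a b d)"

definition ind_symmetry :: "('o, 'a) cat \<Rightarrow> ('o, 'a) indep \<Rightarrow> bool" where
  "ind_symmetry \<C> I \<longleftrightarrow> (\<forall>M a b c. ind \<C> I M a c b \<longrightarrow> ind \<C> I M b c a)"

definition ind_existence ::
  "('o, 'a) cat \<Rightarrow> 'o set \<Rightarrow> ('o, 'a) indep \<Rightarrow> 'o set \<Rightarrow> bool" where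
  "ind_existence \<C> \<M> I base \<longleftrightarrow>
     (\<forall>M \<in> \<M>. \<forall>a \<in> Arr \<C>. \<forall>c \<in> Arr \<C>.
        Cod \<C> a = M \<and> Cod \<C> c = M \<and> Dom \<C> c \<in> base \<longrightarrow> ind \<C> I M a c c)"

definition ind_extension :: "('o, 'a) cat \<Rightarrow> 'o set \<Rightarrow> ('o, 'a) indep \<Rightarrow> bool" where
  "ind_extension \<C> \<M> I \<longleftrightarrow>
     (\<forall>M \<in> \<M>. \<forall>a \<in> Arr \<C>. \<forall>b \<in> Arr \<C>. \<forall>c \<in> Arr \<C>. \<forall>b' \<in> Arr \<C>.
        Cod \<C> a = M \<and> Cod \<C> b = M \<and> Cod \<C> c = M \<and> Cod \<C> b' = M \<and>
        ind \<C> I M a c b \<and> sub_le \<C> b b' \<longrightarrow>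
        (\<exists>N \<in> \<M>. \<exists>f \<in> hom \<C> M N. \<exists>a' \<in> hom \<C> (Dom \<C> a) N.
           gtp_eq \<C> \<M> [a', Comp \<C> f b, Comp \<C> f c] N [a, b, c] M \<and>
           ind \<C> I N a' (Comp \<C> f c) (Comp \<C> f b')))"

definition ind_union :: "'u itself \<Rightarrow> ('o, 'a) cat \<Rightarrow> 'o set \<Rightarrow> ('o, 'a) indep \<Rightarrow> bool" where
  "ind_union _ \<C> \<M> I \<longleftrightarrow>
     (\<forall>(r :: 'u rel) D d. \<forall>M \<in> \<M>. \<forall>m B l b a c.
        directed_poset natLeq r \<and> diagram \<C> r D d \<and> cocone \<C> r D d M m \<and>
        colimit \<C> r D d B l \<and> b \<in> hom \<C> B M \<and> (\<forall>i \<in> Field r. Comp \<C> b (l i) = m i) \<and>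
        a \<in> Arr \<C> \<and> c \<in> Arr \<C> \<and> Cod \<C> a = M \<and> Cod \<C> c = M \<and>
        (\<forall>i \<in> Field r. ind \<C> I M a c (m i)) \<longrightarrow>
        ind \<C> I M a c b)"

definition basic_independence_relation ::
  "'u itself \<Rightarrow> ('o, 'a) cat \<Rightarrow> 'o set \<Rightarrow> ('o, 'a) indep \<Rightarrow> 'o set \<Rightarrow> bool" where
  "basic_independence_relation U \<C> \<M> I base \<longleftrightarrow>
     independence_relation \<C> \<M> I base \<and>
     ind_invariance \<C> \<M> I \<and> ind_monotonicity \<C> I \<and> ind_transitivity \<C> I \<and>
     ind_symmetry \<C> I \<and> ind_existence \<C> \<M> I base \<and> ind_extension \<C> \<M> I \<and> ind_union U \<C> \<M> I"

definition three_amalgamation :: "('o, 'a) cat \<Rightarrow> 'o set \<Rightarrow> ('o, 'a) indep \<Rightarrow> bool" where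
  "three_amalgamation \<C> \<M> I \<longleftrightarrow>
     (\<forall>M \<in> \<M>. \<forall>N1 \<in> \<M>. \<forall>N2 \<in> \<M>. \<forall>N3 \<in> \<M>. \<forall>A \<in> Obj \<C>. \<forall>B \<in> Obj \<C>. \<forall>C \<in> Obj \<C>.
      \<forall>a1 \<in> hom \<C> A N1. \<forall>a3 \<in> hom \<C> A N3.
      \<forall>b1 \<in> hom \<C> B N1. \<forall>b2 \<in> hom \<C> B N2.
      \<forall>c2 \<in> hom \<C> C N2. \<forall>c3 \<in> hom \<C> C N3.
      \<forall>m1 \<in> hom \<C> M N1. \<forall>m2 \<in> hom \<C> M N2. \<forall>m3 \<in> hom \<C> M N3.
        ind \<C> I N1 a1 m1 b1 \<and> ind \<C> I N2 b2 m2 c2 \<and> ind \<C> I N3 c3 m3 a3 \<and>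
        gtp_eq \<C> \<M> [a1, m1] N1 [a3, m3] N3 \<and>
        gtp_eq \<C> \<M> [b1, m1] N1 [b2, m2] N2 \<and>
        gtp_eq \<C> \<M> [c2, m2] N2 [c3, m3] N3 \<longrightarrow>
        (\<exists>N \<in> \<M>. \<exists>f1 \<in> hom \<C> N1 N. \<exists>f2 \<in> hom \<C> N2 N. \<exists>f3 \<in> hom \<C> N3 N.
           Comp \<C> f1 m1 = Comp \<C> f2 m2 \<and> Comp \<C> f2 m2 = Comp \<C> f3 m3 \<and>
           Comp \<C> f1 a1 = Comp \<C> f3 a3 \<and>
           Comp \<C> f1 b1 = Comp \<C> f2 b2 \<and>
           Comp \<C> f2 c2 = Comp \<C> f3 c3 \<and>
           ind \<C> I N (Comp \<C> f1 a1) (Comp \<C> f1 m1) f2))"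


section \<open>Lascar types, bounded invariant equivalence, 2-indiscernibles\<close>

text \<open>An arrow \<open>a : A \<rightarrow> M\<close> is identified with its composite with any extension of \<open>M\<close>. Accordingly
  the chains witnessing the transitive closures below may run through arrows into an extension
  of \<open>M\<close>; the given \<open>M\<close> need not realize the intermediate elements.\<close>

definition trancl_in_extensions ::
  "('o, 'a) cat \<Rightarrow> 'o set \<Rightarrow> ('o \<Rightarrow> 'a \<Rightarrow> 'a \<Rightarrow> 'a \<Rightarrow> bool) \<Rightarrow> 'o \<Rightarrow> 'a \<Rightarrow> 'a \<Rightarrow> 'a \<Rightarrow> bool" where
  "trancl_in_extensions \<C> \<M> R M c a b \<longleftrightarrow>
     (\<exists>N \<in> \<M>. \<exists>f \<in> hom \<C> M N. (R N (Comp \<C> f c))\<^sup>+\<^sup>+ (Comp \<C> f a) (Comp \<C> f b))"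

text \<open>\<open>lgtp_step \<C> \<M> A M c a b\<close> is \<open>(a/c; M) \<sim> (b/c; M)\<close>.\<close>

definition lgtp_step ::
  "('o, 'a) cat \<Rightarrow> 'o set \<Rightarrow> 'o \<Rightarrow> 'o \<Rightarrow> 'a \<Rightarrow> 'a \<Rightarrow> 'a \<Rightarrow> bool" where
  "lgtp_step \<C> \<M> A M c a b \<longleftrightarrow>
     a \<in> hom \<C> A M \<and> b \<in> hom \<C> A M \<and>
     (\<exists>N \<in> \<M>. \<exists>f \<in> hom \<C> M N. \<exists>M0 \<in> \<M>. \<exists>m0 \<in> hom \<C> M0 N.
        sub_le \<C> (Comp \<C> f c) m0 \<and>
        gtp_eq \<C> \<M> [Comp \<C> f a, m0] N [Comp \<C> f b, m0] N)"

definition lgtp_eq ::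
  "('o, 'a) cat \<Rightarrow> 'o set \<Rightarrow> 'o \<Rightarrow> 'o \<Rightarrow> 'a \<Rightarrow> 'a \<Rightarrow> 'a \<Rightarrow> bool" where
  "lgtp_eq \<C> \<M> A = trancl_in_extensions \<C> \<M> (lgtp_step \<C> \<M> A)"

text \<open>\<open>E M c\<close> is the equivalence relation on \<open>Hom(A, M)\<close> assigned to \<open>c : C \<rightarrow> M\<close>.\<close>

definition equivalence_relation_over ::
  "('o, 'a) cat \<Rightarrow> 'o set \<Rightarrow> 'o \<Rightarrow> 'o \<Rightarrow> ('o \<Rightarrow> 'a \<Rightarrow> 'a rel) \<Rightarrow> bool" where
  "equivalence_relation_over \<C> \<M> A C E \<longleftrightarrow>
     (\<forall>M \<in> \<M>. \<forall>c \<in> hom \<C> C M. equiv (hom \<C> A M) (E M c))"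

definition bounded_equivalence ::
  "'u itself \<Rightarrow> ('o, 'a) cat \<Rightarrow> 'o set \<Rightarrow> 'o \<Rightarrow> 'o \<Rightarrow> ('o \<Rightarrow> 'a \<Rightarrow> 'a rel) \<Rightarrow> bool" where
  "bounded_equivalence U \<C> \<M> A C E \<longleftrightarrow>
     (\<exists>l :: 'u rel. Card_order l \<and> small U (Field l) \<and>
        (\<forall>M \<in> \<M>. \<forall>c \<in> hom \<C> C M. |hom \<C> A M // E M c| \<le>o l))"

definition invariant_equivalence ::
  "('o, 'a) cat \<Rightarrow> 'o set \<Rightarrow> 'o \<Rightarrow> 'o \<Rightarrow> ('o \<Rightarrow> 'a \<Rightarrow> 'a rel) \<Rightarrow> bool" where
  "invariant_equivalence \<C> \<M> A C E \<longleftrightarrow>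
     (\<forall>M \<in> \<M>. \<forall>M' \<in> \<M>. \<forall>a \<in> hom \<C> A M. \<forall>b \<in> hom \<C> A M. \<forall>c \<in> hom \<C> C M.
      \<forall>a' \<in> hom \<C> A M'. \<forall>b' \<in> hom \<C> A M'. \<forall>c' \<in> hom \<C> C M'.
        gtp_eq \<C> \<M> [a, b, c] M [a', b', c'] M' \<longrightarrow> ((a, b) \<in> E M c \<longleftrightarrow> (a', b') \<in> E M' c'))"

definition bounded_equiv ::
  "'u itself \<Rightarrow> ('o, 'a) cat \<Rightarrow> 'o set \<Rightarrow> 'o \<Rightarrow> 'o \<Rightarrow> 'o \<Rightarrow> 'a \<Rightarrow> 'a \<Rightarrow> 'a \<Rightarrow> bool" where
  "bounded_equiv U \<C> \<M> A C M c a b \<longleftrightarrow>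
     (\<forall>E. equivalence_relation_over \<C> \<M> A C E \<and> bounded_equivalence U \<C> \<M> A C E \<and>
          invariant_equivalence \<C> \<M> A C E \<longrightarrow> (a, b) \<in> E M c)"

text \<open>Sequences are indexed by the field of a well-order \<open>r\<close>, which stands for their length.\<close>

definition two_indiscernible ::
  "('o, 'a) cat \<Rightarrow> 'o set \<Rightarrow> 'o \<Rightarrow> 'o \<Rightarrow> 'a \<Rightarrow> 'u rel \<Rightarrow> ('u \<Rightarrow> 'a) \<Rightarrow> bool" where
  "two_indiscernible \<C> \<M> A N c r s \<longleftrightarrow>
     small_ordinal r \<and> (\<forall>i \<in> Field r. s i \<in> hom \<C> A N) \<and>
     (\<forall>i1 i2 j1 j2. (i1, i2) \<in> r \<and> i1 \<noteq> i2 \<and> (j1, j2) \<in> r \<and> j1 \<noteq> j2 \<longrightarrow>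
        gtp_eq \<C> \<M> [s i1, c] N [s i2, c] N \<and>
        gtp_eq \<C> \<M> [s i1, s i2, c] N [s j1, s j2, c] N)"

text \<open>\<open>embed r r' e\<close> makes \<open>r\<close> an initial segment of \<open>r'\<close>.\<close>

definition strongly_two_indiscernible ::
  "('o, 'a) cat \<Rightarrow> 'o set \<Rightarrow> 'o \<Rightarrow> 'o \<Rightarrow> 'a \<Rightarrow> 'u rel \<Rightarrow> ('u \<Rightarrow> 'a) \<Rightarrow> bool" where
  "strongly_two_indiscernible \<C> \<M> A N c r s \<longleftrightarrow>
     two_indiscernible \<C> \<M> A N c r s \<and>
     (\<forall>\<gamma> :: 'u rel. small_ordinal \<gamma> \<longrightarrow>
        (\<exists>N' \<in> \<M>. \<exists>f \<in> hom \<C> N N'. \<exists>(r' :: 'u rel) s' e.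
           two_indiscernible \<C> \<M> A N' (Comp \<C> f c) r' s' \<and> \<gamma> \<le>o r' \<and>
           embed r r' e \<and> (\<forall>i \<in> Field r. s' (e i) = Comp \<C> f (s i))))"

definition two_indisc_step ::
  "'u itself \<Rightarrow> ('o, 'a) cat \<Rightarrow> 'o set \<Rightarrow> 'o \<Rightarrow> 'o \<Rightarrow> 'a \<Rightarrow> 'a \<Rightarrow> 'a \<Rightarrow> bool" where
  "two_indisc_step _ \<C> \<M> A M c a b \<longleftrightarrow>
     a \<in> hom \<C> A M \<and> b \<in> hom \<C> A M \<and>
     (\<exists>N \<in> \<M>. \<exists>f \<in> hom \<C> M N. \<exists>(r :: 'u rel) s. \<exists>i \<in> Field r. \<exists>j \<in> Field r.
        strongly_two_indiscernible \<C> \<M> A N (Comp \<C> f c) r s \<and>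
        s i = Comp \<C> f a \<and> s j = Comp \<C> f b)"

definition two_indisc_equiv ::
  "'u itself \<Rightarrow> ('o, 'a) cat \<Rightarrow> 'o set \<Rightarrow> 'o \<Rightarrow> 'o \<Rightarrow> 'a \<Rightarrow> 'a \<Rightarrow> 'a \<Rightarrow> bool" where
  "two_indisc_equiv U \<C> \<M> A = trancl_in_extensions \<C> \<M> (two_indisc_step U \<C> \<M> A)"

end

theory Submission
  imports Defs
begin

text \<open>
  Classes of a bounded equivalence relation that is invariant cannot separate two members of a
  strongly 2-indiscernible sequence, as a long extension of the sequence would have more classes
  than the bound. Lascar types form a bounded invariant equivalence relation: by a
  Loewenheim--Skolem argument in accessible categories, \<open>c\<close> factors through one of a small set of
  models \<open>M0\<close>, and there are only few types over each.

  Conversely, let \<open>a\<close> and \<open>b\<close> have the same type over a model \<open>m\<close>. Existence and Extension give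
  \<open>a'\<close> of this type that is independent over \<open>m\<close> from both, so it is enough to put independent
  \<open>x\<close> and \<open>y\<close> of the same type over \<open>m\<close> on a strongly 2-indiscernible sequence. This
  sequence grows along with a chain of models \<open>S\<^sub>i\<close> and a parallel chain of extensions
  \<open>S\<^sub>i \<rightarrow> K\<^sub>i\<close> containing coherent realizations \<open>\<alpha>\<^sub>i\<close> of \<open>gtp(x, m)\<close> independent from \<open>S\<^sub>i\<close>. At
  successors, \<open>S\<^bsub>i+1\<^esub> = K\<^sub>i\<close>, and 3-amalgamation gives \<open>\<alpha>\<^bsub>i+1\<^esub>\<close> that relates to \<open>\<alpha>\<^sub>i\<close> as \<open>x\<close> does to
  \<open>y\<close>; at limits both chains have colimits, and Union preserves independence. Then the images of
  the \<open>\<alpha>\<^sub>i\<close> form the sequence.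
\<close>

section \<open>Small sets\<close>

text \<open>No monster model is at hand, and nothing guarantees that types extending one another
  along a chain of models have a common extension over its colimit. So no realization is chosen at a
  limit: it is obtained from the earlier ones, which therefore have to correspond under maps
  \<open>K_i -> K_j\<close>. A single coherent element yields a whole sequence because
  3-amalgamation produces two maps from \<open>K_i\<close> into the next \<open>K\<close>, equal on
  \<open>S_i\<close>. One carries \<open>\<alpha>_i\<close> to its successor and continues the
  chain; the other is the new extension, with domain \<open>K_i\<close> as the next
  \<open>S\<close>, and leaves behind a copy of \<open>\<alpha>_i\<close> that becomes a member of
  the sequence. The obstacle for boundedness is that the two categories are accessible for unrelated
  cardinals, so that a presentation of a model by models need not be directed enough for the
  presentable objects of the ambient category.\<close>

text \<open>The parameter \<open>U\<close> only ties the locale to the type \<open>'u\<close>.\<close>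

locale universe =
  fixes U :: "'u itself"
  assumes universe: "Grothendieck_universe TYPE('u)"
begin

lemma UNIV_infinite: "infinite (UNIV :: 'u set)"
  using universe ordLess_imp_ordLeq infinite_iff_natLeq_ordLeq
  unfolding Grothendieck_universe_def by blast

lemma Cinfinite_UNIV: "Cinfinite |UNIV :: 'u set|"
  using UNIV_infinite card_of_Card_order by (metis cinfinite_def Field_card_of)

lemma small_mono: "small TYPE('u) Y \<Longrightarrow> |X| \<le>o |Y| \<Longrightarrow> small TYPE('u) X"
  unfolding small_def by (rule ordLeq_ordLess_trans)

lemma small_subset: "small TYPE('u) Y \<Longrightarrow> X \<subseteq> Y \<Longrightarrow> small TYPE('u) X"
  using small_mono card_of_mono1 by blast

lemma small_image: "small TYPE('u) X \<Longrightarrow> small TYPE('u) (f ` X)"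
  using small_mono card_of_image by blast

lemma small_finite: "finite X \<Longrightarrow> small TYPE('u) X"
  unfolding small_def using UNIV_infinite
  by (intro finite_ordLess_infinite card_of_Well_order) (simp_all add: Field_card_of)

lemma small_Un: "small TYPE('u) X \<Longrightarrow> small TYPE('u) Y \<Longrightarrow> small TYPE('u) (X \<union> Y)"
  unfolding small_def by (rule card_of_Un_ordLess_infinite[OF UNIV_infinite])

lemma small_UN:
  assumes "small TYPE('u) X" "\<And>x. x \<in> X \<Longrightarrow> small TYPE('u) (F x)"
  shows "small TYPE('u) (\<Union>x\<in>X. F x)"
  using assms card_of_UNION_ordLess_infinite_Field_regularCard[OF _ Cinfinite_UNIV] universe
  unfolding small_def Grothendieck_universe_def by blast

lemma small_Times:
  assumes "small TYPE('u) X" "small TYPE('u) Y"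
  shows "small TYPE('u) (X \<times> Y)"
proof -
  have "X \<times> Y = (\<Union>x\<in>X. Pair x ` Y)" by auto
  then show ?thesis using small_UN[OF assms(1)] small_image[OF assms(2)] by metis
qed

text \<open>Bounds and ordinals have to be relations on \<open>'u\<close>, whereas the sets to be
  counted consist of subsets or of tuples of arrows; this moves their cardinality to
  \<open>'u\<close>.\<close>

lemma small_code:
  assumes "small TYPE('u) X"
  obtains Y :: "'u set" where "|X| =o |Y|" "small TYPE('u) Y"
proof -
  from internalize_card_of_ordLess[of X "|UNIV :: 'u set|"] assms
  obtain Y :: "'u set" where "|X| =o |Y|" "|Y| <o |UNIV :: 'u set|"
    unfolding small_def by auto
  then show thesis using that by (auto simp: small_def)
qed

lemma small_inj_into:
  assumes "small TYPE('u) X"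
  obtains f :: "'x \<Rightarrow> 'u" where "inj_on f (X :: 'x set)"
proof -
  have "|X| \<le>o |UNIV :: 'u set|" using assms unfolding small_def by (rule ordLess_imp_ordLeq)
  then show thesis using that card_of_ordLeq[of X "UNIV :: 'u set"] by auto
qed

lemma small_Pow:
  assumes "small TYPE('u) X"
  shows "small TYPE('u) (Pow X)"
proof -
  obtain Y :: "'u set" where Y: "|X| =o |Y|" "small TYPE('u) Y" using small_code[OF assms] .
  then obtain f where f: "bij_betw f X Y" using card_of_ordIso by blast
  then have "bij_betw (image f) (Pow X) (Pow Y)" by (rule bij_betw_Pow)
  then have "|Pow X| =o |Pow Y|" using card_of_ordIso by blast
  moreover have "|Pow Y| <o |UNIV :: 'u set|"
    using Y(2) universe unfolding small_def Grothendieck_universe_def by blast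
  ultimately show ?thesis unfolding small_def by (rule ordIso_ordLess_trans)
qed

lemma small_Func:
  assumes "small TYPE('u) X" "small TYPE('u) Y"
  shows "small TYPE('u) (Func X Y)"
proof -
  let ?g = "\<lambda>f. (\<lambda>x. (x, f x)) ` X"
  have "?g ` Func X Y \<subseteq> Pow (X \<times> Y)" by (auto simp: Func_def)
  moreover have "inj_on ?g (Func X Y)"
  proof (rule inj_onI)
    fix f g assume fg: "f \<in> Func X Y" "g \<in> Func X Y" "?g f = ?g g"
    show "f = g"
    proof
      fix x show "f x = g x"
      proof (cases "x \<in> X")
        case True
        then have "(x, f x) \<in> ?g g" using fg(3) by blast
        then show ?thesis by auto
      qed (use fg in \<open>auto simp: Func_def\<close>)
    qed
  qed
  ultimately have "|Func X Y| \<le>o |Pow (X \<times> Y)|" using card_of_ordLeq by blast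
  then show ?thesis using small_mono small_Pow[OF small_Times[OF assms]] by blast
qed

lemma larger_small_ordinal:
  assumes "Card_order (l :: 'u rel)" "small TYPE('u) (Field l)"
  obtains \<gamma> :: "'u rel" where "small_ordinal \<gamma>" "Card_order \<gamma>" "l <o \<gamma>"
proof -
  obtain Y :: "'u set" where Y: "|Pow (Field l)| =o |Y|" "small TYPE('u) Y"
    using small_code[OF small_Pow[OF assms(2)]] .
  then have "l <o |Y|"
    using Card_order_Pow[OF assms(1)] ordLess_ordIso_trans by blast
  moreover have "small_ordinal |Y|"
    using Y(2) card_of_Well_order unfolding small_ordinal_def Field_card_of by auto
  ultimately show thesis using that card_of_Card_order by blast
qed

end

section \<open>Galois types\<close>

locale cat =
  fixes \<C> :: "('o, 'a) cat"
  assumes category: "category \<C>"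
begin

abbreviation comp (infixr "\<cdot>" 70) where "g \<cdot> f \<equiv> Comp \<C> g f"

lemma comp_hom: "f \<in> hom \<C> X Y \<Longrightarrow> g \<in> hom \<C> Y Z \<Longrightarrow> g \<cdot> f \<in> hom \<C> X Z"
  using category unfolding category_def hom_def by fastforce

lemma comp_assoc:
  "f \<in> hom \<C> W X \<Longrightarrow> g \<in> hom \<C> X Y \<Longrightarrow> h \<in> hom \<C> Y Z \<Longrightarrow> (h \<cdot> g) \<cdot> f = h \<cdot> (g \<cdot> f)"
  using category unfolding category_def hom_def by simp

lemma id_hom [intro]: "X \<in> Obj \<C> \<Longrightarrow> Id \<C> X \<in> hom \<C> X X"
  using category unfolding category_def by blast

lemma comp_id: "f \<in> hom \<C> X Y \<Longrightarrow> f \<cdot> Id \<C> X = f"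
  and id_comp: "f \<in> hom \<C> X Y \<Longrightarrow> Id \<C> Y \<cdot> f = f"
  using category unfolding category_def hom_def by auto

lemma hom_obj: "f \<in> hom \<C> X Y \<Longrightarrow> X \<in> Obj \<C> \<and> Y \<in> Obj \<C>"
  using category unfolding category_def hom_def by blast

lemma sub_leI:
  assumes "h \<in> hom \<C> X Y" "y \<in> hom \<C> Y M" "x = y \<cdot> h"
  shows "sub_le \<C> x y"
proof -
  have "x \<in> hom \<C> X M" using assms comp_hom by simp
  moreover have "y \<in> Arr \<C> \<and> Cod \<C> y = M \<and> h \<in> hom \<C> (Dom \<C> x) (Dom \<C> y)"
    using assms(1,2) calculation by (auto simp: hom_def)
  ultimately show ?thesis using assms(3) by (auto simp: sub_le_def hom_def)
qed

lemma sub_leE: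
  assumes "sub_le \<C> x y" "x \<in> hom \<C> X M" "y \<in> hom \<C> Y M"
  obtains h where "h \<in> hom \<C> X Y" "x = y \<cdot> h"
  using assms by (auto simp: sub_le_def hom_def)

lemma colimit_cocone: "colimit \<C> r D d L l \<Longrightarrow> cocone \<C> r D d L l"
  by (simp add: colimit_def)

lemma colimit_induced:
  assumes "colimit \<C> r D d L l" "cocone \<C> r D d X x"
  obtains h where "h \<in> hom \<C> L X" "\<And>i. i \<in> Field r \<Longrightarrow> h \<cdot> l i = x i"
proof -
  have "\<exists>!h. h \<in> hom \<C> L X \<and> (\<forall>i\<in>Field r. h \<cdot> l i = x i)"
    using assms by (simp add: colimit_def)
  then show thesis using that by (elim ex1E conjE) blast
qed

lemma cocone_comp:
  assumes "diagram \<C> r D d" "cocone \<C> r D d L l" "h \<in> hom \<C> L X"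
  shows "cocone \<C> r D d X (\<lambda>i. h \<cdot> l i)"
  unfolding cocone_def
proof (intro conjI ballI allI impI)
  show "X \<in> Obj \<C>" using hom_obj[OF assms(3)] by blast
next
  fix i assume "i \<in> Field r"
  then show "h \<cdot> l i \<in> hom \<C> (D i) X" using assms(2,3) comp_hom by (auto simp: cocone_def)
next
  fix i j assume ij: "(i, j) \<in> r"
  then have "d i j \<in> hom \<C> (D i) (D j)" "l j \<in> hom \<C> (D j) L" "l j \<cdot> d i j = l i"
    using assms(1,2) by (auto simp: diagram_def cocone_def Field_def)
  then show "(h \<cdot> l j) \<cdot> d i j = h \<cdot> l i" using comp_assoc assms(3) by metis
qed

lemma colimit_unique:
  assumes "diagram \<C> r D d" "colimit \<C> r D d L l" "g \<in> hom \<C> L X" "h \<in> hom \<C> L X"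
    and "\<And>i. i \<in> Field r \<Longrightarrow> g \<cdot> l i = h \<cdot> l i"
  shows "g = h"
proof -
  have "\<exists>!k. k \<in> hom \<C> L X \<and> (\<forall>i\<in>Field r. k \<cdot> l i = h \<cdot> l i)"
    using cocone_comp[OF assms(1) colimit_cocone[OF assms(2)] assms(4)] assms(2)
    by (simp add: colimit_def)
  then show ?thesis by (elim ex1E) (use assms(3-5) in blast)
qed

end

locale aecat = universe U + cat \<C>
  for U :: "'u itself" and \<C> :: "('o, 'a) cat" +
  fixes \<M> :: "'o set"
  assumes AECat: "AECat TYPE('u) \<C> \<M>"
    and AP: "amalgamation_property \<C> \<M>"
begin

lemma models_obj: "M \<in> \<M> \<Longrightarrow> M \<in> Obj \<C>"
  using AECat by (auto simp: AECat_def)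

lemma mono_cancel:
  assumes "f \<in> hom \<C> Y Z" "g \<in> hom \<C> X Y" "h \<in> hom \<C> X Y" "f \<cdot> g = f \<cdot> h"
  shows "g = h"
proof -
  have "mono_arr \<C> f" using AECat assms(1) by (auto simp: AECat_def hom_def)
  moreover have "X \<in> Obj \<C>" using hom_obj[OF assms(2)] by blast
  ultimately show ?thesis using assms unfolding mono_arr_def hom_def by blast
qed

lemma amalgamate:
  assumes "f \<in> hom \<C> M N1" "g \<in> hom \<C> M N2" "M \<in> \<M>" "N1 \<in> \<M>" "N2 \<in> \<M>"
  obtains N f' g' where "N \<in> \<M>" "f' \<in> hom \<C> N1 N" "g' \<in> hom \<C> N2 N" "f' \<cdot> f = g' \<cdot> g"
  using AP assms unfolding amalgamation_property_def by blast

text \<open>Pairing the components keeps the common domain of corresponding arrows next to the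
  equation between them; associativity of composition can then be applied to each pair.\<close>

lemma gtp_eq_iff:
  "gtp_eq \<C> \<M> as M bs M' \<longleftrightarrow> M \<in> \<M> \<and> M' \<in> \<M> \<and>
    (\<exists>N\<in>\<M>. \<exists>f\<in>hom \<C> M N. \<exists>f'\<in>hom \<C> M' N.
       list_all2 (\<lambda>a b. \<exists>X. a \<in> hom \<C> X M \<and> b \<in> hom \<C> X M' \<and> f \<cdot> a = f' \<cdot> b) as bs)"
proof -
  have "list_all2 (\<lambda>a b. \<exists>X. a \<in> hom \<C> X M \<and> b \<in> hom \<C> X M' \<and> f \<cdot> a = f' \<cdot> b) as bs \<longleftrightarrow>
      (\<forall>a\<in>set as. a \<in> Arr \<C> \<and> Cod \<C> a = M) \<and> (\<forall>b\<in>set bs. b \<in> Arr \<C> \<and> Cod \<C> b = M') \<and>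
      map (Dom \<C>) as = map (Dom \<C>) bs \<and> map (Comp \<C> f) as = map (Comp \<C> f') bs" for f f'
    by (induction as bs rule: list_induct2') (auto simp: hom_def)
  then show ?thesis unfolding gtp_eq_def by simp
qed

lemma gtp_eqI:
  assumes "f \<in> hom \<C> M N" "f' \<in> hom \<C> M' N" "M \<in> \<M>" "M' \<in> \<M>" "N \<in> \<M>"
    and "list_all2 (\<lambda>a b. \<exists>X. a \<in> hom \<C> X M \<and> b \<in> hom \<C> X M' \<and> f \<cdot> a = f' \<cdot> b) as bs"
  shows "gtp_eq \<C> \<M> as M bs M'"
  using assms unfolding gtp_eq_iff by blast

lemma gtp_eqE:
  assumes "gtp_eq \<C> \<M> as M bs M'"
  obtains N f f' where "M \<in> \<M>" "M' \<in> \<M>" "N \<in> \<M>" "f \<in> hom \<C> M N" "f' \<in> hom \<C> M' N"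
    "list_all2 (\<lambda>a b. \<exists>X. a \<in> hom \<C> X M \<and> b \<in> hom \<C> X M' \<and> f \<cdot> a = f' \<cdot> b) as bs"
  using assms unfolding gtp_eq_iff by blast

lemma gtp_eq_extend:
  assumes "f \<in> hom \<C> M N" "M \<in> \<M>" "N \<in> \<M>"
    and "list_all2 (\<lambda>a b. \<exists>X. a \<in> hom \<C> X M \<and> b = f \<cdot> a) as bs"
  shows "gtp_eq \<C> \<M> as M bs N"
proof (rule gtp_eqI[OF assms(1) id_hom assms(2,3,3)])
  show "list_all2 (\<lambda>a b. \<exists>X. a \<in> hom \<C> X M \<and> b \<in> hom \<C> X N \<and> f \<cdot> a = Id \<C> N \<cdot> b) as bs"
    using assms(4)
  proof (rule list_all2_mono)
    fix a b assume "\<exists>X. a \<in> hom \<C> X M \<and> b = f \<cdot> a"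
    then obtain X where "a \<in> hom \<C> X M" "b = f \<cdot> a" by blast
    then show "\<exists>X. a \<in> hom \<C> X M \<and> b \<in> hom \<C> X N \<and> f \<cdot> a = Id \<C> N \<cdot> b"
      using comp_hom[of a X M f N] assms(1) id_comp by metis
  qed
qed (use assms(3) models_obj in blast)

lemma gtp_eq_sym: "gtp_eq \<C> \<M> as M bs M' \<Longrightarrow> gtp_eq \<C> \<M> bs M' as M"
  unfolding gtp_eq_def by metis

text \<open>The two witnessing extensions need not be comparable, but both extend the middle model
  \<open>M'\<close>, over which they are amalgamated.\<close>

lemma gtp_eq_trans:
  assumes "gtp_eq \<C> \<M> as M bs M'" "gtp_eq \<C> \<M> bs M' cs M''"
  shows "gtp_eq \<C> \<M> as M cs M''"
proof -
  obtain N f f' where 1: "M \<in> \<M>" "M' \<in> \<M>" "N \<in> \<M>" "f \<in> hom \<C> M N" "f' \<in> hom \<C> M' N"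
    "list_all2 (\<lambda>a b. \<exists>X. a \<in> hom \<C> X M \<and> b \<in> hom \<C> X M' \<and> f \<cdot> a = f' \<cdot> b) as bs"
    using gtp_eqE[OF assms(1)] .
  obtain N' g g' where 2: "M' \<in> \<M>" "M'' \<in> \<M>" "N' \<in> \<M>" "g \<in> hom \<C> M' N'" "g' \<in> hom \<C> M'' N'"
    "list_all2 (\<lambda>a b. \<exists>X. a \<in> hom \<C> X M' \<and> b \<in> hom \<C> X M'' \<and> g \<cdot> a = g' \<cdot> b) bs cs"
    using gtp_eqE[OF assms(2)] .
  obtain K h h' where 3: "K \<in> \<M>" "h \<in> hom \<C> N K" "h' \<in> hom \<C> N' K" "h \<cdot> f' = h' \<cdot> g"
    using amalgamate[OF 1(5) 2(4) 1(2,3) 2(3)] .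
  show ?thesis
  proof (rule gtp_eqI)
    show "h \<cdot> f \<in> hom \<C> M K" "h' \<cdot> g' \<in> hom \<C> M'' K" using 1 2 3 by (auto intro: comp_hom)
    show "list_all2 (\<lambda>a b. \<exists>X. a \<in> hom \<C> X M \<and> b \<in> hom \<C> X M'' \<and> (h \<cdot> f) \<cdot> a = (h' \<cdot> g') \<cdot> b) as cs"
    proof (rule list_all2_trans[OF _ 1(6) 2(6)])
      fix a b c
      assume "\<exists>X. a \<in> hom \<C> X M \<and> b \<in> hom \<C> X M' \<and> f \<cdot> a = f' \<cdot> b"
        and "\<exists>X. b \<in> hom \<C> X M' \<and> c \<in> hom \<C> X M'' \<and> g \<cdot> b = g' \<cdot> c"
      then obtain X where X: "a \<in> hom \<C> X M" "b \<in> hom \<C> X M'" "f \<cdot> a = f' \<cdot> b"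
        "c \<in> hom \<C> X M''" "g \<cdot> b = g' \<cdot> c"
        by (auto simp: hom_def)
      have "(h \<cdot> f) \<cdot> a = h \<cdot> (f' \<cdot> b)" using comp_assoc[OF X(1) 1(4) 3(2)] X(3) by simp
      also have "\<dots> = h' \<cdot> (g \<cdot> b)" using comp_assoc[OF X(2) 1(5) 3(2)] comp_assoc[OF X(2) 2(4) 3(3)] 3(4) by simp
      also have "\<dots> = (h' \<cdot> g') \<cdot> c" using comp_assoc[OF X(4) 2(5) 3(3)] X(5) by simp
      finally show "\<exists>X. a \<in> hom \<C> X M \<and> c \<in> hom \<C> X M'' \<and> (h \<cdot> f) \<cdot> a = (h' \<cdot> g') \<cdot> c"
        using X by blast
    qed
  qed (use 1 2 3 in auto)
qed

text \<open>Types over a model \<open>m\<close> thereby restrict to types over any \<open>c\<close>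
  that factors through \<open>m\<close>.\<close>

lemma gtp_eq_precomp:
  assumes "gtp_eq \<C> \<M> as M bs M'" "(m, m') \<in> set (zip as bs)" "m \<in> hom \<C> Y M" "h \<in> hom \<C> X Y"
  shows "gtp_eq \<C> \<M> (m \<cdot> h # as) M (m' \<cdot> h # bs) M'"
proof -
  obtain N f f' where 1: "M \<in> \<M>" "M' \<in> \<M>" "N \<in> \<M>" "f \<in> hom \<C> M N" "f' \<in> hom \<C> M' N"
    "list_all2 (\<lambda>a b. \<exists>X. a \<in> hom \<C> X M \<and> b \<in> hom \<C> X M' \<and> f \<cdot> a = f' \<cdot> b) as bs"
    using gtp_eqE[OF assms(1)] .
  then have m: "m' \<in> hom \<C> Y M'" "f \<cdot> m = f' \<cdot> m'"
    using assms(2,3) by (auto simp: list_all2_iff hom_def)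
  then have "f \<cdot> (m \<cdot> h) = f' \<cdot> (m' \<cdot> h)"
    using comp_assoc[OF assms(4) m(1) 1(5)] comp_assoc[OF assms(4,3) 1(4)] by simp
  moreover have "m \<cdot> h \<in> hom \<C> X M" "m' \<cdot> h \<in> hom \<C> X M'" using assms(3,4) m(1) by (auto intro: comp_hom)
  ultimately show ?thesis using 1 by (intro gtp_eqI[OF 1(4,5,1,2,3)]) auto
qed

text \<open>The pairs may be taken in any order and repeatedly, so this covers permutations as well
  as subtuples.\<close>

lemma gtp_eq_subtuple:
  assumes "gtp_eq \<C> \<M> as M bs M'"
    and "list_all2 (\<lambda>a' b'. (a', b') \<in> set (zip as bs)) as' bs'"
  shows "gtp_eq \<C> \<M> as' M bs' M'"
proof -
  obtain N f f' where 1: "M \<in> \<M>" "M' \<in> \<M>" "N \<in> \<M>" "f \<in> hom \<C> M N" "f' \<in> hom \<C> M' N"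
    "list_all2 (\<lambda>a b. \<exists>X. a \<in> hom \<C> X M \<and> b \<in> hom \<C> X M' \<and> f \<cdot> a = f' \<cdot> b) as bs"
    using gtp_eqE[OF assms(1)] .
  show ?thesis
    by (rule gtp_eqI[OF 1(4,5,1,2,3) list_all2_mono[OF assms(2)]])
      (use 1(6) in \<open>auto simp: list_all2_iff\<close>)
qed

lemma gtp_eq_hom:
  assumes "gtp_eq \<C> \<M> as M bs M'" "(a, b) \<in> set (zip as bs)"
  shows "a \<in> hom \<C> X M \<longleftrightarrow> b \<in> hom \<C> X M'"
  using assms unfolding gtp_eq_iff by (auto simp: list_all2_iff hom_def)

end

section \<open>Transitive closures along extensions\<close>

text \<open>Intermediate elements of a chain may exist only in an extension, and different chains
  use different extensions. Stability of a single step under further extension allows chains to be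
  moved into an amalgam and concatenated there; Lascar steps and indiscernible steps are both of
  this kind.\<close>

locale extension_stable = aecat U \<C> \<M>
  for U :: "'u itself" and \<C> :: "('o, 'a) cat" and \<M> +
  fixes A C :: 'o and R :: "'o \<Rightarrow> 'a \<Rightarrow> 'a \<Rightarrow> 'a \<Rightarrow> bool"
  assumes R_hom: "R N c a b \<Longrightarrow> a \<in> hom \<C> A N \<and> b \<in> hom \<C> A N"
    and R_extend: "R N c a b \<Longrightarrow> c \<in> hom \<C> C N \<Longrightarrow> N \<in> \<M> \<Longrightarrow> N' \<in> \<M> \<Longrightarrow> f \<in> hom \<C> N N' \<Longrightarrow>
      R N' (f \<cdot> c) (f \<cdot> a) (f \<cdot> b)"
begin

abbreviation R_trancl where "R_trancl \<equiv> trancl_in_extensions \<C> \<M> R"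

lemma tranclp_hom: "(R N c)\<^sup>+\<^sup>+ a b \<Longrightarrow> a \<in> hom \<C> A N \<and> b \<in> hom \<C> A N"
  by (induction rule: tranclp_induct) (use R_hom in blast)+

lemma tranclp_extend:
  assumes "(R N c)\<^sup>+\<^sup>+ a b" "c \<in> hom \<C> C N" "N \<in> \<M>" "N' \<in> \<M>" "f \<in> hom \<C> N N'"
  shows "(R N' (f \<cdot> c))\<^sup>+\<^sup>+ (f \<cdot> a) (f \<cdot> b)"
  using assms(1)
proof (induction rule: tranclp_induct)
  case (base b)
  then show ?case using R_extend assms(2-) by blast
next
  case (step b d)
  then show ?case using R_extend[OF step(2) assms(2-)] by (meson tranclp.trancl_into_trancl)
qed

lemma R_tranclI:
  assumes "(R M c)\<^sup>+\<^sup>+ a b" "M \<in> \<M>" "c \<in> hom \<C> C M"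
  shows "R_trancl M c a b"
proof -
  have "Id \<C> M \<cdot> c = c" "Id \<C> M \<cdot> a = a" "Id \<C> M \<cdot> b = b"
    using tranclp_hom[OF assms(1)] assms(3) id_comp by blast+
  then show ?thesis
    using assms models_obj[OF assms(2)] unfolding trancl_in_extensions_def
    by (intro bexI[of _ M] bexI[of _ "Id \<C> M"]) (auto intro: id_hom)
qed

lemma R_trancl_restrict:
  assumes "R_trancl N (f \<cdot> c) (f \<cdot> a) (f \<cdot> b)" "f \<in> hom \<C> M N"
    "c \<in> hom \<C> C M" "a \<in> hom \<C> A M" "b \<in> hom \<C> A M"
  shows "R_trancl M c a b"
proof -
  obtain K g where g: "K \<in> \<M>" "g \<in> hom \<C> N K"
    "(R K (g \<cdot> (f \<cdot> c)))\<^sup>+\<^sup>+ (g \<cdot> (f \<cdot> a)) (g \<cdot> (f \<cdot> b))"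
    using assms(1) unfolding trancl_in_extensions_def by blast
  then have "(R K ((g \<cdot> f) \<cdot> c))\<^sup>+\<^sup>+ ((g \<cdot> f) \<cdot> a) ((g \<cdot> f) \<cdot> b)"
    using comp_assoc[OF _ assms(2) g(2)] assms(3-5) by simp
  then show ?thesis using g comp_hom[OF assms(2) g(2)] unfolding trancl_in_extensions_def by blast
qed

lemma R_trancl_extend:
  assumes "R_trancl M c a b" "M \<in> \<M>" "N \<in> \<M>" "f \<in> hom \<C> M N"
    "c \<in> hom \<C> C M" "a \<in> hom \<C> A M" "b \<in> hom \<C> A M"
  shows "R_trancl N (f \<cdot> c) (f \<cdot> a) (f \<cdot> b)"
proof -
  obtain K g where g: "K \<in> \<M>" "g \<in> hom \<C> M K" "(R K (g \<cdot> c))\<^sup>+\<^sup>+ (g \<cdot> a) (g \<cdot> b)"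
    using assms(1) unfolding trancl_in_extensions_def by blast
  obtain L f' g' where L: "L \<in> \<M>" "f' \<in> hom \<C> N L" "g' \<in> hom \<C> K L" "f' \<cdot> f = g' \<cdot> g"
    using amalgamate[OF assms(4) g(2) assms(2,3) g(1)] .
  have eq: "g' \<cdot> (g \<cdot> x) = f' \<cdot> (f \<cdot> x)" if "x \<in> hom \<C> X M" for x X
    using comp_assoc[OF that assms(4) L(2)] comp_assoc[OF that g(2) L(3)] L(4) by simp
  have "(R L (g' \<cdot> (g \<cdot> c)))\<^sup>+\<^sup>+ (g' \<cdot> (g \<cdot> a)) (g' \<cdot> (g \<cdot> b))"
    using tranclp_extend[OF g(3) comp_hom[OF assms(5) g(2)] g(1) L(1,3)] .
  then show ?thesis using eq assms(5-7) L unfolding trancl_in_extensions_def by auto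
qed

text \<open>The second chain is transported to the extension \<open>K\<close> that contains the
  first, and the first is then pushed on into \<open>L\<close>, where both can be joined. A chain in
  an extension of \<open>M\<close> already counts as a chain for \<open>M\<close>.\<close>

lemma R_trancl_trans:
  assumes "R_trancl M c x y" "R_trancl M c y z" "M \<in> \<M>"
    "c \<in> hom \<C> C M" "x \<in> hom \<C> A M" "y \<in> hom \<C> A M" "z \<in> hom \<C> A M"
  shows "R_trancl M c x z"
proof -
  obtain K g where g: "K \<in> \<M>" "g \<in> hom \<C> M K" "(R K (g \<cdot> c))\<^sup>+\<^sup>+ (g \<cdot> x) (g \<cdot> y)"
    using assms(1) unfolding trancl_in_extensions_def by blast
  have "R_trancl K (g \<cdot> c) (g \<cdot> y) (g \<cdot> z)"
    using R_trancl_extend[OF assms(2,3) g(1,2) assms(4,6,7)] .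
  then obtain L h where h: "L \<in> \<M>" "h \<in> hom \<C> K L"
    "(R L (h \<cdot> (g \<cdot> c)))\<^sup>+\<^sup>+ (h \<cdot> (g \<cdot> y)) (h \<cdot> (g \<cdot> z))"
    unfolding trancl_in_extensions_def by blast
  have c: "g \<cdot> c \<in> hom \<C> C K" "h \<cdot> (g \<cdot> c) \<in> hom \<C> C L"
    using comp_hom[OF assms(4) g(2)] comp_hom[OF _ h(2)] by auto
  have "(R L (h \<cdot> (g \<cdot> c)))\<^sup>+\<^sup>+ (h \<cdot> (g \<cdot> x)) (h \<cdot> (g \<cdot> z))"
    using tranclp_extend[OF g(3) c(1) g(1) h(1,2)] h(3) by (rule tranclp_trans)
  then have "R_trancl L (h \<cdot> (g \<cdot> c)) (h \<cdot> (g \<cdot> x)) (h \<cdot> (g \<cdot> z))"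
    using R_tranclI h(1) c(2) by blast
  then have "R_trancl K (g \<cdot> c) (g \<cdot> x) (g \<cdot> z)"
    using R_trancl_restrict[OF _ h(2) c(1) comp_hom[OF assms(5) g(2)] comp_hom[OF assms(7) g(2)]]
    by blast
  then show ?thesis using R_trancl_restrict[OF _ g(2) assms(4,5,7)] by blast
qed

lemma R_trancl_sym:
  assumes "R_trancl M c a b" "\<And>N c x y. R N c x y \<Longrightarrow> R N c y x"
  shows "R_trancl M c b a"
proof -
  have "(R N c)\<inverse>\<inverse> = R N c" for N c using assms(2) by (intro ext) auto
  then have "(R N c)\<^sup>+\<^sup>+ x y \<Longrightarrow> (R N c)\<^sup>+\<^sup>+ y x" for N c x y
    using tranclp_converse[of "R N c"] by (metis conversep_iff)
  then show ?thesis using assms(1) unfolding trancl_in_extensions_def by blast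
qed

text \<open>Both triples coincide in the common extension \<open>N\<close>, so it suffices to go up
  from \<open>M\<close> and to come down to \<open>M'\<close>.\<close>

lemma R_trancl_invariant:
  assumes gtp: "gtp_eq \<C> \<M> [a, b, c] M [a', b', c'] M'" and R: "R_trancl M c a b"
    and hom: "a \<in> hom \<C> A M" "b \<in> hom \<C> A M" "c \<in> hom \<C> C M"
  shows "R_trancl M' c' a' b'"
proof -
  obtain N f f' where f: "M \<in> \<M>" "M' \<in> \<M>" "N \<in> \<M>" "f \<in> hom \<C> M N" "f' \<in> hom \<C> M' N"
    "list_all2 (\<lambda>a b. \<exists>X. a \<in> hom \<C> X M \<and> b \<in> hom \<C> X M' \<and> f \<cdot> a = f' \<cdot> b) [a, b, c] [a', b', c']"
    using gtp_eqE[OF gtp] .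
  then have eq: "f \<cdot> a = f' \<cdot> a'" "f \<cdot> b = f' \<cdot> b'" "f \<cdot> c = f' \<cdot> c'" by auto
  have "a' \<in> hom \<C> A M'" "b' \<in> hom \<C> A M'" "c' \<in> hom \<C> C M'"
    using gtp_eq_hom[OF gtp] hom by auto
  then show ?thesis
    using R_trancl_restrict[OF _ f(5)] R_trancl_extend[OF R f(1,3,4) hom(3,1,2)] eq by simp
qed

text \<open>Reduces an inclusion between two such closures to a single step of \<open>S\<close>, the
  proof of which may pass to further extensions.\<close>

lemma R_trancl_generated:
  assumes S: "\<And>N c x y. N \<in> \<M> \<Longrightarrow> c \<in> hom \<C> C N \<Longrightarrow> S N c x y \<Longrightarrow>
      x \<in> hom \<C> A N \<and> y \<in> hom \<C> A N \<and> R_trancl N c x y"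
    and "trancl_in_extensions \<C> \<M> S M c a b"
    and hom: "a \<in> hom \<C> A M" "b \<in> hom \<C> A M" "c \<in> hom \<C> C M"
  shows "R_trancl M c a b"
proof -
  obtain N f where N: "N \<in> \<M>" "f \<in> hom \<C> M N" "(S N (f \<cdot> c))\<^sup>+\<^sup>+ (f \<cdot> a) (f \<cdot> b)"
    using assms(2) unfolding trancl_in_extensions_def by blast
  have c: "f \<cdot> c \<in> hom \<C> C N" using comp_hom[OF hom(3) N(2)] .
  note S = S[OF N(1) c]
  have "y \<in> hom \<C> A N \<and> x \<in> hom \<C> A N \<and> R_trancl N (f \<cdot> c) x y"
    if "(S N (f \<cdot> c))\<^sup>+\<^sup>+ x y" for x y
    using that
  proof (induction rule: tranclp_induct)
    case (base y)
    then show ?case using S by blast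
  next
    case (step y z)
    then show ?case using S[OF step(2)] R_trancl_trans[OF _ _ N(1) c] by blast
  qed
  from this[OF N(3)] show ?thesis using R_trancl_restrict[OF _ N(2) hom(3,1,2)] by blast
qed

end

section \<open>Stability of Lascar steps and indiscernible steps under extension\<close>

context aecat
begin

lemma lgtp_step_sym: "lgtp_step \<C> \<M> A M c a b \<Longrightarrow> lgtp_step \<C> \<M> A M c b a"
  unfolding lgtp_step_def by (meson gtp_eq_sym)

lemma two_indisc_step_sym: "two_indisc_step TYPE('u) \<C> \<M> A M c a b \<Longrightarrow> two_indisc_step TYPE('u) \<C> \<M> A M c b a"
  unfolding two_indisc_step_def by blast

lemma lgtp_stepI:
  assumes "a \<in> hom \<C> A M" "b \<in> hom \<C> A M" "M \<in> \<M>" "c \<in> hom \<C> C M"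
    and "M0 \<in> \<M>" "m0 \<in> hom \<C> M0 M" "sub_le \<C> c m0" "gtp_eq \<C> \<M> [a, m0] M [b, m0] M"
  shows "lgtp_step \<C> \<M> A M c a b"
  unfolding lgtp_step_def
  using assms models_obj[OF assms(3)] id_comp[OF assms(1)] id_comp[OF assms(2)] id_comp[OF assms(4)]
  by (intro conjI bexI[of _ M] bexI[of _ "Id \<C> M"] bexI[of _ M0] bexI[of _ m0]) (auto intro: id_hom)

lemma sub_le_extend:
  assumes "sub_le \<C> x y" "f \<in> hom \<C> M N" "x \<in> hom \<C> X M" "y \<in> hom \<C> Y M"
  shows "sub_le \<C> (f \<cdot> x) (f \<cdot> y)"
proof -
  obtain h where h: "h \<in> hom \<C> X Y" "x = y \<cdot> h" using sub_leE[OF assms(1,3,4)] .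
  show ?thesis
    using sub_leI[OF h(1) comp_hom[OF assms(4,2)]] comp_assoc[OF h(1) assms(4,2)] h(2) by simp
qed

lemma gtp_eq_extend_both:
  assumes "gtp_eq \<C> \<M> as M bs M'" "f \<in> hom \<C> M N" "f' \<in> hom \<C> M' N'" "N \<in> \<M>" "N' \<in> \<M>"
  shows "gtp_eq \<C> \<M> (map (Comp \<C> f) as) N (map (Comp \<C> f') bs) N'"
proof -
  have M: "M \<in> \<M>" "M' \<in> \<M>" "\<forall>a\<in>set as. \<exists>X. a \<in> hom \<C> X M" "\<forall>b\<in>set bs. \<exists>X. b \<in> hom \<C> X M'"
    using assms(1) by (auto simp: gtp_eq_def hom_def)
  have "gtp_eq \<C> \<M> as M (map (Comp \<C> f) as) N" "gtp_eq \<C> \<M> bs M' (map (Comp \<C> f') bs) N'"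
    by (rule gtp_eq_extend; use M assms in \<open>auto simp: list_all2_map2 list_all2_same\<close>)+
  then show ?thesis using gtp_eq_trans gtp_eq_sym assms(1) by blast
qed

lemma lgtp_step_extend:
  assumes "lgtp_step \<C> \<M> A M c a b" "c \<in> hom \<C> C M" "M \<in> \<M>" "M' \<in> \<M>" "g \<in> hom \<C> M M'"
  shows "lgtp_step \<C> \<M> A M' (g \<cdot> c) (g \<cdot> a) (g \<cdot> b)"
proof -
  obtain N f M0 m0 where ab: "a \<in> hom \<C> A M" "b \<in> hom \<C> A M" and N: "N \<in> \<M>" "f \<in> hom \<C> M N"
    and m0: "M0 \<in> \<M>" "m0 \<in> hom \<C> M0 N" "sub_le \<C> (f \<cdot> c) m0"
    and gtp: "gtp_eq \<C> \<M> [f \<cdot> a, m0] N [f \<cdot> b, m0] N"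
    using assms(1) unfolding lgtp_step_def by blast
  obtain K f' g' where K: "K \<in> \<M>" "g' \<in> hom \<C> M' K" "f' \<in> hom \<C> N K" "g' \<cdot> g = f' \<cdot> f"
    using amalgamate[OF assms(5) N(2) assms(3,4) N(1)] .
  have eq: "f' \<cdot> (f \<cdot> x) = g' \<cdot> (g \<cdot> x)" if "x \<in> hom \<C> X M" for x X
    using comp_assoc[OF that assms(5) K(2)] comp_assoc[OF that N(2) K(3)] K(4) by simp
  have "gtp_eq \<C> \<M> [g' \<cdot> (g \<cdot> a), f' \<cdot> m0] K [g' \<cdot> (g \<cdot> b), f' \<cdot> m0] K"
    using gtp_eq_extend_both[OF gtp K(3,3,1,1)] eq ab by simp
  moreover have "sub_le \<C> (g' \<cdot> (g \<cdot> c)) (f' \<cdot> m0)"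
    using sub_le_extend[OF m0(3) K(3) comp_hom[OF assms(2) N(2)] m0(2)] eq[OF assms(2)] by simp
  moreover have "f' \<cdot> m0 \<in> hom \<C> M0 K" "g \<cdot> a \<in> hom \<C> A M'" "g \<cdot> b \<in> hom \<C> A M'"
    using m0 K assms ab by (auto intro: comp_hom)
  ultimately show ?thesis unfolding lgtp_step_def using K m0(1) by blast
qed

lemma lgtp_step_extension_stable: "extension_stable TYPE('u) \<C> \<M> A C (lgtp_step \<C> \<M> A)"
proof unfold_locales
  show "lgtp_step \<C> \<M> A N c a b \<Longrightarrow> a \<in> hom \<C> A N \<and> b \<in> hom \<C> A N" for N c a b
    by (simp add: lgtp_step_def)
qed (rule lgtp_step_extend)

lemma two_indiscernible_extend:
  assumes "two_indiscernible \<C> \<M> A N c r s" "f \<in> hom \<C> N N'" "N' \<in> \<M>"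
  shows "two_indiscernible \<C> \<M> A N' (f \<cdot> c) r (\<lambda>i. f \<cdot> s i)"
  unfolding two_indiscernible_def
proof (intro conjI allI impI ballI; (elim conjE)?)
  show "small_ordinal r" using assms(1) by (simp add: two_indiscernible_def)
  show "f \<cdot> s i \<in> hom \<C> A N'" if "i \<in> Field r" for i
    using that assms comp_hom unfolding two_indiscernible_def by blast
  fix i1 i2 j1 j2 assume "(i1, i2) \<in> r" "i1 \<noteq> i2" "(j1, j2) \<in> r" "j1 \<noteq> j2"
  then have "gtp_eq \<C> \<M> [s i1, c] N [s i2, c] N"
    "gtp_eq \<C> \<M> [s i1, s i2, c] N [s j1, s j2, c] N"
    using assms(1) unfolding two_indiscernible_def by blast+
  from this[THEN gtp_eq_extend_both, OF assms(2,2,3,3)]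
  show "gtp_eq \<C> \<M> [f \<cdot> s i1, f \<cdot> c] N' [f \<cdot> s i2, f \<cdot> c] N'"
    "gtp_eq \<C> \<M> [f \<cdot> s i1, f \<cdot> s i2, f \<cdot> c] N' [f \<cdot> s j1, f \<cdot> s j2, f \<cdot> c] N'"
    by simp_all
qed

text \<open>The longer sequences live in extensions \<open>K\<close> of \<open>N\<close> that are
  unrelated to \<open>N'\<close>, so they are moved to an amalgam of the two over
  \<open>N\<close>.\<close>

lemma strongly_two_indiscernible_extend:
  assumes "strongly_two_indiscernible \<C> \<M> A N c (r :: 'u rel) s"
    and "f \<in> hom \<C> N N'" "N \<in> \<M>" "N' \<in> \<M>" "c \<in> hom \<C> C N"
  shows "strongly_two_indiscernible \<C> \<M> A N' (f \<cdot> c) r (\<lambda>i. f \<cdot> s i)"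
  unfolding strongly_two_indiscernible_def
proof (intro conjI allI impI)
  have indisc: "two_indiscernible \<C> \<M> A N c r s"
    using assms(1) by (simp add: strongly_two_indiscernible_def)
  then show "two_indiscernible \<C> \<M> A N' (f \<cdot> c) r (\<lambda>i. f \<cdot> s i)"
    using two_indiscernible_extend assms(2,4) by blast
  fix \<gamma> :: "'u rel" assume "small_ordinal \<gamma>"
  then obtain K g and r' :: "'u rel" and s' e where K: "K \<in> \<M>" "g \<in> hom \<C> N K"
    "two_indiscernible \<C> \<M> A K (g \<cdot> c) r' s'" "\<gamma> \<le>o r'" "embed r r' e"
    "\<forall>i\<in>Field r. s' (e i) = g \<cdot> s i"
    using assms(1) unfolding strongly_two_indiscernible_def by blast
  obtain L f' g' where L: "L \<in> \<M>" "f' \<in> hom \<C> N' L" "g' \<in> hom \<C> K L" "f' \<cdot> f = g' \<cdot> g"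
    using amalgamate[OF assms(2) K(2) assms(3,4) K(1)] .
  have eq: "g' \<cdot> (g \<cdot> x) = f' \<cdot> (f \<cdot> x)" if "x \<in> hom \<C> X N" for x X
    using comp_assoc[OF that assms(2) L(2)] comp_assoc[OF that K(2) L(3)] L(4) by simp
  have "two_indiscernible \<C> \<M> A L (f' \<cdot> (f \<cdot> c)) r' (\<lambda>i. g' \<cdot> s' i)"
    using two_indiscernible_extend[OF K(3) L(3,1)] eq[OF assms(5)] by simp
  moreover have "\<forall>i\<in>Field r. g' \<cdot> s' (e i) = f' \<cdot> (f \<cdot> s i)"
    using K(6) eq indisc unfolding two_indiscernible_def by metis
  ultimately show "\<exists>N''\<in>\<M>. \<exists>h\<in>hom \<C> N' N''. \<exists>(r' :: 'u rel) s' e.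
      two_indiscernible \<C> \<M> A N'' (h \<cdot> (f \<cdot> c)) r' s' \<and> \<gamma> \<le>o r' \<and> embed r r' e \<and>
      (\<forall>i\<in>Field r. s' (e i) = h \<cdot> (f \<cdot> s i))"
    using L(1,2) K(4,5) by blast
qed

lemma two_indisc_step_extend:
  assumes "two_indisc_step TYPE('u) \<C> \<M> A M c a b" "c \<in> hom \<C> C M" "M \<in> \<M>" "M' \<in> \<M>" "g \<in> hom \<C> M M'"
  shows "two_indisc_step TYPE('u) \<C> \<M> A M' (g \<cdot> c) (g \<cdot> a) (g \<cdot> b)"
proof -
  obtain N f and r :: "'u rel" and s i j where ab: "a \<in> hom \<C> A M" "b \<in> hom \<C> A M"
    and N: "N \<in> \<M>" "f \<in> hom \<C> M N"
    and s: "i \<in> Field r" "j \<in> Field r" "strongly_two_indiscernible \<C> \<M> A N (f \<cdot> c) r s"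
      "s i = f \<cdot> a" "s j = f \<cdot> b"
    using assms(1) unfolding two_indisc_step_def by blast
  obtain K f' g' where K: "K \<in> \<M>" "g' \<in> hom \<C> M' K" "f' \<in> hom \<C> N K" "g' \<cdot> g = f' \<cdot> f"
    using amalgamate[OF assms(5) N(2) assms(3,4) N(1)] .
  have eq: "f' \<cdot> (f \<cdot> x) = g' \<cdot> (g \<cdot> x)" if "x \<in> hom \<C> X M" for x X
    using comp_assoc[OF that assms(5) K(2)] comp_assoc[OF that N(2) K(3)] K(4) by simp
  have "strongly_two_indiscernible \<C> \<M> A K (g' \<cdot> (g \<cdot> c)) r (\<lambda>i. f' \<cdot> s i)"
    using strongly_two_indiscernible_extend[OF s(3) K(3) N(1) K(1) comp_hom[OF assms(2) N(2)]]
      eq[OF assms(2)] by simp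
  moreover have "f' \<cdot> s i = g' \<cdot> (g \<cdot> a)" "f' \<cdot> s j = g' \<cdot> (g \<cdot> b)" using s eq ab by simp_all
  moreover have "g \<cdot> a \<in> hom \<C> A M'" "g \<cdot> b \<in> hom \<C> A M'"
    using assms ab by (auto intro: comp_hom)
  ultimately show ?thesis unfolding two_indisc_step_def using K s(1,2) by blast
qed

lemma two_indisc_step_extension_stable: "extension_stable TYPE('u) \<C> \<M> A C (two_indisc_step TYPE('u) \<C> \<M> A)"
proof unfold_locales
  show "two_indisc_step TYPE('u) \<C> \<M> A N c a b \<Longrightarrow> a \<in> hom \<C> A N \<and> b \<in> hom \<C> A N" for N c a b
    by (simp add: two_indisc_step_def)
qed (rule two_indisc_step_extend)

end

section \<open>Bounded invariant equivalence relations\<close>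

context aecat
begin

lemma invariant_equivalence_extend:
  assumes "invariant_equivalence \<C> \<M> A C E" "f \<in> hom \<C> M N" "M \<in> \<M>" "N \<in> \<M>"
    and "a \<in> hom \<C> A M" "b \<in> hom \<C> A M" "c \<in> hom \<C> C M"
  shows "(f \<cdot> a, f \<cdot> b) \<in> E N (f \<cdot> c) \<longleftrightarrow> (a, b) \<in> E M c"
proof -
  have "gtp_eq \<C> \<M> [a, b, c] M [f \<cdot> a, f \<cdot> b, f \<cdot> c] N"
    using assms(2-) by (intro gtp_eq_extend) auto
  then show ?thesis
    using assms comp_hom[OF _ assms(2)] unfolding invariant_equivalence_def by blast
qed

text \<open>All increasing pairs have the same type over \<open>c\<close>, so by invariance one
  inequivalent pair makes all members pairwise inequivalent, and \<open>i\<close> is determined by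
  the class of \<open>s i\<close>.\<close>

lemma inequivalent_indiscernibles_bounded:
  assumes "equivalence_relation_over \<C> \<M> A C E" "invariant_equivalence \<C> \<M> A C E"
    and "N \<in> \<M>" "c \<in> hom \<C> C N" "two_indiscernible \<C> \<M> A N c (r :: 'u rel) s"
    and "(p, q) \<in> r" "p \<noteq> q" "(s p, s q) \<notin> E N c"
  shows "|Field r| \<le>o |hom \<C> A N // E N c|"
proof -
  have equiv: "equiv (hom \<C> A N) (E N c)"
    using assms(1,3,4) by (simp add: equivalence_relation_over_def)
  have s: "s i \<in> hom \<C> A N" if "i \<in> Field r" for i
    using assms(5) that by (simp add: two_indiscernible_def)
  have neq: "(s i, s j) \<notin> E N c" if "(i, j) \<in> r" "i \<noteq> j" for i j
  proof -
    have "gtp_eq \<C> \<M> [s p, s q, c] N [s i, s j, c] N"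
      using assms(5-7) that unfolding two_indiscernible_def by blast
    moreover have "s p \<in> hom \<C> A N" "s q \<in> hom \<C> A N" "s i \<in> hom \<C> A N" "s j \<in> hom \<C> A N"
      using s assms(6) that by (auto simp: Field_def)
    ultimately show ?thesis
      using assms(2-4,8) unfolding invariant_equivalence_def by blast
  qed
  have "inj_on (\<lambda>i. E N c `` {s i}) (Field r)"
  proof (rule inj_onI, rule ccontr)
    fix i j assume ij: "i \<in> Field r" "j \<in> Field r" "E N c `` {s i} = E N c `` {s j}" "i \<noteq> j"
    have "(s i, s j) \<in> E N c" "(s j, s i) \<in> E N c"
      using eq_equiv_class_iff[OF equiv s s] ij equiv by (auto simp: equiv_def sym_def)
    moreover have "Total r"
      using assms(5) unfolding two_indiscernible_def small_ordinal_def order_on_defs by blast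
    ultimately show False using neq ij unfolding total_on_def by blast
  qed
  moreover have "(\<lambda>i. E N c `` {s i}) ` Field r \<subseteq> hom \<C> A N // E N c"
    using s by (auto intro: quotientI)
  ultimately show ?thesis using card_of_ordLeq by blast
qed

lemma two_indisc_step_imp_equivalent:
  assumes eqv: "equivalence_relation_over \<C> \<M> A C E" and bnd: "bounded_equivalence TYPE('u) \<C> \<M> A C E"
    and inv: "invariant_equivalence \<C> \<M> A C E"
    and "M \<in> \<M>" "c \<in> hom \<C> C M" "two_indisc_step TYPE('u) \<C> \<M> A M c a b"
  shows "(a, b) \<in> E M c"
proof -
  obtain N f and r :: "'u rel" and s i j where ab: "a \<in> hom \<C> A M" "b \<in> hom \<C> A M"
    and N: "N \<in> \<M>" "f \<in> hom \<C> M N"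
    and s: "i \<in> Field r" "j \<in> Field r" "strongly_two_indiscernible \<C> \<M> A N (f \<cdot> c) r s"
      "s i = f \<cdot> a" "s j = f \<cdot> b"
    using assms(6) unfolding two_indisc_step_def by blast
  have c: "f \<cdot> c \<in> hom \<C> C N" using comp_hom[OF assms(5) N(2)] .
  obtain l :: "'u rel" where l: "Card_order l" "small TYPE('u) (Field l)"
    "\<And>M c. M \<in> \<M> \<Longrightarrow> c \<in> hom \<C> C M \<Longrightarrow> |hom \<C> A M // E M c| \<le>o l"
    using bnd unfolding bounded_equivalence_def by blast
  \<comment> \<open>A cardinal strictly above the bound on the number of classes; the sequence is
    extended to at least this length.\<close>
  obtain \<gamma> :: "'u rel" where \<gamma>: "small_ordinal \<gamma>" "Card_order \<gamma>" "l <o \<gamma>"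
    using larger_small_ordinal[OF l(1,2)] .
  have indisc: "two_indiscernible \<C> \<M> A N (f \<cdot> c) r s"
    using s(3) by (simp add: strongly_two_indiscernible_def)
  then have well: "Well_order r" and s_hom: "\<And>i. i \<in> Field r \<Longrightarrow> s i \<in> hom \<C> A N"
    by (auto simp: two_indiscernible_def small_ordinal_def)
  obtain K g and r' :: "'u rel" and s' e where K: "K \<in> \<M>" "g \<in> hom \<C> N K"
    "two_indiscernible \<C> \<M> A K (g \<cdot> (f \<cdot> c)) r' s'" "\<gamma> \<le>o r'" "embed r r' e"
    "\<forall>i\<in>Field r. s' (e i) = g \<cdot> s i"
    using s(3) \<gamma>(1) unfolding strongly_two_indiscernible_def by blast
  have gc: "g \<cdot> (f \<cdot> c) \<in> hom \<C> C K" using comp_hom[OF c K(2)] .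
  have inj: "inj_on e (Field r)" using embed_inj_on[OF well K(5)] .
  have E: "(s p, s q) \<in> E N (f \<cdot> c)" if pq: "(p, q) \<in> r" for p q
  proof (cases "p = q")
    case True
    then show ?thesis
      using eqv N(1) c s_hom[of p] pq
      unfolding equivalence_relation_over_def equiv_def refl_on_def by (auto simp: Field_def)
  next
    case False
    have F: "p \<in> Field r" "q \<in> Field r" using pq by (auto simp: Field_def)
    have e: "(e p, e q) \<in> r'" "e p \<noteq> e q"
      using embed_compat[OF K(5)] pq inj F False by (auto simp: compat_def inj_on_def)
    have "(s' (e p), s' (e q)) \<in> E K (g \<cdot> (f \<cdot> c))"
    proof (rule ccontr)
      assume "\<not> ?thesis"
      then have "|Field r'| \<le>o |hom \<C> A K // E K (g \<cdot> (f \<cdot> c))|"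
        using inequivalent_indiscernibles_bounded[OF eqv inv K(1) gc K(3) e] by blast
      then have "|Field r'| \<le>o l" using l(3)[OF K(1) gc] by (rule ordLeq_transitive)
      \<comment> \<open>The lengths \<open>\<gamma>\<close> and \<open>r'\<close> are compared as
        order types; since \<open>\<gamma>\<close> is a cardinal, \<open>r'\<close> has at least
        \<open>\<gamma>\<close> elements.\<close>
      moreover have "|Field \<gamma>| \<le>o |Field r'|" using K(4) by (rule card_of_mono2)
      moreover have "\<gamma> =o |Field \<gamma>|"
        using card_of_Field_ordIso[OF \<gamma>(2)] by (rule ordIso_symmetric)
      ultimately have "\<gamma> \<le>o l" using ordIso_ordLeq_trans ordLeq_transitive by blast
      then show False using \<gamma>(3) not_ordLess_ordLeq by blast
    qed
    then have "(g \<cdot> s p, g \<cdot> s q) \<in> E K (g \<cdot> (f \<cdot> c))" using K(6) F by simp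
    then show ?thesis
      using invariant_equivalence_extend[OF inv K(2) N(1) K(1) s_hom[OF F(1)] s_hom[OF F(2)] c]
      by blast
  qed
  \<comment> \<open>The two occurrences may come in either order, whereas the fact \<open>E\<close>
    is about increasing pairs.\<close>
  have "Total r" "Refl r" using well unfolding order_on_defs by blast+
  then have "(i, j) \<in> r \<or> (j, i) \<in> r"
    using s(1,2) by (metis refl_onD total_on_def)
  then have "(s i, s j) \<in> E N (f \<cdot> c)"
    using E eqv N(1) c unfolding equivalence_relation_over_def equiv_def sym_def by blast
  then show ?thesis
    using invariant_equivalence_extend[OF inv N(2) assms(4) N(1) ab assms(5)] s(4,5) by simp
qed

lemma two_indisc_equiv_imp_bounded_equiv:
  assumes "two_indisc_equiv TYPE('u) \<C> \<M> A M c a b"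
    and "M \<in> \<M>" "a \<in> hom \<C> A M" "b \<in> hom \<C> A M" "c \<in> hom \<C> C M"
  shows "bounded_equiv TYPE('u) \<C> \<M> A C M c a b"
  unfolding bounded_equiv_def
proof (intro allI impI, elim conjE)
  fix E assume E: "equivalence_relation_over \<C> \<M> A C E"
    "bounded_equivalence TYPE('u) \<C> \<M> A C E" "invariant_equivalence \<C> \<M> A C E"
  obtain N f where N: "N \<in> \<M>" "f \<in> hom \<C> M N"
    "(two_indisc_step TYPE('u) \<C> \<M> A N (f \<cdot> c))\<^sup>+\<^sup>+ (f \<cdot> a) (f \<cdot> b)"
    using assms(1) unfolding two_indisc_equiv_def trancl_in_extensions_def by blast
  have c: "f \<cdot> c \<in> hom \<C> C N" using comp_hom[OF assms(5) N(2)] .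
  note equiv_step = two_indisc_step_imp_equivalent[OF E N(1) c]
  have trans: "trans (E N (f \<cdot> c))"
    using E(1) N(1) c unfolding equivalence_relation_over_def equiv_def by blast
  have "(x, y) \<in> E N (f \<cdot> c)"
    if "(two_indisc_step TYPE('u) \<C> \<M> A N (f \<cdot> c))\<^sup>+\<^sup>+ x y" for x y
    using that
  proof (induction rule: tranclp_induct)
    case (base y)
    then show ?case by (rule equiv_step)
  next
    case (step y z)
    show ?case using transD[OF trans step.IH equiv_step[OF step.hyps(2)]] .
  qed
  from this[OF N(3)] show "(a, b) \<in> E M c"
    using invariant_equivalence_extend[OF E(3) N(2) assms(2) N(1) assms(3-5)] by blast
qed

end

section \<open>Long indiscernible sequences\<close>

context cat
begin

text \<open>The recursion does not distinguish zero, successor and limit stages: stage \<open>i\<close> takes a cocone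
  with vertex \<open>L i\<close> over all the earlier stages and continues it with an arrow \<open>q i\<close> satisfying
  \<open>Q\<close>. The transition arrows into stage \<open>i\<close> thereby all factor through \<open>q i\<close>.\<close>

lemma transfinite_chain:
  fixes r :: "'i rel" and Q :: "'a \<Rightarrow> bool"
  assumes well: "Well_order r"
    and cocones: "\<And>i D d. diagram \<C> (Restr r (underS r i)) D d \<Longrightarrow>
      \<exists>L x. cocone \<C> (Restr r (underS r i)) D d L x"
    and next_arrow: "\<And>X. X \<in> Obj \<C> \<Longrightarrow> \<exists>Y. \<exists>q\<in>hom \<C> X Y. Q q"
  obtains D d L q t where "diagram \<C> r D d"
    and "\<And>i. i \<in> Field r \<Longrightarrow> q i \<in> hom \<C> (L i) (D i) \<and> Q (q i)"
    and "\<And>i j. (j, i) \<in> r \<Longrightarrow> j \<noteq> i \<Longrightarrow> t i j \<in> hom \<C> (D j) (L i) \<and> d j i = q i \<cdot> t i j"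
proof -
  \<comment> \<open>\<open>F j\<close> is the quadruple \<open>(L, D, q, t)\<close> of stage
    \<open>j\<close>: the vertex of the cocone, the object of the chain, the arrow between them, and
    the legs of the cocone. \<open>d' F\<close> decodes the transition arrows, with identities on
    the diagonal.\<close>
  define d' where "d' F i j =
    (if i = j then Id \<C> (fst (snd (F j))) else fst (snd (snd (F j))) \<cdot> snd (snd (snd (F j))) i)"
    for F :: "'i \<Rightarrow> 'o \<times> 'o \<times> 'a \<times> ('i \<Rightarrow> 'a)" and i j
  define P where "P F i v = (case v of (L, Y, q, t) \<Rightarrow>
      cocone \<C> (Restr r (underS r i)) (\<lambda>j. fst (snd (F j))) (d' F) L t \<and> q \<in> hom \<C> L Y \<and> Q q)"
    for F i v
  \<comment> \<open>Stated for any set \<open>T\<close> of stages: during the recursion it consists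
    of the predecessors of \<open>i\<close>, at the end it is everything.\<close>
  have diag: "diagram \<C> (Restr r T) (\<lambda>j. fst (snd (F j))) (d' F)" if P: "\<And>j. j \<in> T \<Longrightarrow> P F j (F j)" for F T
  proof -
    have PD: "fst (snd (snd (F j))) \<in> hom \<C> (fst (F j)) (fst (snd (F j)))" if "j \<in> T" for j
      using P[OF that] unfolding P_def by (auto split: prod.splits)
    have Pc: "cocone \<C> (Restr r (underS r j)) (\<lambda>j. fst (snd (F j))) (d' F) (fst (F j)) (snd (snd (snd (F j))))"
      if "j \<in> T" for j
      using P[OF that] unfolding P_def by (auto split: prod.splits)
    have refl: "Refl r" and antisym: "antisym r" and trans: "trans r"
      using well unfolding order_on_defs by blast+
    have t: "snd (snd (snd (F j))) i \<in> hom \<C> (fst (snd (F i))) (fst (F j))"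
      if "(i, j) \<in> r" "i \<noteq> j" "j \<in> T" for i j
    proof -
      have "(i, i) \<in> Restr r (underS r j)"
        using that refl by (auto simp: underS_def refl_on_def Field_def)
      then have "i \<in> Field (Restr r (underS r j))" by (auto simp: Field_def)
      then show ?thesis using Pc[OF that(3)] unfolding cocone_def by blast
    qed
    show ?thesis
      unfolding diagram_def
    proof (intro conjI ballI allI impI; (elim conjE)?)
      fix i assume "i \<in> Field (Restr r T)"
      then have "i \<in> T" by (auto simp: Field_def)
      then show "fst (snd (F i)) \<in> Obj \<C>" "d' F i i = Id \<C> (fst (snd (F i)))"
        using hom_obj[OF PD] by (auto simp: d'_def)
    next
      fix i j assume "(i, j) \<in> Restr r T"
      then have ij: "(i, j) \<in> r" "i \<in> T" "j \<in> T" by auto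
      show "d' F i j \<in> hom \<C> (fst (snd (F i))) (fst (snd (F j)))"
        using t[OF ij(1) _ ij(3)] comp_hom PD[OF ij(3)] hom_obj[OF PD[OF ij(3)]]
        by (auto simp: d'_def)
    next
      fix i j k assume "(i, j) \<in> Restr r T" "(j, k) \<in> Restr r T"
      then have ijk: "(i, j) \<in> r" "(j, k) \<in> r" "i \<in> T" "j \<in> T" "k \<in> T" by auto
      have dij: "d' F i j \<in> hom \<C> (fst (snd (F i))) (fst (snd (F j)))"
        if "(i, j) \<in> r" "i \<in> T" "j \<in> T" for i j
        using t[OF that(1) _ that(3)] comp_hom PD[OF that(3)] hom_obj[OF PD[OF that(3)]]
        by (auto simp: d'_def)
      show "d' F j k \<cdot> d' F i j = d' F i k"
      proof (cases "i = j \<or> j = k")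
        case True
        then show ?thesis
          using dij[OF ijk(1,3,4)] dij[OF ijk(2,4,5)] comp_id id_comp by (auto simp: d'_def)
      next
        case False
        have "i \<noteq> k" using ijk False antisym unfolding antisym_def by blast
        have "(i, k) \<in> r" using ijk trans unfolding trans_def by blast
        then have "(i, j) \<in> Restr r (underS r k)"
          using ijk False \<open>i \<noteq> k\<close> by (auto simp: underS_def)
        then have "snd (snd (snd (F k))) j \<cdot> d' F i j = snd (snd (snd (F k))) i"
          using Pc[OF ijk(5)] by (simp add: cocone_def)
        then show ?thesis
          using comp_assoc[OF dij[OF ijk(1,3,4)] t[OF ijk(2) _ ijk(5)] PD[OF ijk(5)]] False \<open>i \<noteq> k\<close>
          by (simp add: d'_def)
      qed
    qed
  qed
  have "\<exists>F. \<forall>i. P F i (F i)"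
  proof (rule dependent_wf_choice)
    show "wf (r - Relation.Id)" using well by (simp add: order_on_defs)
    \<comment> \<open>The cocone at stage \<open>i\<close> mentions only values of \<open>F\<close>
      strictly below \<open>i\<close>, as recursion along \<open>r\<close> requires.\<close>
    show "P F i v = P G i v" if "\<And>j. (j, i) \<in> r - Relation.Id \<Longrightarrow> F j = G j" for F G i v
    proof -
      have eq: "F j = G j" if "j \<in> Field (Restr r (underS r i))" for j
        using that \<open>\<And>j. (j, i) \<in> r - Relation.Id \<Longrightarrow> F j = G j\<close> by (auto simp: Field_def underS_def)
      then have "d' F j k = d' G j k" if "(j, k) \<in> Restr r (underS r i)" for j k
        using that unfolding d'_def by (metis FieldI2)
      then have "cocone \<C> (Restr r (underS r i)) (\<lambda>j. fst (snd (F j))) (d' F) L t =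
            cocone \<C> (Restr r (underS r i)) (\<lambda>j. fst (snd (G j))) (d' G) L t" for L t
        using eq unfolding cocone_def by (metis (no_types, lifting))
      then show ?thesis unfolding P_def by simp
    qed
    show "\<exists>v. P F i v" if "\<And>j. (j, i) \<in> r - Relation.Id \<Longrightarrow> P F j (F j)" for F i
    proof -
      have "diagram \<C> (Restr r (underS r i)) (\<lambda>j. fst (snd (F j))) (d' F)"
        using that by (intro diag) (auto simp: underS_def)
      then obtain L t where L: "cocone \<C> (Restr r (underS r i)) (\<lambda>j. fst (snd (F j))) (d' F) L t"
        using cocones by blast
      then obtain Y q where "q \<in> hom \<C> L Y" "Q q" using next_arrow unfolding cocone_def by blast
      then show ?thesis using L unfolding P_def by (intro exI[of _ "(L, Y, q, t)"]) simp
    qed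
  qed
  then obtain F where F: "\<And>i. P F i (F i)" by blast
  show thesis
  proof (rule that[of "\<lambda>j. fst (snd (F j))" "d' F" "\<lambda>i. fst (snd (snd (F i)))" "\<lambda>i. fst (F i)"
        "\<lambda>i. snd (snd (snd (F i)))"])
    show "diagram \<C> r (\<lambda>j. fst (snd (F j))) (d' F)"
      using diag[of UNIV F] F by simp
    show "fst (snd (snd (F i))) \<in> hom \<C> (fst (F i)) (fst (snd (F i))) \<and> Q (fst (snd (snd (F i))))" for i
      using F[of i] unfolding P_def by (auto split: prod.splits)
    show "snd (snd (snd (F i))) j \<in> hom \<C> (fst (snd (F j))) (fst (F i)) \<and>
        d' F j i = fst (snd (snd (F i))) \<cdot> snd (snd (snd (F i))) j" if ji: "(j, i) \<in> r" "j \<noteq> i" for i j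
    proof
      have "(j, j) \<in> Restr r (underS r i)"
        using ji well by (auto simp: underS_def order_on_defs refl_on_def Field_def)
      then have "j \<in> Field (Restr r (underS r i))" by (auto simp: Field_def)
      then show "snd (snd (snd (F i))) j \<in> hom \<C> (fst (snd (F j))) (fst (F i))"
        using F[of i] unfolding P_def cocone_def by (auto split: prod.splits)
      show "d' F j i = fst (snd (snd (F i))) \<cdot> snd (snd (snd (F i))) j"
        using ji by (simp add: d'_def)
    qed
  qed
qed

end

context universe
begin

lemma small_ordinal_Restr: "small_ordinal (r :: 'u rel) \<Longrightarrow> small_ordinal (Restr r T)"
  using Well_order_Restr small_subset[of "Field r" "Field (Restr r T)"]
  by (auto simp: small_ordinal_def Field_def)

lemma small_ordinal_directed:
  assumes "small_ordinal (r :: 'u rel)" "Field r \<noteq> {}"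
  shows "directed_poset natLeq r"
proof -
  have r: "Partial_order r" "Total r" "Refl r" "trans r" "small TYPE('u) (Field r)"
    using assms(1) unfolding small_ordinal_def order_on_defs by auto
  have "\<exists>u\<in>Field r. \<forall>i\<in>S. (i, u) \<in> r" if "finite S" "S \<subseteq> Field r" for S
    using that
  proof (induction S)
    case empty
    then show ?case using assms(2) by blast
  next
    case (insert x S)
    then obtain u where u: "u \<in> Field r" "\<forall>i\<in>S. (i, u) \<in> r" by blast
    have "(x, u) \<in> r \<or> (u, x) \<in> r" "(x, x) \<in> r"
      using insert.prems u(1) r(2,3) unfolding total_on_def refl_on_def by (metis insert_subset)+
    then show ?case using u insert.prems r(4) by (blast dest: transD)
  qed
  then show ?thesis
    using r unfolding directed_poset_def finite_iff_ordLess_natLeq by blast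
qed

end

context aecat
begin

lemma model_colimit:
  assumes "directed_poset natLeq (r :: 'u rel)" "diagram \<C> r D d" "\<And>i. i \<in> Field r \<Longrightarrow> D i \<in> \<M>"
  obtains L l where "L \<in> \<M>" "colimit \<C> r D d L l"
proof -
  have "diagram (full_subcat \<C> \<M>) r D d"
    using assms(2,3) unfolding diagram_def full_subcat_def hom_def by (auto simp: Field_def)
  moreover have "has_directed_colimits TYPE('u) natLeq (full_subcat \<C> \<M>)"
    using AECat by (simp add: AECat_def)
  ultimately obtain L l where L: "colimit (full_subcat \<C> \<M>) r D d L l"
    using assms(1) unfolding has_directed_colimits_def by blast
  then have "L \<in> \<M>" by (simp add: colimit_def cocone_def full_subcat_def)
  moreover have "colimit \<C> r D d L l"
    using AECat assms(1) \<open>diagram (full_subcat \<C> \<M>) r D d\<close> L unfolding AECat_def by blast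
  ultimately show thesis using that by blast
qed

end

section \<open>The category of independent realizations of a type\<close>

locale independent_pair = aecat U \<C> \<M>
  for U :: "'u itself" and \<C> :: "('o, 'a) cat" and \<M> +
  fixes I :: "('o, 'a) indep" and base :: "'o set" and A M0 N :: 'o and x y m :: 'a
  assumes basic: "basic_independence_relation TYPE('u) \<C> \<M> I base"
    and three: "three_amalgamation \<C> \<M> I"
    and M0: "M0 \<in> \<M>" and N: "N \<in> \<M>"
    and x: "x \<in> hom \<C> A N" and y: "y \<in> hom \<C> A N" and m: "m \<in> hom \<C> M0 N"
    and xy: "ind \<C> I N x m y"
    and gtp_xy: "gtp_eq \<C> \<M> [x, m] N [y, m] N"
begin

lemma invariance:
  "ind \<C> I M a c b \<Longrightarrow> gtp_eq \<C> \<M> [a, b, c] M [a', b', c'] M' \<Longrightarrow> ind \<C> I M' a' c' b'"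
  using basic unfolding basic_independence_relation_def ind_invariance_def by blast

lemma symmetry: "ind \<C> I M a c b \<Longrightarrow> ind \<C> I M b c a"
  using basic unfolding basic_independence_relation_def ind_symmetry_def by blast

text \<open>An object is a realization \<open>\<alpha>\<close>, in an extension \<open>n\<close>, of the type of \<open>x\<close> over \<open>m\<close> that is
  independent from the domain of \<open>n\<close>; arrows are the maps of extensions that preserve it.\<close>

abbreviation ext where "ext X \<equiv> fst X"
abbreviation elem where "elem X \<equiv> fst (snd X)"
abbreviation par where "par X \<equiv> snd (snd X)"
abbreviation small_map where "small_map f \<equiv> fst (snd (snd f))"
abbreviation large_map where "large_map f \<equiv> snd (snd (snd f))"

definition realization :: "'a \<times> 'a \<times> 'a \<Rightarrow> 'o \<Rightarrow> 'o \<Rightarrow> bool" where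
  "realization X S L \<longleftrightarrow> S \<in> \<M> \<and> L \<in> \<M> \<and> ext X \<in> hom \<C> S L \<and> elem X \<in> hom \<C> A L \<and>
     par X \<in> hom \<C> M0 S \<and> ind \<C> I L (elem X) (ext X \<cdot> par X) (ext X) \<and>
     gtp_eq \<C> \<M> [elem X, ext X \<cdot> par X] L [x, m] N"

definition realization_obj where "realization_obj = {X. realization X (Dom \<C> (ext X)) (Cod \<C> (ext X))}"

definition realization_map where
  "realization_map X Y u v \<longleftrightarrow>
     u \<in> hom \<C> (Dom \<C> (ext X)) (Dom \<C> (ext Y)) \<and> v \<in> hom \<C> (Cod \<C> (ext X)) (Cod \<C> (ext Y)) \<and>
     v \<cdot> ext X = ext Y \<cdot> u \<and> v \<cdot> elem X = elem Y \<and> u \<cdot> par X = par Y"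

text \<open>Arrows record their source and target: \<open>Dom\<close> and \<open>Cod\<close> are
  functions of the arrow alone, and the same two maps may preserve several realizations.\<close>

definition realization_cat where
  "realization_cat = \<lparr>Obj = realization_obj,
     Arr = {(X, Y, u, v). X \<in> realization_obj \<and> Y \<in> realization_obj \<and> realization_map X Y u v},
     Dom = fst, Cod = fst \<circ> snd,
     Id = (\<lambda>X. (X, X, Id \<C> (Dom \<C> (ext X)), Id \<C> (Cod \<C> (ext X)))),
     Comp = (\<lambda>g f. (fst f, fst (snd g), small_map g \<cdot> small_map f, large_map g \<cdot> large_map f))\<rparr>"

lemma realization_objI: "realization X S L \<Longrightarrow> X \<in> realization_obj \<and> Dom \<C> (ext X) = S \<and> Cod \<C> (ext X) = L"
  unfolding realization_obj_def realization_def hom_def by auto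

lemma realization_cat_hom:
  "f \<in> hom realization_cat X Y \<longleftrightarrow> X \<in> realization_obj \<and> Y \<in> realization_obj \<and> realization_map X Y (small_map f) (large_map f) \<and>
     f = (X, Y, small_map f, large_map f)"
  unfolding hom_def realization_cat_def by (cases f) auto

lemma realization_obj_hom:
  assumes "X \<in> realization_obj"
  shows "ext X \<in> hom \<C> (Dom \<C> (ext X)) (Cod \<C> (ext X))" "elem X \<in> hom \<C> A (Cod \<C> (ext X))"
    "par X \<in> hom \<C> M0 (Dom \<C> (ext X))" "Dom \<C> (ext X) \<in> \<M>" "Cod \<C> (ext X) \<in> \<M>"
  using assms by (auto simp: realization_obj_def realization_def)

lemma realization_map_comp:
  assumes f: "realization_map X Y u v" and g: "realization_map Y Z u' v'"
    and "X \<in> realization_obj" "Y \<in> realization_obj" "Z \<in> realization_obj"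
  shows "realization_map X Z (u' \<cdot> u) (v' \<cdot> v)"
proof -
  note X = realization_obj_hom[OF assms(3)] and Y = realization_obj_hom[OF assms(4)] and Z = realization_obj_hom[OF assms(5)]
  have u: "u \<in> hom \<C> (Dom \<C> (ext X)) (Dom \<C> (ext Y))" "u' \<in> hom \<C> (Dom \<C> (ext Y)) (Dom \<C> (ext Z))"
    and v: "v \<in> hom \<C> (Cod \<C> (ext X)) (Cod \<C> (ext Y))" "v' \<in> hom \<C> (Cod \<C> (ext Y)) (Cod \<C> (ext Z))"
    using f g by (auto simp: realization_map_def)
  have "(v' \<cdot> v) \<cdot> ext X = v' \<cdot> (ext Y \<cdot> u)"
    using comp_assoc[OF X(1) v] f by (simp add: realization_map_def)
  also have "\<dots> = (ext Z \<cdot> u') \<cdot> u"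
    using comp_assoc[OF u(1) Y(1) v(2)] g by (simp add: realization_map_def)
  also have "\<dots> = ext Z \<cdot> (u' \<cdot> u)" using comp_assoc[OF u Z(1)] .
  finally show ?thesis
    using comp_assoc[OF X(2) v] comp_assoc[OF X(3) u] comp_hom[OF u] comp_hom[OF v] f g
    by (simp add: realization_map_def)
qed

lemma realization_map_id: "X \<in> realization_obj \<Longrightarrow> realization_map X X (Id \<C> (Dom \<C> (ext X))) (Id \<C> (Cod \<C> (ext X)))"
  using realization_obj_hom[of X] id_comp comp_id id_hom models_obj unfolding realization_map_def by metis

lemma category_realization_cat: "category realization_cat"
  unfolding category_def
proof (intro conjI ballI impI; (elim conjE)?)
  fix f assume "f \<in> Arr realization_cat"
  then have f: "f \<in> hom realization_cat (Dom realization_cat f) (Cod realization_cat f)" by (simp add: hom_def)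
  then show "Dom realization_cat f \<in> Obj realization_cat" "Cod realization_cat f \<in> Obj realization_cat"
    by (simp_all add: realization_cat_hom) (simp_all add: realization_cat_def)
  show "Comp realization_cat f (Id realization_cat (Dom realization_cat f)) = f"
    "Comp realization_cat (Id realization_cat (Cod realization_cat f)) f = f"
    using f comp_id[of "small_map f"] comp_id[of "large_map f"] id_comp[of "small_map f"] id_comp[of "large_map f"]
    unfolding realization_cat_hom realization_map_def by (simp_all add: realization_cat_def prod_eq_iff) metis+
next
  fix X assume "X \<in> Obj realization_cat"
  then have "X \<in> realization_obj" by (simp add: realization_cat_def)
  then show "Id realization_cat X \<in> hom realization_cat X X"
    unfolding realization_cat_hom using realization_map_id by (simp add: realization_cat_def)
next
  fix f g assume "f \<in> Arr realization_cat" "g \<in> Arr realization_cat" and fg: "Cod realization_cat f = Dom realization_cat g"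
  then have "f \<in> hom realization_cat (Dom realization_cat f) (Cod realization_cat f)"
    "g \<in> hom realization_cat (Cod realization_cat f) (Cod realization_cat g)" by (simp_all add: hom_def)
  then show "Comp realization_cat g f \<in> hom realization_cat (Dom realization_cat f) (Cod realization_cat g)"
    unfolding realization_cat_hom by (auto simp: realization_cat_def intro: realization_map_comp)
next
  fix f g h assume "f \<in> Arr realization_cat" "g \<in> Arr realization_cat" "h \<in> Arr realization_cat"
    and "Cod realization_cat f = Dom realization_cat g" "Cod realization_cat g = Dom realization_cat h"
  then have "f \<in> hom realization_cat (Dom realization_cat f) (Cod realization_cat f)"
    "g \<in> hom realization_cat (Cod realization_cat f) (Cod realization_cat g)"
    "h \<in> hom realization_cat (Cod realization_cat g) (Cod realization_cat h)" by (simp_all add: hom_def)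
  then have
    "small_map f \<in> hom \<C> (Dom \<C> (ext (Dom realization_cat f))) (Dom \<C> (ext (Cod realization_cat f)))"
    "small_map g \<in> hom \<C> (Dom \<C> (ext (Cod realization_cat f))) (Dom \<C> (ext (Cod realization_cat g)))"
    "small_map h \<in> hom \<C> (Dom \<C> (ext (Cod realization_cat g))) (Dom \<C> (ext (Cod realization_cat h)))"
    "large_map f \<in> hom \<C> (Cod \<C> (ext (Dom realization_cat f))) (Cod \<C> (ext (Cod realization_cat f)))"
    "large_map g \<in> hom \<C> (Cod \<C> (ext (Cod realization_cat f))) (Cod \<C> (ext (Cod realization_cat g)))"
    "large_map h \<in> hom \<C> (Cod \<C> (ext (Cod realization_cat g))) (Cod \<C> (ext (Cod realization_cat h)))"
    by (simp_all add: realization_cat_hom realization_map_def)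
  then show "Comp realization_cat (Comp realization_cat h g) f = Comp realization_cat h (Comp realization_cat g f)"
    using comp_assoc by (simp add: realization_cat_def)
qed

text \<open>Existence makes \<open>x\<close> independent from \<open>m\<close> over
  \<open>m\<close>, so the extension \<open>m\<close> with the element \<open>x\<close> is a
  starting point. It is the vertex of the cocone on the empty chain.\<close>

lemma initial_realization: "realization (m, x, Id \<C> M0) M0 N"
proof -
  have "m \<cdot> Id \<C> M0 = m" using m by (rule comp_id)
  moreover have "ind \<C> I N x m m"
  proof -
    have "ind_existence \<C> \<M> I base" "\<M> \<subseteq> base"
      using basic unfolding basic_independence_relation_def independence_relation_def by blast+
    then show ?thesis using x m M0 N unfolding ind_existence_def hom_def by blast
  qed
  moreover have "gtp_eq \<C> \<M> [x, m] N [x, m] N"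
    using gtp_xy gtp_eq_sym gtp_eq_trans by blast
  ultimately show ?thesis
    using M0 N m x models_obj id_hom unfolding realization_def by simp
qed

text \<open>3-amalgamation over \<open>M0\<close> makes \<open>f2 \<cdot> \<alpha>\<close> and
  \<open>f1 \<cdot> \<alpha>\<close> behave like \<open>y\<close> and \<open>x\<close>. Of the two
  maps from \<open>K\<close>, \<open>f2\<close> becomes the new extension and \<open>f1\<close> the
  map between large models; that they agree on \<open>S\<close> is the commutativity demanded of an
  arrow.\<close>

lemma next_realization:
  assumes X: "X \<in> realization_obj"
  obtains Y q where "q \<in> hom realization_cat X Y" "Dom \<C> (ext Y) = Cod \<C> (ext X)" "small_map q = ext X"
    "gtp_eq \<C> \<M> [ext Y \<cdot> elem X, elem Y, ext Y \<cdot> par Y] (Cod \<C> (ext Y)) [y, x, m] N"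
proof -
  define n \<alpha> \<mu> S K where "n = ext X" "\<alpha> = elem X" "\<mu> = par X" "S = Dom \<C> (ext X)" "K = Cod \<C> (ext X)"
  note defs = this
  have n: "n \<in> hom \<C> S K" and \<alpha>: "\<alpha> \<in> hom \<C> A K" and \<mu>: "\<mu> \<in> hom \<C> M0 S"
    and S: "S \<in> \<M>" and K: "K \<in> \<M>" using realization_obj_hom[OF X] by (simp_all add: defs)
  have ind: "ind \<C> I K \<alpha> (n \<cdot> \<mu>) n" and gtp: "gtp_eq \<C> \<M> [\<alpha>, n \<cdot> \<mu>] K [x, m] N"
    using X by (simp_all add: realization_obj_def realization_def defs)
  have n\<mu>: "n \<cdot> \<mu> \<in> hom \<C> M0 K" using comp_hom[OF \<mu> n] .
  have "gtp_eq \<C> \<M> [n, n \<cdot> \<mu>] K [n, n \<cdot> \<mu>] K"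
    using gtp_eq_extend[OF id_hom[OF models_obj[OF K]] K K] id_comp[OF n] id_comp[OF n\<mu>] n n\<mu>
    by (metis (mono_tags, lifting) list_all2_Cons list_all2_Nil)
  moreover have "gtp_eq \<C> \<M> [\<alpha>, n \<cdot> \<mu>] K [y, m] N" using gtp_eq_trans[OF gtp gtp_xy] .
  moreover have obj: "A \<in> Obj \<C>" "S \<in> Obj \<C>" using hom_obj[OF x] models_obj[OF S] by auto
  \<comment> \<open>The triangle has the corners \<open>\<alpha>\<close>, \<open>S\<close> and the next element: \<open>K\<close> twice, with \<open>S\<close> in common,
    and \<open>N\<close> for the type that the next element should have over \<open>\<alpha>\<close>.\<close>
  ultimately obtain K' f1 f2 f3 where K': "K' \<in> \<M>" and f: "f1 \<in> hom \<C> K K'" "f2 \<in> hom \<C> K K'" "f3 \<in> hom \<C> N K'"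
    and eq: "f1 \<cdot> (n \<cdot> \<mu>) = f2 \<cdot> (n \<cdot> \<mu>)" "f2 \<cdot> (n \<cdot> \<mu>) = f3 \<cdot> m" "f1 \<cdot> \<alpha> = f3 \<cdot> x" "f1 \<cdot> n = f2 \<cdot> n" "f2 \<cdot> \<alpha> = f3 \<cdot> y"
    and ind': "ind \<C> I K' (f1 \<cdot> \<alpha>) (f1 \<cdot> (n \<cdot> \<mu>)) f2"
    using three[unfolded three_amalgamation_def, rule_format,
        OF M0 K K N obj(1) obj(2) obj(1) \<alpha> x n n \<alpha> y n\<mu> n\<mu> m]
      ind symmetry[OF ind] symmetry[OF xy] gtp by blast
  \<comment> \<open>3-amalgamation gives independence from \<open>f2\<close> itself, hence from the
    whole copy of \<open>K\<close> that becomes the next small model.\<close>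
  define Y where "Y = (f2, f1 \<cdot> \<alpha>, n \<cdot> \<mu>)"
  have gtp': "gtp_eq \<C> \<M> [f2 \<cdot> \<alpha>, f1 \<cdot> \<alpha>, f2 \<cdot> (n \<cdot> \<mu>)] K' [y, x, m] N"
    by (rule gtp_eq_sym, rule gtp_eq_extend[OF f(3) N K']) (use eq x y m in auto)
  have "gtp_eq \<C> \<M> [f1 \<cdot> \<alpha>, f2 \<cdot> (n \<cdot> \<mu>)] K' [x, m] N"
    by (rule gtp_eq_subtuple[OF gtp']) auto
  then have Y: "realization Y K K'"
    using ind' K K' f comp_hom[OF \<alpha> f(1)] n\<mu> eq by (simp add: Y_def realization_def)
  note Y' = realization_objI[OF Y]
  have "Dom \<C> n = S" "Cod \<C> n = K" using n by (auto simp: hom_def)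
  then have "realization_map X Y n f1"
    using n f eq Y' by (simp add: realization_map_def Y_def defs(1-3)[symmetric])
  then have "(X, Y, n, f1) \<in> hom realization_cat X Y" using X Y' by (simp add: realization_cat_hom)
  then show thesis
  proof (rule that)
    show "Dom \<C> (ext Y) = Cod \<C> (ext X)" using Y' by (simp add: defs)
    show "small_map (X, Y, n, f1) = ext X" by (simp add: defs)
    show "gtp_eq \<C> \<M> [ext Y \<cdot> elem X, elem Y, ext Y \<cdot> par Y] (Cod \<C> (ext Y)) [y, x, m] N"
      using gtp' Y' by (simp add: defs[symmetric] Y_def)
  qed
qed

text \<open>A nonempty small ordinal is directed, so the small and the large models have colimits
  that are again models, and the induced map between these is the required extension. The new
  realization is the common image of those in the diagram.\<close>

lemma chain_cocone:
  assumes r: "small_ordinal (r :: 'u rel)" and diag: "diagram realization_cat r D d"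
  shows "\<exists>X z. cocone realization_cat r D d X z"
proof (cases "Field r = {}")
  case True
  moreover have "r = {}" using True by (auto simp: Field_def)
  moreover have "(m, x, Id \<C> M0) \<in> realization_obj" using realization_objI[OF initial_realization] by simp
  ultimately show ?thesis unfolding cocone_def by (auto simp: realization_cat_def)
next
  case False
  then have directed: "directed_poset natLeq r" by (rule small_ordinal_directed[OF r])
  define S K u v where "S i = Dom \<C> (ext (D i))" "K i = Cod \<C> (ext (D i))"
    "u i j = small_map (d i j)" "v i j = large_map (d i j)" for i j
  note defs = this
  have obj: "D i \<in> realization_obj" if "i \<in> Field r" for i
    using diag that by (simp add: diagram_def realization_cat_def)
  note homs = realization_obj_hom[OF obj, folded defs]
  have map: "realization_map (D i) (D j) (u i j) (v i j)" if "(i, j) \<in> r" for i j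
    using diag that by (simp add: diagram_def realization_cat_hom defs)
  have uv: "u i j \<in> hom \<C> (S i) (S j)" "v i j \<in> hom \<C> (K i) (K j)"
    "v i j \<cdot> ext (D i) = ext (D j) \<cdot> u i j" "v i j \<cdot> elem (D i) = elem (D j)" "u i j \<cdot> par (D i) = par (D j)"
    if "(i, j) \<in> r" for i j
    using map[OF that] by (simp_all add: realization_map_def defs)
  have id: "d i i = (D i, D i, Id \<C> (S i), Id \<C> (K i))" if "i \<in> Field r" for i
    using diag that by (simp add: diagram_def realization_cat_def defs)
  have comp: "u j k \<cdot> u i j = u i k \<and> v j k \<cdot> v i j = v i k" if "(i, j) \<in> r" "(j, k) \<in> r" for i j k
  proof -
    have "Comp realization_cat (d j k) (d i j) = d i k" using diag that by (auto simp: diagram_def)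
    then show ?thesis by (simp add: realization_cat_def defs prod_eq_iff)
  qed
  have dS: "diagram \<C> r S u" and dK: "diagram \<C> r K v"
    using homs uv comp id models_obj by (auto simp: diagram_def defs)
  obtain S' l where S': "S' \<in> \<M>" "colimit \<C> r S u S' l" using model_colimit[OF directed dS homs(4)] .
  obtain K' k where K': "K' \<in> \<M>" "colimit \<C> r K v K' k" using model_colimit[OF directed dK homs(5)] .
  have l: "l i \<in> hom \<C> (S i) S'" and k: "k i \<in> hom \<C> (K i) K'" if "i \<in> Field r" for i
    using S'(2) K'(2) that by (auto simp: colimit_def cocone_def)
  have lu: "l j \<cdot> u i j = l i" and kv: "k j \<cdot> v i j = k i" if "(i, j) \<in> r" for i j
    using S'(2) K'(2) that by (auto simp: colimit_def cocone_def)
  have F: "i \<in> Field r \<and> j \<in> Field r" if "(i, j) \<in> r" for i j using that by (auto simp: Field_def)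
  have cone: "cocone \<C> r S u K' (\<lambda>i. k i \<cdot> ext (D i))"
    unfolding cocone_def
  proof (intro conjI ballI allI impI)
    show "K' \<in> Obj \<C>" using K' models_obj by blast
    show "k i \<cdot> ext (D i) \<in> hom \<C> (S i) K'" if "i \<in> Field r" for i
      using comp_hom[OF homs(1)[OF that] k[OF that]] .
    fix i j assume ij: "(i, j) \<in> r"
    have "(k j \<cdot> ext (D j)) \<cdot> u i j = k j \<cdot> (v i j \<cdot> ext (D i))"
      using comp_assoc[OF uv(1)[OF ij] homs(1) k] F[OF ij] uv(3)[OF ij] by simp
    also have "\<dots> = k i \<cdot> ext (D i)"
      using comp_assoc[OF homs(1) uv(2)[OF ij] k] F[OF ij] kv[OF ij] by simp
    finally show "(k j \<cdot> ext (D j)) \<cdot> u i j = k i \<cdot> ext (D i)" .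
  qed
  obtain n where n: "n \<in> hom \<C> S' K'" "\<And>i. i \<in> Field r \<Longrightarrow> n \<cdot> l i = k i \<cdot> ext (D i)"
    using colimit_induced[OF S'(2) cone] by blast
  obtain i0 where i0: "i0 \<in> Field r" using False by blast
  \<comment> \<open>Defined at one arbitrary stage; as \<open>r\<close> is total and the maps are
    coherent, every other stage gives the same arrows.\<close>
  define \<alpha> \<mu> where "\<alpha> = k i0 \<cdot> elem (D i0)" "\<mu> = l i0 \<cdot> par (D i0)"
  have up: "k i \<cdot> elem (D i) = k j \<cdot> elem (D j) \<and> l i \<cdot> par (D i) = l j \<cdot> par (D j)" if "(i, j) \<in> r" for i j
    using comp_assoc[OF homs(2) uv(2)[OF that] k] comp_assoc[OF homs(3) uv(1)[OF that] l] F[OF that]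
      uv(4,5)[OF that] lu[OF that] kv[OF that] by simp
  have r': "Total r" "Refl r" using r unfolding small_ordinal_def order_on_defs by auto
  have \<alpha>\<mu>: "k i \<cdot> elem (D i) = \<alpha>" "l i \<cdot> par (D i) = \<mu>" if "i \<in> Field r" for i
  proof -
    have "(i, i0) \<in> r \<or> (i0, i) \<in> r" using r' that i0 by (metis refl_onD total_on_def)
    then show "k i \<cdot> elem (D i) = \<alpha>" "l i \<cdot> par (D i) = \<mu>" using up unfolding \<alpha>_\<mu>_def by metis+
  qed
  have n\<mu>: "n \<cdot> \<mu> = k i \<cdot> (ext (D i) \<cdot> par (D i))" if "i \<in> Field r" for i
    using comp_assoc[OF homs(3)[OF that] l[OF that] n(1)] n(2)[OF that] \<alpha>\<mu>(2)[OF that]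
      comp_assoc[OF homs(3)[OF that] homs(1)[OF that] k[OF that]] by simp
  have \<alpha>: "\<alpha> \<in> hom \<C> A K'" and \<mu>: "\<mu> \<in> hom \<C> M0 S'"
    using comp_hom[OF homs(2)[OF i0] k[OF i0]] comp_hom[OF homs(3)[OF i0] l[OF i0]] by (simp_all add: \<alpha>_\<mu>_def)
  have real: "ind \<C> I (K i) (elem (D i)) (ext (D i) \<cdot> par (D i)) (ext (D i))"
    "gtp_eq \<C> \<M> [elem (D i), ext (D i) \<cdot> par (D i)] (K i) [x, m] N" if "i \<in> Field r" for i
    using obj[OF that] by (simp_all add: realization_obj_def realization_def defs)
  have gtp_i: "gtp_eq \<C> \<M> [elem (D i), ext (D i), ext (D i) \<cdot> par (D i)] (K i)
      [\<alpha>, k i \<cdot> ext (D i), n \<cdot> \<mu>] K'" if "i \<in> Field r" for i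
    using that homs(1-3)[OF that] \<alpha>\<mu>(1)[OF that] n\<mu>[OF that]
      comp_hom[OF homs(3)[OF that] homs(1)[OF that]]
    by (intro gtp_eq_extend[OF k homs(5) K'(1)]) auto
  have ind_i: "ind \<C> I K' \<alpha> (n \<cdot> \<mu>) (k i \<cdot> ext (D i))" if "i \<in> Field r" for i
    using invariance[OF real(1) gtp_i] that by blast
  \<comment> \<open>Union is applied to the small models, with colimit \<open>S'\<close>;
    \<open>\<alpha>\<close> and the base \<open>n \<cdot> \<mu>\<close> are already the same at all
    stages.\<close>
  have "ind_union TYPE('u) \<C> \<M> I" using basic by (simp add: basic_independence_relation_def)
  then have ind: "ind \<C> I K' \<alpha> (n \<cdot> \<mu>) n"
    unfolding ind_union_def
    using directed dS K'(1) cone S'(2) n ind_i \<alpha> comp_hom[OF \<mu> n(1)] unfolding hom_def by blast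
  have "gtp_eq \<C> \<M> [\<alpha>, n \<cdot> \<mu>] K' [elem (D i0), ext (D i0) \<cdot> par (D i0)] (K i0)"
    by (rule gtp_eq_subtuple[OF gtp_eq_sym[OF gtp_i[OF i0]]]) auto
  then have "gtp_eq \<C> \<M> [\<alpha>, n \<cdot> \<mu>] K' [x, m] N" using real(2)[OF i0] by (rule gtp_eq_trans)
  then have X: "realization (n, \<alpha>, \<mu>) S' K'"
    using ind n(1) \<alpha> \<mu> S'(1) K'(1) by (simp add: realization_def)
  have "Dom \<C> n = S'" "Cod \<C> n = K'" using n(1) by (auto simp: hom_def)
  then have "cocone realization_cat r D d (n, \<alpha>, \<mu>) (\<lambda>i. (D i, (n, \<alpha>, \<mu>), l i, k i))"
    unfolding cocone_def realization_cat_hom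
    using realization_objI[OF X] obj l k n(2) \<alpha>\<mu> lu kv diag
    by (auto simp: realization_map_def defs[symmetric] realization_cat_def diagram_def hom_def)
  then show ?thesis by blast
qed

text \<open>Stage \<open>i\<close> passes from \<open>L i\<close> to \<open>D i\<close>, whose small
  model is the large model of \<open>L i\<close>. This is how \<open>elem (L i)\<close> enters the
  chain of small models and from there the vertex \<open>Z\<close>. In the pair type to be repeated,
  the earlier member plays \<open>y\<close> and the later one \<open>x\<close>.\<close>

lemma long_indiscernible_sequence:
  assumes r: "small_ordinal (r :: 'u rel)"
  obtains K m' s where "K \<in> \<M>" "m' \<in> hom \<C> M0 K" "\<And>i. i \<in> Field r \<Longrightarrow> s i \<in> hom \<C> A K"
    and "\<And>i j. (i, j) \<in> r \<Longrightarrow> i \<noteq> j \<Longrightarrow> gtp_eq \<C> \<M> [s i, s j, m'] K [y, x, m] N"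
proof -
  interpret real: cat realization_cat using category_realization_cat by unfold_locales
  define Q where "Q q \<longleftrightarrow> (let X = fst q; Y = fst (snd q) in
      Dom \<C> (ext Y) = Cod \<C> (ext X) \<and> small_map q = ext X \<and>
      gtp_eq \<C> \<M> [ext Y \<cdot> elem X, elem Y, ext Y \<cdot> par Y] (Cod \<C> (ext Y)) [y, x, m] N)"
    for q :: "('a \<times> 'a \<times> 'a) \<times> ('a \<times> 'a \<times> 'a) \<times> 'a \<times> 'a"
  have next_arrow: "\<exists>Y. \<exists>q\<in>hom realization_cat X Y. Q q" if X: "X \<in> Obj realization_cat" for X
  proof -
    have "X \<in> realization_obj" using X by (simp add: realization_cat_def)
    then obtain Y q where q: "q \<in> hom realization_cat X Y" "Dom \<C> (ext Y) = Cod \<C> (ext X)" "small_map q = ext X"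
      "gtp_eq \<C> \<M> [ext Y \<cdot> elem X, elem Y, ext Y \<cdot> par Y] (Cod \<C> (ext Y)) [y, x, m] N"
      using next_realization by blast
    moreover have "fst q = X" "fst (snd q) = Y" using q(1) by (auto simp: hom_def realization_cat_def)
    ultimately show ?thesis unfolding Q_def Let_def by blast
  qed
  have cocones: "\<exists>L z. cocone realization_cat (Restr r (underS r i)) D d L z"
    if "diagram realization_cat (Restr r (underS r i)) D d" for i D d
    using chain_cocone[OF small_ordinal_Restr[OF r] that] .
  have "Well_order r" using r by (simp add: small_ordinal_def)
  from real.transfinite_chain[OF this cocones next_arrow]
  obtain D d L q t where D: "diagram realization_cat r D d"
    and q: "\<And>i. i \<in> Field r \<Longrightarrow> q i \<in> hom realization_cat (L i) (D i) \<and> Q (q i)"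
    and t: "\<And>i j. (j, i) \<in> r \<Longrightarrow> j \<noteq> i \<Longrightarrow>
      t i j \<in> hom realization_cat (D j) (L i) \<and> d j i = Comp realization_cat (q i) (t i j)"
    by metis
  obtain Z z where Z: "cocone realization_cat r D d Z z" using chain_cocone[OF r D] by blast
  have Zobj: "Z \<in> realization_obj" using Z by (simp add: cocone_def realization_cat_def)
  note Zh = realization_obj_hom[OF Zobj]
  have q_obj: "L i \<in> realization_obj" "D i \<in> realization_obj"
    and q_dom: "Dom \<C> (ext (D i)) = Cod \<C> (ext (L i))" and q_map: "small_map (q i) = ext (L i)"
    and q_gtp: "gtp_eq \<C> \<M> [ext (D i) \<cdot> elem (L i), elem (D i), ext (D i) \<cdot> par (D i)] (Cod \<C> (ext (D i))) [y, x, m] N"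
    if "i \<in> Field r" for i
  proof -
    have "fst (q i) = L i" "fst (snd (q i)) = D i" using q[OF that] by (auto simp: hom_def realization_cat_def)
    then show "L i \<in> realization_obj" "D i \<in> realization_obj"
      "Dom \<C> (ext (D i)) = Cod \<C> (ext (L i))" "small_map (q i) = ext (L i)"
      "gtp_eq \<C> \<M> [ext (D i) \<cdot> elem (L i), elem (D i), ext (D i) \<cdot> par (D i)] (Cod \<C> (ext (D i))) [y, x, m] N"
      using q[OF that] by (simp_all add: realization_cat_hom Q_def Let_def)
  qed
  define e where "e i = small_map (z i)" for i
  have z: "realization_map (D i) Z (e i) (large_map (z i))" if "i \<in> Field r" for i
    using Z that by (simp add: cocone_def realization_cat_hom e_def)
  have e: "e i \<in> hom \<C> (Cod \<C> (ext (L i))) (Dom \<C> (ext Z))" "e i \<cdot> par (D i) = par Z" if "i \<in> Field r" for i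
    using z[OF that] q_dom[OF that] by (simp_all add: realization_map_def)
  show thesis
  proof (rule that[of "Dom \<C> (ext Z)" "par Z" "\<lambda>i. e i \<cdot> elem (L i)"])
    show "Dom \<C> (ext Z) \<in> \<M>" "par Z \<in> hom \<C> M0 (Dom \<C> (ext Z))" by (fact Zh)+
    show "e i \<cdot> elem (L i) \<in> hom \<C> A (Dom \<C> (ext Z))" if "i \<in> Field r" for i
      using comp_hom[OF realization_obj_hom(2)[OF q_obj(1)[OF that]] e(1)[OF that]] .
    fix j i assume ji: "(j, i) \<in> r" "j \<noteq> i"
    then have F: "j \<in> Field r" "i \<in> Field r" by (auto simp: Field_def)
    define u v where "u = small_map (t i j)" "v = large_map (t i j)"
    note Dj = realization_obj_hom[OF q_obj(2)[OF F(1)]] and Di = realization_obj_hom[OF q_obj(2)[OF F(2)]]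
      and Lj = realization_obj_hom[OF q_obj(1)[OF F(1)]] and Li = realization_obj_hom[OF q_obj(1)[OF F(2)]]
    have uv: "u \<in> hom \<C> (Dom \<C> (ext (D j))) (Dom \<C> (ext (L i)))" "v \<in> hom \<C> (Cod \<C> (ext (D j))) (Cod \<C> (ext (L i)))"
      "v \<cdot> ext (D j) = ext (L i) \<cdot> u" "v \<cdot> elem (D j) = elem (L i)" "u \<cdot> par (D j) = par (L i)"
      using t[OF ji] by (auto simp: realization_cat_hom realization_map_def u_v_def)
    have "z j = Comp realization_cat (z i) (Comp realization_cat (q i) (t i j))"
      using Z ji(1) t[OF ji] unfolding cocone_def by metis
    then have ej: "e i \<cdot> (ext (L i) \<cdot> u) = e j"
      using q_map[OF F(2)] by (simp add: realization_cat_def e_def u_v_def)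
    \<comment> \<open>The large model of \<open>D j\<close> reaches the small model of
      \<open>Z\<close> through the large model of \<open>L i\<close>. Restricted to the small model
      of \<open>D j\<close> this map is \<open>e j\<close>, and it sends \<open>elem (D j)\<close>
      to member \<open>i\<close>. Hence the type fixed at stage \<open>j\<close> is the type of
      members \<open>j\<close> and \<open>i\<close> for every later \<open>i\<close>.\<close>
    have g: "e i \<cdot> v \<in> hom \<C> (Cod \<C> (ext (D j))) (Dom \<C> (ext Z))"
      using comp_hom[OF uv(2) e(1)[OF F(2)]] .
    have Lj': "elem (L j) \<in> hom \<C> A (Dom \<C> (ext (D j)))" using Lj(2) q_dom[OF F(1)] by simp
    have "(e i \<cdot> v) \<cdot> ext (D j) = e j"
      using comp_assoc[OF Dj(1) uv(2) e(1)[OF F(2)]] uv(3) ej by simp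
    then have 1: "(e i \<cdot> v) \<cdot> (ext (D j) \<cdot> elem (L j)) = e j \<cdot> elem (L j)"
      and 3: "(e i \<cdot> v) \<cdot> (ext (D j) \<cdot> par (D j)) = par Z"
      using comp_assoc[OF Lj' Dj(1) g] comp_assoc[OF Dj(3) Dj(1) g] e(2)[OF F(1)] by simp_all
    have 2: "(e i \<cdot> v) \<cdot> elem (D j) = e i \<cdot> elem (L i)"
      using comp_assoc[OF Dj(2) uv(2) e(1)[OF F(2)]] uv(4) by simp
    have "gtp_eq \<C> \<M> [ext (D j) \<cdot> elem (L j), elem (D j), ext (D j) \<cdot> par (D j)] (Cod \<C> (ext (D j)))
        [e j \<cdot> elem (L j), e i \<cdot> elem (L i), par Z] (Dom \<C> (ext Z))"
      using comp_hom[OF Lj' Dj(1)] comp_hom[OF Dj(3) Dj(1)] Dj(2) 1 2 3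
      by (intro gtp_eq_extend[OF g Dj(5) Zh(4)]) auto
    then show "gtp_eq \<C> \<M> [e j \<cdot> elem (L j), e i \<cdot> elem (L i), par Z] (Dom \<C> (ext Z)) [y, x, m] N"
      using q_gtp[OF F(1)] gtp_eq_sym gtp_eq_trans by blast
  qed
qed

end

section \<open>Strongly 2-indiscernible pairs\<close>

context independent_pair
begin

text \<open>As all pairs look like \<open>(y, x)\<close>, the earlier of two members looks like
  \<open>y\<close> and the later like \<open>x\<close>; that these agree over the base is
  \<open>gtp_xy\<close>. All types are restricted from a model to an object \<open>C\<close> below
  it.\<close>

lemma two_indiscernibleI:
  assumes r: "small_ordinal (r :: 'u rel)" and m': "m' \<in> hom \<C> M0 K" and h: "h \<in> hom \<C> C M0"
    and s: "\<And>i. i \<in> Field r \<Longrightarrow> s i \<in> hom \<C> A K"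
    and gtp: "\<And>i j. (i, j) \<in> r \<Longrightarrow> i \<noteq> j \<Longrightarrow> gtp_eq \<C> \<M> [s i, s j, m'] K [y, x, m] N"
  shows "two_indiscernible \<C> \<M> A K (m' \<cdot> h) r s"
  unfolding two_indiscernible_def
proof (intro conjI allI impI ballI; (elim conjE)?)
  have pairs: "gtp_eq \<C> \<M> [s i, s j, m' \<cdot> h] K [y, x, m \<cdot> h] N" if "(i, j) \<in> r" "i \<noteq> j" for i j
    by (rule gtp_eq_subtuple[OF gtp_eq_precomp[OF gtp[OF that] _ m' h]]) auto
  have xy': "gtp_eq \<C> \<M> [x, m \<cdot> h] N [y, m \<cdot> h] N"
    by (rule gtp_eq_subtuple[OF gtp_eq_precomp[OF gtp_xy _ m h]]) auto
  fix i1 i2 j1 j2 assume i: "(i1, i2) \<in> r" "i1 \<noteq> i2" and j: "(j1, j2) \<in> r" "j1 \<noteq> j2"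
  show "gtp_eq \<C> \<M> [s i1, s i2, m' \<cdot> h] K [s j1, s j2, m' \<cdot> h] K"
    using pairs[OF i] pairs[OF j] gtp_eq_sym gtp_eq_trans by blast
  have "gtp_eq \<C> \<M> [s i1, m' \<cdot> h] K [y, m \<cdot> h] N" "gtp_eq \<C> \<M> [s i2, m' \<cdot> h] K [x, m \<cdot> h] N"
    by (rule gtp_eq_subtuple[OF pairs[OF i]]; simp)+
  then show "gtp_eq \<C> \<M> [s i1, m' \<cdot> h] K [s i2, m' \<cdot> h] K"
    using xy' gtp_eq_sym gtp_eq_trans by blast
qed (use r s in blast)+

text \<open>The sequence \<open>y\<close>, \<open>x\<close> of length two extends to any length: a
  long sequence has the same pair type throughout, so two of its members can be identified with
  \<open>y\<close> and \<open>x\<close> in a common extension.\<close>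

lemma two_indisc_step_pair:
  assumes c: "c \<in> hom \<C> C N" and cm: "sub_le \<C> c m"
  shows "two_indisc_step TYPE('u) \<C> \<M> A N c y x"
proof -
  obtain h where h: "h \<in> hom \<C> C M0" "c = m \<cdot> h" using sub_leE[OF cm c m] .
  obtain p q :: 'u where pq: "p \<noteq> q"
    using UNIV_infinite by (metis (full_types) finite.emptyI finite_insert finite_subset insertCI subsetI)
  define r where "r = {(p, p), (p, q), (q, q)}"
  define s where "s i = (if i = p then y else x)" for i
  have F: "Field r = {p, q}" by (auto simp: r_def Field_def)
  have "r - Relation.Id = {(p, q)}" using pq by (auto simp: r_def)
  then have "wf (r - Relation.Id)" using pq by simp
  moreover have "Linear_order r"
    using pq F by (auto simp: r_def order_on_defs refl_on_def trans_def antisym_def total_on_def)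
  ultimately have well: "Well_order r" by (simp add: well_order_on_def)
  then have r: "small_ordinal r" by (simp add: small_ordinal_def F small_finite)
  have "gtp_eq \<C> \<M> [y, x, m] N [y, x, m] N"
    using N x y m id_comp[OF x] id_comp[OF y] id_comp[OF m]
    by (intro gtp_eq_extend[OF id_hom[OF models_obj[OF N]]]) auto
  then have indisc: "two_indiscernible \<C> \<M> A N c r s"
    unfolding h(2) using r m h(1) x y pq by (intro two_indiscernibleI) (auto simp: F s_def r_def)
  have "strongly_two_indiscernible \<C> \<M> A N c r s"
    unfolding strongly_two_indiscernible_def
  proof (intro conjI allI impI indisc)
    fix \<gamma> :: "'u rel" assume \<gamma>: "small_ordinal \<gamma>"
    \<comment> \<open>\<open>r\<close> has to embed as an initial segment even if
      \<open>\<gamma>\<close> is shorter than two.\<close>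
    have "\<exists>r' :: 'u rel. small_ordinal r' \<and> \<gamma> \<le>o r' \<and> r \<le>o r'"
      using ordLeq_total[of \<gamma> r] ordLeq_reflexive[OF well] ordLeq_reflexive[of \<gamma>] \<gamma> r
      unfolding small_ordinal_def by blast
    then obtain r' :: "'u rel" where r': "small_ordinal r'" "\<gamma> \<le>o r'" "r \<le>o r'" by blast
    obtain e where e: "embed r r' e" using r'(3) unfolding ordLeq_def by blast
    obtain K m' t where K: "K \<in> \<M>" "m' \<in> hom \<C> M0 K" "\<And>i. i \<in> Field r' \<Longrightarrow> t i \<in> hom \<C> A K"
      and t: "\<And>i j. (i, j) \<in> r' \<Longrightarrow> i \<noteq> j \<Longrightarrow> gtp_eq \<C> \<M> [t i, t j, m'] K [y, x, m] N"
      using long_indiscernible_sequence[OF r'(1)] by blast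
    have "(p, q) \<in> r" by (simp add: r_def)
    then have "(e p, e q) \<in> r'" "e p \<noteq> e q"
      using embed_compat[OF e] embed_inj_on[OF well e] pq F by (auto simp: compat_def inj_on_def)
    \<comment> \<open>A model witnessing that the members at the positions of \<open>p\<close> and
      \<open>q\<close> have the type of \<open>(y, x)\<close> over \<open>m\<close>; there the long
      sequence continues the given pair.\<close>
    then obtain L f f' where L: "L \<in> \<M>" "f \<in> hom \<C> K L" "f' \<in> hom \<C> N L"
      and "map (Comp \<C> f) [t (e p), t (e q), m'] = map (Comp \<C> f') [y, x, m]"
      using t[of "e p" "e q"] unfolding gtp_eq_def by blast
    then have eq: "f \<cdot> t (e p) = f' \<cdot> y" "f \<cdot> t (e q) = f' \<cdot> x" "f \<cdot> m' = f' \<cdot> m" by simp_all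
    have "two_indiscernible \<C> \<M> A L (f \<cdot> (m' \<cdot> h)) r' (\<lambda>i. f \<cdot> t i)"
      by (rule two_indiscernible_extend[OF two_indiscernibleI[OF r'(1) K(2) h(1) K(3) t] L(2,1)])
    moreover have "f \<cdot> (m' \<cdot> h) = f' \<cdot> c"
      using comp_assoc[OF h(1) K(2) L(2)] comp_assoc[OF h(1) m L(3)] eq(3) h(2) by simp
    moreover have "\<forall>i\<in>Field r. f \<cdot> t (e i) = f' \<cdot> s i" using eq(1,2) F by (auto simp: s_def)
    ultimately show "\<exists>N'\<in>\<M>. \<exists>f\<in>hom \<C> N N'. \<exists>(r' :: 'u rel) s' e.
        two_indiscernible \<C> \<M> A N' (f \<cdot> c) r' s' \<and> \<gamma> \<le>o r' \<and> embed r r' e \<and>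
        (\<forall>i\<in>Field r. s' (e i) = f \<cdot> s i)"
      using L(1,3) r'(2) e by (intro bexI[of _ L] bexI[of _ f'] exI conjI) auto
  qed
  then show ?thesis
    unfolding two_indisc_step_def
    using N x y F pq id_comp[OF c] id_comp[OF x] id_comp[OF y] models_obj
    by (intro conjI bexI[of _ N] bexI[of _ "Id \<C> N"] exI[of _ r] exI[of _ s] bexI[of _ p] bexI[of _ q])
      (auto simp: s_def intro: id_hom)
qed

end

section \<open>A Lascar step as two indiscernible steps\<close>

context aecat
begin

text \<open>An independent realization of the common type of \<open>a\<close> and \<open>b\<close> over the model \<open>M0\<close> is
  independent from all of \<open>N\<close>, so it starts a long indiscernible sequence with either of them.\<close>

lemma lgtp_step_imp_two_indisc_equiv:
  assumes basic: "basic_independence_relation TYPE('u) \<C> \<M> I base" and three: "three_amalgamation \<C> \<M> I"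
    and M: "M \<in> \<M>" and c: "c \<in> hom \<C> C M" and lgtp: "lgtp_step \<C> \<M> A M c a b"
  shows "two_indisc_equiv TYPE('u) \<C> \<M> A M c a b"
proof -
  interpret stable: extension_stable U \<C> \<M> A C "two_indisc_step TYPE('u) \<C> \<M> A"
    by (rule two_indisc_step_extension_stable)
  obtain N f M0 m where ab: "a \<in> hom \<C> A M" "b \<in> hom \<C> A M" and N: "N \<in> \<M>" "f \<in> hom \<C> M N"
    and M0: "M0 \<in> \<M>" and m: "m \<in> hom \<C> M0 N" and cm: "sub_le \<C> (f \<cdot> c) m"
    and gtp: "gtp_eq \<C> \<M> [f \<cdot> a, m] N [f \<cdot> b, m] N"
    using lgtp unfolding lgtp_step_def by blast
  have fa: "f \<cdot> a \<in> hom \<C> A N" and fb: "f \<cdot> b \<in> hom \<C> A N" and fc: "f \<cdot> c \<in> hom \<C> C N"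
    using ab c N(2) comp_hom by blast+
  have ind_ex: "ind_existence \<C> \<M> I base" "\<M> \<subseteq> base" and ind_ext: "ind_extension \<C> \<M> I"
    and ind_mono: "ind_monotonicity \<C> I" and ind_sym: "ind_symmetry \<C> I"
    using basic unfolding basic_independence_relation_def independence_relation_def by blast+
  have "ind \<C> I N (f \<cdot> a) m m"
    using ind_ex fa m M0 N(1) unfolding ind_existence_def hom_def by blast
  moreover have id: "Id \<C> N \<in> hom \<C> N N" using id_hom models_obj N(1) by blast
  moreover have "sub_le \<C> m (Id \<C> N)" using sub_leI[OF m id] id_comp[OF m] by simp
  \<comment> \<open>\<open>Id \<C> N\<close> as the enlarged right-hand side makes \<open>a'\<close>
    independent from all of \<open>N\<close>; \<open>m\<close> occurs twice because Existence has it
    both as base and on the right.\<close>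
  ultimately have "\<exists>K\<in>\<M>. \<exists>g\<in>hom \<C> N K. \<exists>a'\<in>hom \<C> (Dom \<C> (f \<cdot> a)) K.
      gtp_eq \<C> \<M> [a', g \<cdot> m, g \<cdot> m] K [f \<cdot> a, m, m] N \<and> ind \<C> I K a' (g \<cdot> m) (g \<cdot> Id \<C> N)"
    using ind_ext[unfolded ind_extension_def, rule_format, of N "f \<cdot> a" m m "Id \<C> N"] N(1) fa m
    by (simp add: hom_def)
  moreover have "Dom \<C> (f \<cdot> a) = A" using fa by (simp add: hom_def)
  ultimately obtain K g a' where K: "K \<in> \<M>" "g \<in> hom \<C> N K" "a' \<in> hom \<C> A K"
    and gtp': "gtp_eq \<C> \<M> [a', g \<cdot> m, g \<cdot> m] K [f \<cdot> a, m, m] N" and ind': "ind \<C> I K a' (g \<cdot> m) g"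
    using comp_id by metis
  have gm: "g \<cdot> m \<in> hom \<C> M0 K" using comp_hom[OF m K(2)] .
  have a': "gtp_eq \<C> \<M> [a', g \<cdot> m] K [f \<cdot> a, m] N" by (rule gtp_eq_subtuple[OF gtp']) auto
  have cm': "sub_le \<C> (g \<cdot> (f \<cdot> c)) (g \<cdot> m)" using sub_le_extend[OF cm K(2) fc m] .
  \<comment> \<open>Used for \<open>a\<close> and for \<open>b\<close>. Monotonicity concerns the
    left argument, so shrinking \<open>g\<close> to \<open>g \<cdot> x\<close> takes symmetry before
    and after it.\<close>
  have step: "two_indisc_step TYPE('u) \<C> \<M> A K (g \<cdot> (f \<cdot> c)) (g \<cdot> x) a'"
    if x: "x \<in> hom \<C> A N" "gtp_eq \<C> \<M> [f \<cdot> a, m] N [x, m] N" for x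
  proof -
    have "sub_le \<C> (g \<cdot> x) g" by (rule sub_leI[OF x(1) K(2) refl])
    then have "ind \<C> I K a' (g \<cdot> m) (g \<cdot> x)"
      using ind' ind_mono ind_sym unfolding ind_monotonicity_def ind_symmetry_def by blast
    moreover have "gtp_eq \<C> \<M> [x, m] N [g \<cdot> x, g \<cdot> m] K"
      using x(1) m by (intro gtp_eq_extend[OF K(2) N(1) K(1)]) auto
    then have "gtp_eq \<C> \<M> [a', g \<cdot> m] K [g \<cdot> x, g \<cdot> m] K"
      using a' x(2) gtp_eq_trans by blast
    ultimately interpret independent_pair U \<C> \<M> I base A M0 K a' "g \<cdot> x" "g \<cdot> m"
      using basic three M0 K gm comp_hom[OF x(1) K(2)] by unfold_locales
    show ?thesis using two_indisc_step_pair[OF comp_hom[OF fc K(2)] cm'] .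
  qed
  have "gtp_eq \<C> \<M> [f \<cdot> a, m] N [f \<cdot> a, m] N" using gtp gtp_eq_sym gtp_eq_trans by blast
  \<comment> \<open>The link \<open>a'\<close> is an arrow into \<open>K\<close>, so the chain is
    formed there and then restricted to \<open>N\<close> and to \<open>M\<close>.\<close>
  then have "(two_indisc_step TYPE('u) \<C> \<M> A K (g \<cdot> (f \<cdot> c)))\<^sup>+\<^sup>+ (g \<cdot> (f \<cdot> a)) (g \<cdot> (f \<cdot> b))"
    using step[OF fa] two_indisc_step_sym[OF step[OF fb gtp]] by (meson tranclp.intros)
  then have "stable.R_trancl K (g \<cdot> (f \<cdot> c)) (g \<cdot> (f \<cdot> a)) (g \<cdot> (f \<cdot> b))"
    using stable.R_tranclI K(1) comp_hom[OF fc K(2)] by blast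
  then have "stable.R_trancl N (f \<cdot> c) (f \<cdot> a) (f \<cdot> b)"
    using stable.R_trancl_restrict K(2) fc fa fb by blast
  then show ?thesis
    unfolding two_indisc_equiv_def using stable.R_trancl_restrict N(2) c ab by blast
qed

lemma lgtp_eq_imp_two_indisc_equiv:
  assumes "basic_independence_relation TYPE('u) \<C> \<M> I base" "three_amalgamation \<C> \<M> I"
    and "a \<in> hom \<C> A M" "b \<in> hom \<C> A M" "c \<in> hom \<C> C M" "lgtp_eq \<C> \<M> A M c a b"
  shows "two_indisc_equiv TYPE('u) \<C> \<M> A M c a b"
proof -
  interpret stable: extension_stable U \<C> \<M> A C "two_indisc_step TYPE('u) \<C> \<M> A"
    by (rule two_indisc_step_extension_stable)
  show ?thesis
    using stable.R_trancl_generated[of "lgtp_step \<C> \<M> A" M c a b] assms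
      lgtp_step_imp_two_indisc_equiv[OF assms(1,2)]
    unfolding lgtp_eq_def two_indisc_equiv_def by (metis lgtp_step_def)
qed

end

section \<open>Loewenheim--Skolem for models\<close>

lemma dir_image_inv:
  assumes "inj_on \<phi> (Field r)" "(k, l) \<in> dir_image r \<phi>"
  shows "(inv_into (Field r) \<phi> k, inv_into (Field r) \<phi> l) \<in> r"
proof -
  obtain i j where ij: "(i, j) \<in> r" "k = \<phi> i" "l = \<phi> j" using assms(2) by (auto simp: dir_image_def)
  then have "i \<in> Field r" "j \<in> Field r" by (auto simp: Field_def)
  then show ?thesis using ij assms(1) by simp
qed

lemma directed_poset_dir_image:
  assumes "directed_poset l r" "inj_on \<phi> (Field r)" "small TYPE('u) (Field (dir_image r \<phi>))"
  shows "directed_poset l (dir_image r \<phi> :: 'u rel)"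
  unfolding directed_poset_def
proof (intro conjI allI impI)
  have r: "Partial_order r" using assms(1) by (simp add: directed_poset_def)
  then show "Partial_order (dir_image r \<phi>)" by (rule Partial_order_dir_image[OF _ assms(2)])
  show "small TYPE('u) (Field (dir_image r \<phi>))" by (fact assms(3))
  fix S assume S: "S \<subseteq> Field (dir_image r \<phi>)" "|S| <o l"
  let ?T = "inv_into (Field r) \<phi> ` S"
  have S': "S \<subseteq> \<phi> ` Field r" using S(1) dir_image_Field[of r \<phi>] r
    by (simp add: order_on_defs)
  have "|?T| <o l" using card_of_image S(2) by (rule ordLeq_ordLess_trans)
  moreover have "?T \<subseteq> Field r" using S' by (auto intro: inv_into_into)
  ultimately obtain u where u: "u \<in> Field r" "\<forall>i\<in>?T. (i, u) \<in> r"
    using assms(1) unfolding directed_poset_def by blast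
  have "(k, \<phi> u) \<in> dir_image r \<phi>" if "k \<in> S" for k
  proof -
    have "\<phi> (inv_into (Field r) \<phi> k) = k" using S' that by (auto intro: f_inv_into_f)
    moreover have "(inv_into (Field r) \<phi> k, u) \<in> r" using u(2) that by blast
    ultimately show ?thesis unfolding dir_image_def by force
  qed
  moreover have "(u, u) \<in> r" using r u(1) by (auto simp: order_on_defs refl_on_def)
  then have "\<phi> u \<in> Field (dir_image r \<phi>)" by (auto simp: dir_image_def Field_def)
  ultimately show "\<exists>u\<in>Field (dir_image r \<phi>). \<forall>i\<in>S. (i, u) \<in> dir_image r \<phi>" by blast
qed

section \<open>Reindexing and decomposing colimits\<close>

context cat
begin

text \<open>Cocones on a diagram and on its copy along \<open>\<phi>\<close> are the same up to
  renaming of the indices, hence so are the universal properties.\<close>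

lemma colimit_reindex:
  assumes "inj_on \<phi> (Field r)" "Refl r"
    and D: "\<And>i. i \<in> Field r \<Longrightarrow> D' (\<phi> i) = D i"
    and d: "\<And>i j. (i, j) \<in> r \<Longrightarrow> d' (\<phi> i) (\<phi> j) = d i j"
    and colim: "colimit \<C> (dir_image r \<phi>) D' d' L l"
  shows "colimit \<C> r D d L (\<lambda>i. l (\<phi> i))"
proof -
  have F: "Field (dir_image r \<phi>) = \<phi> ` Field r" by (simp add: dir_image_Field assms(2))
  have cocone: "cocone \<C> (dir_image r \<phi>) D' d' X x \<longleftrightarrow> cocone \<C> r D d X (\<lambda>i. x (\<phi> i))" for X x
  proof -
    have "(\<forall>k l. (k, l) \<in> dir_image r \<phi> \<longrightarrow> x l \<cdot> d' k l = x k) \<longleftrightarrow>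
        (\<forall>i j. (i, j) \<in> r \<longrightarrow> x (\<phi> j) \<cdot> d i j = x (\<phi> i))"
      using d by (auto simp: dir_image_def) metis+
    then show ?thesis unfolding cocone_def F using D by simp
  qed
  show ?thesis
    unfolding colimit_def
  proof (intro conjI allI impI)
    show "cocone \<C> r D d L (\<lambda>i. l (\<phi> i))" using colimit_cocone[OF colim] by (simp add: cocone)
    fix X x assume "cocone \<C> r D d X x"
    then have "cocone \<C> r D d X (\<lambda>i. x (inv_into (Field r) \<phi> (\<phi> i)))"
      unfolding cocone_def using assms(1) by (simp add: FieldI1 FieldI2)
    then have "cocone \<C> (dir_image r \<phi>) D' d' X (\<lambda>k. x (inv_into (Field r) \<phi> k))"
      by (simp add: cocone)
    from colim[unfolded colimit_def, THEN conjunct2, rule_format, OF this]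
    have "\<exists>!h. h \<in> hom \<C> L X \<and> (\<forall>k\<in>\<phi> ` Field r. h \<cdot> l k = x (inv_into (Field r) \<phi> k))"
      by (simp only: F)
    then show "\<exists>!h. h \<in> hom \<C> L X \<and> (\<forall>i\<in>Field r. h \<cdot> l (\<phi> i) = x i)"
      using assms(1) by simp
  qed
qed

lemma cocone_subset: "cocone \<C> r' D d X x \<Longrightarrow> r \<subseteq> r' \<Longrightarrow> cocone \<C> r D d X x"
  using mono_Field[of r r'] unfolding cocone_def by blast

lemma diagram_Restr: "diagram \<C> r D d \<Longrightarrow> diagram \<C> (Restr r S) D d"
  unfolding diagram_def by (auto simp: Field_def)

text \<open>A colimit of colimits: a compatible family on the vertices \<open>L k\<close> gives a
  cocone on \<open>D\<close> by using, for each \<open>i\<close>, any \<open>k\<close> with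
  \<open>i\<close> in \<open>Sub k\<close>; upper bounds in \<open>p\<close> make the choice of
  \<open>k\<close> immaterial.\<close>

lemma colimit_of_subdiagrams:
  assumes refl: "Refl r" and diag: "diagram \<C> r D d" and colim: "colimit \<C> r D d M x"
    and p: "Refl p" "trans p" "\<And>k l. k \<in> Field p \<Longrightarrow> l \<in> Field p \<Longrightarrow> \<exists>m. (k, m) \<in> p \<and> (l, m) \<in> p"
    and sub: "\<And>k. k \<in> Field p \<Longrightarrow> Sub k \<subseteq> Field r" "\<And>k l. (k, l) \<in> p \<Longrightarrow> Sub k \<subseteq> Sub l"
      "\<And>i. i \<in> Field r \<Longrightarrow> \<exists>k\<in>Field p. i \<in> Sub k"
    and colims: "\<And>k. k \<in> Field p \<Longrightarrow> colimit \<C> (Restr r (Sub k)) D d (L k) (y k)"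
  obtains e \<psi> where "diagram \<C> p L e" "colimit \<C> p L e M \<psi>"
proof -
  have F: "Field (Restr r (Sub k)) = Sub k" if "k \<in> Field p" for k
    using sub(1)[OF that] refl by (auto simp: Field_def refl_on_def)
  have Fp: "k \<in> Field p \<and> l \<in> Field p" if "(k, l) \<in> p" for k l using that by (auto simp: Field_def)
  have cone: "cocone \<C> (Restr r (Sub k)) D d (L k) (y k)" if "k \<in> Field p" for k
    using colimit_cocone[OF colims[OF that]] .
  have y: "y k i \<in> hom \<C> (D i) (L k)" if "k \<in> Field p" "i \<in> Sub k" for k i
    using cone[OF that(1)] that F[OF that(1)] by (simp add: cocone_def)
  have yd: "y k j \<cdot> d i j = y k i" if "k \<in> Field p" "i \<in> Sub k" "j \<in> Sub k" "(i, j) \<in> r" for k i j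
    using cone[OF that(1)] that by (simp add: cocone_def)
  have unique: "g = h" if "k \<in> Field p" "g \<in> hom \<C> (L k) X" "h \<in> hom \<C> (L k) X"
      "\<And>i. i \<in> Sub k \<Longrightarrow> g \<cdot> y k i = h \<cdot> y k i" for k g h X
    using colimit_unique[OF diagram_Restr[OF diag] colims[OF that(1)] that(2,3)] that(4) F[OF that(1)] by simp
  have "cocone \<C> (Restr r (Sub k)) D d (L l) (y l)" if "(k, l) \<in> p" for k l
    using Fp[OF that] sub(2)[OF that] by (intro cocone_subset[OF cone]) auto
  then have "\<exists>h. h \<in> hom \<C> (L k) (L l) \<and> (\<forall>i\<in>Sub k. h \<cdot> y k i = y l i)" if "(k, l) \<in> p" for k l
    using colimit_induced[OF colims] Fp[OF that] F that by metis
  then obtain e where e: "\<And>k l. (k, l) \<in> p \<Longrightarrow> e k l \<in> hom \<C> (L k) (L l)"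
    "\<And>k l i. (k, l) \<in> p \<Longrightarrow> i \<in> Sub k \<Longrightarrow> e k l \<cdot> y k i = y l i"
    by metis
  have x: "x i \<in> hom \<C> (D i) M" if "i \<in> Field r" for i
    using colim that by (simp add: colimit_def cocone_def)
  have "cocone \<C> (Restr r (Sub k)) D d M x" if "k \<in> Field p" for k
    using colim by (intro cocone_subset[OF colimit_cocone]) auto
  then have "\<exists>h. h \<in> hom \<C> (L k) M \<and> (\<forall>i\<in>Sub k. h \<cdot> y k i = x i)" if "k \<in> Field p" for k
    using colimit_induced[OF colims] F that by metis
  then obtain \<psi> where \<psi>: "\<And>k. k \<in> Field p \<Longrightarrow> \<psi> k \<in> hom \<C> (L k) M"
    "\<And>k i. k \<in> Field p \<Longrightarrow> i \<in> Sub k \<Longrightarrow> \<psi> k \<cdot> y k i = x i"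
    by metis
  have dp: "diagram \<C> p L e"
    unfolding diagram_def
  proof (intro conjI ballI allI impI; (elim conjE)?)
    fix k assume k: "k \<in> Field p"
    show Lk: "L k \<in> Obj \<C>" using hom_obj[OF \<psi>(1)[OF k]] by blast
    have kk: "(k, k) \<in> p" using k p(1) by (simp add: refl_on_def)
    show "e k k = Id \<C> (L k)"
      by (rule unique[OF k e(1)[OF kk] id_hom[OF Lk]]) (use e(2)[OF kk] id_comp[OF y[OF k]] in simp)
  next
    fix k l m assume kl: "(k, l) \<in> p" and lm: "(l, m) \<in> p"
    have km: "(k, m) \<in> p" using transD[OF p(2) kl lm] .
    show "e l m \<cdot> e k l = e k m"
    proof (rule unique[OF _ comp_hom[OF e(1)[OF kl] e(1)[OF lm]] e(1)[OF km]])
      show k: "k \<in> Field p" using Fp[OF kl] by blast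
      fix i assume i: "i \<in> Sub k"
      have "(e l m \<cdot> e k l) \<cdot> y k i = e l m \<cdot> (e k l \<cdot> y k i)"
        using comp_assoc[OF y[OF k i] e(1)[OF kl] e(1)[OF lm]] .
      also have "\<dots> = e k m \<cdot> y k i"
        using e(2)[OF kl i] e(2)[OF km i] e(2)[OF lm] sub(2)[OF kl] i by auto
      finally show "(e l m \<cdot> e k l) \<cdot> y k i = e k m \<cdot> y k i" .
    qed
  qed (rule e(1))
  have cp: "cocone \<C> p L e M \<psi>"
    unfolding cocone_def
  proof (intro conjI ballI allI impI)
    show "M \<in> Obj \<C>" using colim by (simp add: colimit_def cocone_def)
    fix k l assume kl: "(k, l) \<in> p"
    then have k: "k \<in> Field p" and l: "l \<in> Field p" using Fp by blast+
    show "\<psi> l \<cdot> e k l = \<psi> k"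
    proof (rule unique[OF k comp_hom[OF e(1)[OF kl] \<psi>(1)[OF l]] \<psi>(1)[OF k]])
      fix i assume i: "i \<in> Sub k"
      then have "i \<in> Sub l" using sub(2)[OF kl] by blast
      then show "(\<psi> l \<cdot> e k l) \<cdot> y k i = \<psi> k \<cdot> y k i"
        using comp_assoc[OF y[OF k i] e(1)[OF kl] \<psi>(1)[OF l]] e(2)[OF kl i] \<psi>(2)[OF l] \<psi>(2)[OF k i] by simp
    qed
  qed (rule \<psi>(1))
  have "colimit \<C> p L e M \<psi>"
    unfolding colimit_def
  proof (intro conjI allI impI cp)
    fix X z assume z: "cocone \<C> p L e X z"
    have zh: "z k \<in> hom \<C> (L k) X" if "k \<in> Field p" for k using z that by (simp add: cocone_def)
    have up: "z k \<cdot> y k i = z m \<cdot> y m i" if km: "(k, m) \<in> p" and i: "i \<in> Sub k" for k m i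
    proof -
      have k: "k \<in> Field p" and m: "m \<in> Field p" using Fp[OF km] by blast+
      have "z k = z m \<cdot> e k m" using z km by (simp add: cocone_def)
      then show ?thesis using comp_assoc[OF y[OF k i] e(1)[OF km] zh[OF m]] e(2)[OF km i] by simp
    qed
    have indep: "z k \<cdot> y k i = z l \<cdot> y l i"
      if k: "k \<in> Field p" "i \<in> Sub k" and l: "l \<in> Field p" "i \<in> Sub l" for k l i
    proof -
      obtain m where m: "(k, m) \<in> p" "(l, m) \<in> p" using p(3)[OF k(1) l(1)] by blast
      show ?thesis using up[OF m(1) k(2)] up[OF m(2) l(2)] by simp
    qed
    obtain w where w: "\<And>i. i \<in> Field r \<Longrightarrow> w i \<in> Field p \<and> i \<in> Sub (w i)"
      using sub(3) by metis
    define v where "v i = z (w i) \<cdot> y (w i) i" for i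
    have v: "v i = z k \<cdot> y k i" if "i \<in> Field r" "k \<in> Field p" "i \<in> Sub k" for i k
      unfolding v_def using indep[OF _ _ that(2,3)] w[OF that(1)] by blast
    have "cocone \<C> r D d X v"
      unfolding cocone_def
    proof (intro conjI ballI allI impI)
      show "X \<in> Obj \<C>" using z by (simp add: cocone_def)
      show "v i \<in> hom \<C> (D i) X" if "i \<in> Field r" for i
        using comp_hom y zh w[OF that] unfolding v_def by blast
      fix i j assume ij: "(i, j) \<in> r"
      then have i: "i \<in> Field r" and j: "j \<in> Field r" by (auto simp: Field_def)
      obtain m where m: "(w i, m) \<in> p" "(w j, m) \<in> p" using p(3) w[OF i] w[OF j] by blast
      then have mF: "m \<in> Field p" "i \<in> Sub m" "j \<in> Sub m"
        using Fp sub(2) w[OF i] w[OF j] by blast+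
      have "d i j \<in> hom \<C> (D i) (D j)" using diag ij by (simp add: diagram_def)
      then show "v j \<cdot> d i j = v i"
        using comp_assoc[OF _ y[OF mF(1,3)] zh[OF mF(1)]] yd[OF mF ij] v[OF i mF(1,2)] v[OF j mF(1,3)] by simp
    qed
    then obtain h where h: "h \<in> hom \<C> M X" "\<And>i. i \<in> Field r \<Longrightarrow> h \<cdot> x i = v i"
      using colimit_induced[OF colim] by blast
    have h\<psi>: "h \<cdot> \<psi> k = z k" if k: "k \<in> Field p" for k
    proof (rule unique[OF k comp_hom[OF \<psi>(1)[OF k] h(1)] zh[OF k]])
      fix i assume i: "i \<in> Sub k"
      then have "i \<in> Field r" using sub(1)[OF k] by blast
      then show "(h \<cdot> \<psi> k) \<cdot> y k i = z k \<cdot> y k i"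
        using comp_assoc[OF y[OF k i] \<psi>(1)[OF k] h(1)] \<psi>(2)[OF k i] h(2) v k i by simp
    qed
    moreover have "g = h" if g: "g \<in> hom \<C> M X" "\<forall>k\<in>Field p. g \<cdot> \<psi> k = z k" for g
    proof (rule colimit_unique[OF diag colim g(1) h(1)])
      fix i assume i: "i \<in> Field r"
      note wi = conjunct1[OF w[OF i]] conjunct2[OF w[OF i]]
      have "(g \<cdot> \<psi> (w i)) \<cdot> y (w i) i = g \<cdot> x i"
        using comp_assoc[OF y[OF wi] \<psi>(1)[OF wi(1)] g(1)] \<psi>(2)[OF wi] by simp
      then show "g \<cdot> x i = h \<cdot> x i" using g(2) wi h(2)[OF i] by (simp add: v_def)
    qed
    ultimately show "\<exists>!h. h \<in> hom \<C> M X \<and> (\<forall>k\<in>Field p. h \<cdot> \<psi> k = z k)"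
      using h(1) by blast
  qed
  then show thesis using that dp by blast
qed

end

text \<open>Countably many rounds close a set under a binary operation: elements appearing in rounds
  \<open>a\<close> and \<open>b\<close> are both present after \<open>a + b\<close> rounds. Neither
  a single round nor the countable union exceeds the size of the infinite set
  \<open>K\<close>.\<close>

lemma closure_under_operation:
  fixes ub :: "'x \<Rightarrow> 'x \<Rightarrow> 'x" and K :: "'y set"
  assumes "infinite K" "|T| \<le>o |K|" "T \<subseteq> F" "\<And>i j. i \<in> F \<Longrightarrow> j \<in> F \<Longrightarrow> ub i j \<in> F"
  obtains S where "T \<subseteq> S" "S \<subseteq> F" "|S| \<le>o |K|" "\<forall>i\<in>S. \<forall>j\<in>S. ub i j \<in> S"
proof -
  define G where "G S = S \<union> (\<lambda>(i, j). ub i j) ` (S \<times> S)" for S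
  define S where "S = (\<Union>n. (G ^^ n) T)"
  have "|(G ^^ n) T| \<le>o |K| \<and> (G ^^ n) T \<subseteq> F" for n
  proof (induction n)
    case (Suc n)
    let ?S = "(G ^^ n) T"
    have K: "infinite (Field |K| )" using assms(1) by (simp add: Field_card_of)
    have S: "|?S| \<le>o |K|" using Suc by blast
    have "|?S \<times> ?S| \<le>o |K|"
      by (rule card_of_Times_ordLeq_infinite_Field[OF K S S card_of_Card_order])
    then have "|(\<lambda>(i, j). ub i j) ` (?S \<times> ?S)| \<le>o |K|"
      by (rule ordLeq_transitive[OF card_of_image])
    then have "|G ?S| \<le>o |K|"
      by (subst G_def) (rule card_of_Un_ordLeq_infinite_Field[OF K S _ card_of_Card_order])
    moreover have "?S \<subseteq> F" using Suc by blast
    then have "G ?S \<subseteq> F" using assms(4) by (auto simp: G_def[of "?S"])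
    ultimately show ?case by simp
  qed (use assms in simp)
  then have iter: "\<forall>n\<in>UNIV. |(G ^^ n) T| \<le>o |K|" "\<And>n. (G ^^ n) T \<subseteq> F" by simp_all
  have "|UNIV :: nat set| \<le>o |K|" using assms(1) by (simp add: infinite_iff_card_of_nat)
  then have "|S| \<le>o |K|"
    unfolding S_def using iter(1) by (rule card_of_UNION_ordLeq_infinite[OF assms(1)])
  moreover have "S \<subseteq> F" using iter(2) by (simp add: S_def UN_subset_iff)
  moreover have "T \<subseteq> S" using UN_upper[of 0 UNIV "\<lambda>n. (G ^^ n) T"] by (simp add: S_def)
  moreover have "ub i j \<in> S" if ij: "i \<in> S" "j \<in> S" for i j
  proof -
    obtain a b where ab: "i \<in> (G ^^ a) T" "j \<in> (G ^^ b) T" using ij by (auto simp: S_def)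
    have mono: "(G ^^ a) T \<subseteq> (G ^^ (a + k)) T" for a k by (induction k) (auto simp: G_def)
    have "i \<in> (G ^^ (a + b)) T" "j \<in> (G ^^ (a + b)) T"
      using ab mono[of a b] mono[of b a] by (auto simp: add.commute)
    then have "ub i j \<in> (G ^^ Suc (a + b)) T" by (auto simp: G_def)
    then show ?thesis unfolding S_def by blast
  qed
  ultimately show thesis using that by blast
qed

section \<open>Small families of models\<close>

context aecat
begin

lemma locally_small_hom: "small TYPE('u) (hom \<C> X Y)"
proof (cases "X \<in> Obj \<C> \<and> Y \<in> Obj \<C>")
  case True
  then show ?thesis using AECat unfolding AECat_def accessible_def locally_small_def by blast
next
  case False
  then have "hom \<C> X Y = {}" using hom_obj by blast
  then show ?thesis by (simp add: small_finite)
qed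

text \<open>Posets of the given size are spread over all of \<open>'u\<close>, but their copies on
  \<open>K\<close> form a small set. One vertex for each diagram on \<open>K\<close> is enough,
  since reindexing turns its colimit into one of the original diagram.\<close>

lemma representatives_of_colimits:
  fixes K :: "'u set"
  assumes P: "small TYPE('u) P" "P \<subseteq> \<M>" and K: "small TYPE('u) K"
  obtains Q where "small TYPE('u) Q" "Q \<subseteq> \<M>"
    and "\<forall>(r :: 'u rel) D d. directed_poset natLeq r \<and> diagram \<C> r D d \<and>
      (\<forall>i\<in>Field r. D i \<in> P) \<and> |Field r| \<le>o |K| \<longrightarrow> (\<exists>L\<in>Q. \<exists>l. colimit \<C> r D d L l)"
proof -
  define H where "H = (\<Union>X\<in>P. \<Union>Y\<in>P. hom \<C> X Y)"
  \<comment> \<open>\<open>undefined\<close> is the value of \<open>D'\<close> and \<open>d'\<close>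
    off the copied poset; it has to be added to \<open>P\<close> and \<open>H\<close>, as it may lie
    outside them.\<close>
  define T where "T = Pow (K \<times> K) \<times> Func K (insert undefined P) \<times> Func (K \<times> K) (insert undefined H)"
  have insert: "small TYPE('u) (insert undefined X)" if "small TYPE('u) X" for X :: "'b set"
    using small_Un[OF small_finite[of "{undefined}"] that] by simp
  have "small TYPE('u) H" unfolding H_def by (intro small_UN P locally_small_hom)
  then have T: "small TYPE('u) T"
    unfolding T_def by (intro small_Times small_Pow small_Func insert K P)
  \<comment> \<open>Chosen for every code, also for those that are no directed diagrams of models;
    values that are not models are discarded by the intersection with \<open>\<M>\<close>.\<close>
  define vertex where "vertex t = (SOME L. L \<in> \<M> \<and>
      (\<exists>l. colimit \<C> (fst t) (fst (snd t)) (curry (snd (snd t))) L l))" for t :: "'u rel \<times> ('u \<Rightarrow> 'o) \<times> ('u \<times> 'u \<Rightarrow> 'a)"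
  show thesis
  proof (rule that[of "vertex ` T \<inter> \<M>"]; (intro allI impI; elim conjE)?)
    show "small TYPE('u) (vertex ` T \<inter> \<M>)" by (rule small_subset[OF small_image[OF T] Int_lower1])
    show "vertex ` T \<inter> \<M> \<subseteq> \<M>" by blast
    fix r :: "'u rel" and D d
    assume "directed_poset natLeq r" "diagram \<C> r D d" "\<forall>i\<in>Field r. D i \<in> P" "|Field r| \<le>o |K|"
    then have r: "directed_poset natLeq r" "diagram \<C> r D d" "\<And>i. i \<in> Field r \<Longrightarrow> D i \<in> P" "|Field r| \<le>o |K|"
      by blast+
    obtain \<phi> where \<phi>: "inj_on \<phi> (Field r)" "\<phi> ` Field r \<subseteq> K" using r(4) card_of_ordLeq[of "Field r" K] by blast
    have refl: "Refl r" using r(1) by (simp add: directed_poset_def order_on_defs)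
    define r' where "r' = dir_image r \<phi>"
    define \<psi> where "\<psi> = inv_into (Field r) \<phi>"
    define D' where "D' k = (if k \<in> \<phi> ` Field r then D (\<psi> k) else undefined)" for k
    define d' where "d' kl = (if kl \<in> r' then d (\<psi> (fst kl)) (\<psi> (snd kl)) else undefined)" for kl
    have \<psi>: "\<psi> (\<phi> i) = i" if "i \<in> Field r" for i using \<phi>(1) that by (simp add: \<psi>_def)
    have F: "Field r' = \<phi> ` Field r" by (simp add: r'_def dir_image_Field refl)
    have r'E: "(\<psi> k, \<psi> l) \<in> r \<and> k \<in> \<phi> ` Field r \<and> l \<in> \<phi> ` Field r" if "(k, l) \<in> r'" for k l
      using dir_image_inv[OF \<phi>(1)] that F FieldI1[OF that] FieldI2[OF that] by (simp add: r'_def \<psi>_def)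
    have hom: "d i j \<in> hom \<C> (D i) (D j)" "D i \<in> P" "D j \<in> P" if "(i, j) \<in> r" for i j
      using r(2,3) that by (auto simp: diagram_def Field_def)
    have r'K: "r' \<subseteq> K \<times> K"
    proof (rule subrelI)
      fix k l assume "(k, l) \<in> r'"
      then show "(k, l) \<in> K \<times> K" using r'E[of k l] \<phi>(2) by (simp add: subset_iff)
    qed
    moreover have "D' \<in> Func K (insert undefined P)"
      using \<phi>(2) \<psi> r(3) by (auto simp: Func_def D'_def)
    moreover have "d' \<in> Func (K \<times> K) (insert undefined H)"
    proof -
      have "d' kl \<in> insert undefined H" for kl
      proof (cases "kl \<in> r'")
        case True
        then have "(\<psi> (fst kl), \<psi> (snd kl)) \<in> r" using r'E[of "fst kl" "snd kl"] by simp
        note hom[OF this]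
        then have "d (\<psi> (fst kl)) (\<psi> (snd kl)) \<in> H" unfolding H_def by blast
        then show ?thesis using True by (simp add: d'_def)
      qed (simp add: d'_def)
      moreover have "d' kl = undefined" if "kl \<notin> K \<times> K" for kl
        using that r'K by (auto simp: d'_def)
      ultimately show ?thesis unfolding Func_def by blast
    qed
    ultimately have t: "(r', D', d') \<in> T" by (simp add: T_def)
    have directed: "directed_poset natLeq r'"
      unfolding r'_def
    proof (rule directed_poset_dir_image[OF r(1) \<phi>(1)])
      show "small TYPE('u) (Field (dir_image r \<phi>))"
        using F small_subset[OF K \<phi>(2)] by (simp add: r'_def)
    qed
    have "diagram \<C> r' D' (curry d')"
      unfolding diagram_def
    proof (intro conjI ballI allI impI; (elim conjE)?)
      fix k assume "k \<in> Field r'"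
      then obtain i where i: "i \<in> Field r" "k = \<phi> i" using F by blast
      then have "(i, i) \<in> r" using refl by (simp add: refl_on_def)
      then have "(k, k) \<in> r'" using i by (auto simp: r'_def dir_image_def)
      then show "D' k \<in> Obj \<C>" "curry d' k k = Id \<C> (D' k)"
        using i \<psi> r(2) by (auto simp: D'_def d'_def diagram_def)
    next
      fix k l assume kl: "(k, l) \<in> r'"
      then show "curry d' k l \<in> hom \<C> (D' k) (D' l)"
        using r'E[OF kl] hom(1) by (simp add: D'_def d'_def)
    next
      fix k l m assume klm: "(k, l) \<in> r'" "(l, m) \<in> r'"
      have "trans r'" using directed by (simp add: directed_poset_def order_on_defs)
      then have "(k, m) \<in> r'" using klm by (blast dest: transD)
      moreover have "d (\<psi> l) (\<psi> m) \<cdot> d (\<psi> k) (\<psi> l) = d (\<psi> k) (\<psi> m)"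
        using r(2) r'E[OF klm(1)] r'E[OF klm(2)] unfolding diagram_def by blast
      ultimately show "curry d' l m \<cdot> curry d' k l = curry d' k m"
        using klm by (simp add: d'_def)
    qed
    moreover have "D' k \<in> \<M>" if "k \<in> Field r'" for k
      using that F \<psi> r(3) P(2) by (auto simp: D'_def)
    ultimately obtain L l where "L \<in> \<M>" "colimit \<C> r' D' (curry d') L l"
      using model_colimit[OF directed] by blast
    then have "\<exists>L. L \<in> \<M> \<and> (\<exists>l. colimit \<C> r' D' (curry d') L l)" by blast
    from someI_ex[OF this]
    have "vertex (r', D', d') \<in> \<M> \<and> (\<exists>l. colimit \<C> r' D' (curry d') (vertex (r', D', d')) l)"
      by (simp only: vertex_def fst_conv snd_conv)
    then obtain l where l: "vertex (r', D', d') \<in> \<M>" "colimit \<C> r' D' (curry d') (vertex (r', D', d')) l"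
      by blast
    have "colimit \<C> r D d (vertex (r', D', d')) (\<lambda>i. l (\<phi> i))"
    proof (rule colimit_reindex[OF \<phi>(1) refl])
      show "D' (\<phi> i) = D i" if "i \<in> Field r" for i using that \<psi> by (simp add: D'_def)
      show "curry d' (\<phi> i) (\<phi> j) = d i j" if ij: "(i, j) \<in> r" for i j
      proof -
        have "(\<phi> i, \<phi> j) \<in> r'" using ij by (auto simp: r'_def dir_image_def)
        then show ?thesis using \<psi>[OF FieldI1[OF ij]] \<psi>[OF FieldI2[OF ij]] by (simp add: d'_def)
      qed
      show "colimit \<C> (dir_image r \<phi>) D' (curry d') (vertex (r', D', d')) l"
        using l(2) by (simp only: r'_def)
    qed
    then show "\<exists>L\<in>vertex ` T \<inter> \<M>. \<exists>l. colimit \<C> r D d L l" using t l(1) by blast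
  qed
qed

text \<open>The factorizations \<open>h i\<close> are compatible after composition with
  \<open>n\<close>, hence compatible because \<open>n\<close> is a monomorphism; they therefore
  induce an arrow from the colimit.\<close>

lemma factor_through_colimit:
  assumes diag: "diagram \<C> r D d" and colim: "colimit \<C> r D d X x" and f: "f \<in> hom \<C> X M"
    and n: "n \<in> hom \<C> L M"
    and factor: "\<And>i. i \<in> Field r \<Longrightarrow> \<exists>h\<in>hom \<C> (D i) L. f \<cdot> x i = n \<cdot> h"
  obtains f' where "f' \<in> hom \<C> X L" "f = n \<cdot> f'"
proof -
  obtain h where h: "\<And>i. i \<in> Field r \<Longrightarrow> h i \<in> hom \<C> (D i) L" "\<And>i. i \<in> Field r \<Longrightarrow> f \<cdot> x i = n \<cdot> h i"
    using factor by metis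
  have x: "x i \<in> hom \<C> (D i) X" if "i \<in> Field r" for i
    using colim that by (simp add: colimit_def cocone_def)
  have "cocone \<C> r D d L h"
    unfolding cocone_def
  proof (intro conjI ballI allI impI)
    show "L \<in> Obj \<C>" using hom_obj[OF n] by blast
    fix i j assume ij: "(i, j) \<in> r"
    then have i: "i \<in> Field r" and j: "j \<in> Field r" by (auto simp: Field_def)
    have d: "d i j \<in> hom \<C> (D i) (D j)" using diag ij by (simp add: diagram_def)
    have "x j \<cdot> d i j = x i" using colim ij by (simp add: colimit_def cocone_def)
    then have "n \<cdot> (h j \<cdot> d i j) = n \<cdot> h i"
      using comp_assoc[OF d h(1)[OF j] n] comp_assoc[OF d x[OF j] f] h(2)[OF i] h(2)[OF j] by simp
    then show "h j \<cdot> d i j = h i"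
      using mono_cancel[OF n comp_hom[OF d h(1)[OF j]] h(1)[OF i]] by blast
  qed (rule h(1))
  then obtain f' where f': "f' \<in> hom \<C> X L" "\<And>i. i \<in> Field r \<Longrightarrow> f' \<cdot> x i = h i"
    using colimit_induced[OF colim] by blast
  have "n \<cdot> f' = f"
    by (rule colimit_unique[OF diag colim comp_hom[OF f'(1) n] f])
      (use comp_assoc[OF x f'(1) n] f'(2) h(2) in simp)
  then show thesis using that f'(1) by blast
qed

end

lemma directed_poset_mono:
  fixes r :: "'u rel"
  assumes "directed_poset l r" "l' \<le>o l"
  shows "directed_poset l' r"
  unfolding directed_poset_def
proof (intro conjI allI impI)
  show "Partial_order r" "small TYPE('u) (Field r)" using assms(1) by (simp_all add: directed_poset_def)
  fix S assume "S \<subseteq> Field r" "|S| <o l'"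
  moreover from this have "|S| <o l" using assms(2) ordLess_ordLeq_trans by blast
  ultimately show "\<exists>u\<in>Field r. \<forall>i\<in>S. (i, u) \<in> r"
    using assms(1) unfolding directed_poset_def by blast
qed

lemma accessibleE:
  assumes "accessible TYPE('u) \<D>"
  obtains l :: "'u rel" and P where "small_regular_cardinal l" "small TYPE('u) P" "\<forall>X\<in>P. presentable l \<D> X"
    "\<forall>X\<in>Obj \<D>. \<exists>(r :: 'u rel) D d x. directed_poset l r \<and> diagram \<D> r D d \<and>
       (\<forall>i\<in>Field r. D i \<in> P) \<and> colimit \<D> r D d X x"
  using assms unfolding accessible_def by (elim conjE exE) (rule that)

section \<open>Factorization through small models\<close>

context aecat
begin

text \<open>Since models have all directed colimits, subsets closed under a choice of upper bounds suffice
  to raise the degree of directedness; no sharp inequality between cardinals is needed.\<close>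

lemma colimit_of_small_subdiagrams:
  fixes K :: "'u set"
  assumes K: "infinite K" and r: "directed_poset natLeq (r :: 'u rel)"
    and diag: "diagram \<C> r D d" and colim: "colimit \<C> r D d M x"
    and colims: "\<forall>S. directed_poset natLeq (Restr r S) \<and> S \<subseteq> Field r \<and> |S| \<le>o |K| \<longrightarrow>
      (\<exists>L\<in>Q. \<exists>l. colimit \<C> (Restr r S) D d L l)"
  obtains p :: "'u rel" and L e \<psi> where "Partial_order p" "small TYPE('u) (Field p)"
    and "\<forall>R. R \<subseteq> Field p \<and> |R| \<le>o |K| \<longrightarrow> (\<exists>u\<in>Field p. \<forall>k\<in>R. (k, u) \<in> p)"
    and "diagram \<C> p L e" "colimit \<C> p L e M \<psi>" "\<forall>k\<in>Field p. L k \<in> Q"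
proof -
  have po: "Partial_order r" and refl: "Refl r" and trans: "trans r" and small_r: "small TYPE('u) (Field r)"
    and ub_ex: "\<And>S. S \<subseteq> Field r \<Longrightarrow> finite S \<Longrightarrow> \<exists>u\<in>Field r. \<forall>i\<in>S. (i, u) \<in> r"
    using r unfolding directed_poset_def order_on_defs finite_iff_ordLess_natLeq by blast+
  have "\<exists>u. u \<in> Field r \<and> (i, u) \<in> r \<and> (j, u) \<in> r" if "i \<in> Field r" "j \<in> Field r" for i j
    using ub_ex[of "{i, j}"] that by blast
  then obtain ub where ub: "\<And>i j. i \<in> Field r \<Longrightarrow> j \<in> Field r \<Longrightarrow> ub i j \<in> Field r"
    "\<And>i j. i \<in> Field r \<Longrightarrow> j \<in> Field r \<Longrightarrow> (i, ub i j) \<in> r \<and> (j, ub i j) \<in> r"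
    by metis
  obtain i0 where i0: "i0 \<in> Field r" using ub_ex[of "{}"] by blast
  \<comment> \<open>A nonempty subset closed under the chosen upper bounds is directed, and every
    subset of size at most \<open>|K|\<close> lies in such a subset within the same size
    bound.\<close>
  define \<S> where "\<S> = {S. S \<subseteq> Field r \<and> S \<noteq> {} \<and> |S| \<le>o |K| \<and> (\<forall>i\<in>S. \<forall>j\<in>S. ub i j \<in> S)}"
  have close: "\<exists>S\<in>\<S>. T \<subseteq> S" if T: "T \<subseteq> Field r" "|T| \<le>o |K|" for T
  proof -
    have KF: "infinite (Field |K| )" using K by (simp add: Field_card_of)
    have "|{i0}| \<le>o |K|" using K by (intro card_of_singl_ordLeq) auto
    then have card: "|insert i0 T| \<le>o |K|"
      using card_of_Un_ordLeq_infinite_Field[OF KF _ T(2) card_of_Card_order, of "{i0}"] by simp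
    have sub: "insert i0 T \<subseteq> Field r" using T(1) i0 by blast
    obtain S where "insert i0 T \<subseteq> S" "S \<subseteq> Field r" "|S| \<le>o |K|"
      "\<forall>i\<in>S. \<forall>j\<in>S. ub i j \<in> S"
      using closure_under_operation[where ub = ub, OF K card sub ub(1)] .
    then show ?thesis unfolding \<S>_def by (intro bexI[of _ S]) auto
  qed
  have small_S: "small TYPE('u) \<S>"
    by (rule small_subset[OF small_Pow[OF small_r]]) (auto simp: \<S>_def)
  \<comment> \<open>Index posets are relations on \<open>'u\<close>, so the subsets are coded by
    elements of \<open>'u\<close>.\<close>
  obtain \<phi> :: "'u set \<Rightarrow> 'u" where \<phi>: "inj_on \<phi> \<S>" using small_inj_into[OF small_S] .
  define Sub where "Sub = inv_into \<S> \<phi>"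
  have Sub: "Sub (\<phi> S) = S" if "S \<in> \<S>" for S using \<phi> that by (simp add: Sub_def)
  define p where "p = {(k, l). k \<in> \<phi> ` \<S> \<and> l \<in> \<phi> ` \<S> \<and> Sub k \<subseteq> Sub l}"
  have Fp: "Field p = \<phi> ` \<S>" by (auto simp: p_def Field_def)
  have SubS: "Sub k \<in> \<S>" if "k \<in> Field p" for k using that Sub Fp by auto
  have inj: "k = l" if "k \<in> Field p" "l \<in> Field p" "Sub k = Sub l" for k l using that Sub Fp by auto
  have po_p: "Partial_order p"
    unfolding order_on_defs
  proof (intro conjI)
    show "Refl p" unfolding refl_on_def Fp by (simp add: p_def)
    show "trans p" by (auto simp: trans_def p_def)
    show "p \<subseteq> Field p \<times> Field p" by (auto simp: Field_def)
    show "antisym p"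
    proof (rule antisymI)
      fix k l assume "(k, l) \<in> p" "(l, k) \<in> p"
      then have "k \<in> \<phi> ` \<S>" "l \<in> \<phi> ` \<S>" "Sub k = Sub l" unfolding p_def by simp_all
      then show "k = l" using inj[of k l] unfolding Fp by blast
    qed
  qed
  have small_p: "small TYPE('u) (Field p)" unfolding Fp using small_image[OF small_S] .
  \<comment> \<open>A union of at most \<open>|K|\<close> sets of size at most \<open>|K|\<close> is
    again of that size; this is the gain in directedness.\<close>
  have bounds: "\<exists>u\<in>Field p. \<forall>k\<in>R. (k, u) \<in> p" if R: "R \<subseteq> Field p" "|R| \<le>o |K|" for R
  proof -
    have "Sub k \<subseteq> Field r \<and> |Sub k| \<le>o |K|" if "k \<in> R" for k
      using SubS[of k] R(1) that by (auto simp: \<S>_def)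
    then have "\<forall>k\<in>R. |Sub k| \<le>o |K|" and "(\<Union>k\<in>R. Sub k) \<subseteq> Field r" by blast+
    moreover from this have "|\<Union>k\<in>R. Sub k| \<le>o |K|"
      by (intro card_of_UNION_ordLeq_infinite[OF K R(2)])
    ultimately obtain S where S: "S \<in> \<S>" "(\<Union>k\<in>R. Sub k) \<subseteq> S" using close by blast
    have "(k, \<phi> S) \<in> p" if k: "k \<in> R" for k
    proof -
      have "k \<in> \<phi> ` \<S>" using R(1) Fp k by blast
      then show ?thesis using S k Sub[OF S(1)] by (auto simp: p_def)
    qed
    moreover have "\<phi> S \<in> Field p" using S(1) Fp by blast
    ultimately show ?thesis by blast
  qed
  have "\<exists>L\<in>Q. \<exists>y. colimit \<C> (Restr r (Sub k)) D d L y" if k: "k \<in> Field p" for k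
  proof (rule colims[rule_format], intro conjI)
    have S: "Sub k \<subseteq> Field r" "Sub k \<noteq> {}" "|Sub k| \<le>o |K|" "\<And>i j. i \<in> Sub k \<Longrightarrow> j \<in> Sub k \<Longrightarrow> ub i j \<in> Sub k"
      using SubS[OF k] by (auto simp: \<S>_def)
    show "Sub k \<subseteq> Field r" "|Sub k| \<le>o |K|" by (fact S)+
    have F: "Field (Restr r (Sub k)) = Sub k" using S(1) refl by (auto simp: Field_def refl_on_def)
    have dir: "\<exists>u\<in>Sub k. \<forall>i\<in>T. (i, u) \<in> r" if "finite T" "T \<subseteq> Sub k" for T
      using that
    proof (induction T)
      case (insert i T)
      then obtain u where u: "u \<in> Sub k" "\<forall>j\<in>T. (j, u) \<in> r" by blast
      have iu: "i \<in> Sub k" "i \<in> Field r" "u \<in> Field r" using insert.prems u(1) S(1) by auto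
      have "(j, ub i u) \<in> r" if "j \<in> insert i T" for j
        using that u(2) ub(2)[OF iu(2,3)] trans by (blast dest: transD)
      then show ?case using S(4)[OF iu(1) u(1)] by blast
    qed (use S(2) in blast)
    have "\<exists>u\<in>Sub k. \<forall>i\<in>T. (i, u) \<in> Restr r (Sub k)" if "finite T" "T \<subseteq> Sub k" for T
      using dir[OF that] that(2) by blast
    moreover have "Partial_order (Restr r (Sub k))" using po by (rule Partial_order_Restr)
    ultimately show "directed_poset natLeq (Restr r (Sub k))"
      unfolding directed_poset_def F finite_iff_ordLess_natLeq[symmetric]
      using small_subset[OF small_r S(1)] by blast
  qed
  then obtain L y where L: "\<And>k. k \<in> Field p \<Longrightarrow> L k \<in> Q"
    "\<And>k. k \<in> Field p \<Longrightarrow> colimit \<C> (Restr r (Sub k)) D d (L k) (y k)"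
    by metis
  obtain e \<psi> where "diagram \<C> p L e" "colimit \<C> p L e M \<psi>"
  proof (rule colimit_of_subdiagrams[OF refl diag colim])
    show "Refl p" "trans p" using po_p by (simp_all add: order_on_defs)
    show "\<exists>m. (k, m) \<in> p \<and> (l, m) \<in> p" if "k \<in> Field p" "l \<in> Field p" for k l
    proof -
      have "|{k, l}| \<le>o |K|" using K by (intro ordLess_imp_ordLeq finite_ordLess_infinite)
        (simp_all add: Field_card_of card_of_Well_order card_of_well_order_on)
      then show ?thesis using bounds[of "{k, l}"] that by blast
    qed
    show "Sub k \<subseteq> Field r" if "k \<in> Field p" for k using SubS[OF that] by (simp add: \<S>_def)
    show "Sub k \<subseteq> Sub l" if "(k, l) \<in> p" for k l using that by (simp add: p_def)
    show "\<exists>k\<in>Field p. i \<in> Sub k" if i: "i \<in> Field r" for i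
    proof -
      have "|{i}| \<le>o |K|" using K by (intro card_of_singl_ordLeq) auto
      then obtain S where "S \<in> \<S>" "i \<in> S" using close[of "{i}"] i by blast
      then show ?thesis using Sub Fp by (intro bexI[of _ "\<phi> S"]) auto
    qed
    show "colimit \<C> (Restr r (Sub k)) D d (L k) (y k)" if "k \<in> Field p" for k by (rule L(2)[OF that])
  qed
  then show thesis using that[OF po_p small_p] bounds L(1) by blast
qed

text \<open>\<open>X\<close> and \<open>Y\<close> are colimits of presentable objects, and
  \<open>M\<close> is a highly directed colimit of models from \<open>Q\<close>. Each presentable
  piece factors through some stage, these stages have a common upper bound, and there the
  factorizations glue because arrows are monic. Two objects are treated at once since an element and
  a model have to be put into the same small model.\<close>

lemma Loewenheim_Skolem:
  assumes X: "X \<in> Obj \<C>" and Y: "Y \<in> Obj \<C>"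
  obtains Q where "small TYPE('u) Q" "Q \<subseteq> \<M>"
    and "\<And>M f g. M \<in> \<M> \<Longrightarrow> f \<in> hom \<C> X M \<Longrightarrow> g \<in> hom \<C> Y M \<Longrightarrow>
      \<exists>L\<in>Q. \<exists>n\<in>hom \<C> L M. \<exists>f'\<in>hom \<C> X L. \<exists>g'\<in>hom \<C> Y L. f = n \<cdot> f' \<and> g = n \<cdot> g'"
proof -
  have acc: "accessible TYPE('u) \<C>" "accessible TYPE('u) (full_subcat \<C> \<M>)"
    using AECat by (simp_all add: AECat_def)
  obtain lC :: "'u rel" and PC where lC: "small_regular_cardinal lC" and "small TYPE('u) PC"
    and PC: "\<forall>Z\<in>PC. presentable lC \<C> Z"
    and genC: "\<forall>Z\<in>Obj \<C>. \<exists>(r :: 'u rel) D d x. directed_poset lC r \<and> diagram \<C> r D d \<and>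
        (\<forall>i\<in>Field r. D i \<in> PC) \<and> colimit \<C> r D d Z x"
    by (rule accessibleE[OF acc(1)])
  obtain lM :: "'u rel" and PM where lM: "small_regular_cardinal lM" and PM: "small TYPE('u) PM"
    "\<forall>Z\<in>PM. presentable lM (full_subcat \<C> \<M>) Z"
    and genM: "\<forall>Z\<in>Obj (full_subcat \<C> \<M>). \<exists>(r :: 'u rel) D d x.
        directed_poset lM r \<and> diagram (full_subcat \<C> \<M>) r D d \<and>
        (\<forall>i\<in>Field r. D i \<in> PM) \<and> colimit (full_subcat \<C> \<M>) r D d Z x"
    by (rule accessibleE[OF acc(2)])
  have PM_models: "PM \<subseteq> \<M>" using PM(2) by (auto simp: presentable_def full_subcat_def)
  obtain rX :: "'u rel" and DX dX xX where rX: "directed_poset lC rX" "diagram \<C> rX DX dX"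
    "\<And>i. i \<in> Field rX \<Longrightarrow> DX i \<in> PC" "colimit \<C> rX DX dX X xX" using genC X by blast
  obtain rY :: "'u rel" and DY dY xY where rY: "directed_poset lC rY" "diagram \<C> rY DY dY"
    "\<And>i. i \<in> Field rY \<Longrightarrow> DY i \<in> PC" "colimit \<C> rY DY dY Y xY" using genC Y by blast
  \<comment> \<open>Large enough for the \<open>lC\<close>-directedness that presentability in
    \<open>\<C>\<close> asks for, and for one upper bound over all indices of both
    presentations.\<close>
  define K where "K = Field lC \<union> Field rX \<union> Field rY"
  have K: "infinite K" "small TYPE('u) K"
    using lC rX(1) rY(1) unfolding K_def
    by (auto simp: small_regular_cardinal_def directed_poset_def intro!: small_Un)
  obtain Q where Q: "small TYPE('u) Q" "Q \<subseteq> \<M>"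
    "\<forall>(r :: 'u rel) D d. directed_poset natLeq r \<and> diagram \<C> r D d \<and>
      (\<forall>i\<in>Field r. D i \<in> PM) \<and> |Field r| \<le>o |K| \<longrightarrow> (\<exists>L\<in>Q. \<exists>l. colimit \<C> r D d L l)"
    using representatives_of_colimits[OF PM(1) PM_models K(2)] .
  have "\<exists>L\<in>Q. \<exists>n\<in>hom \<C> L M. \<exists>f'\<in>hom \<C> X L. \<exists>g'\<in>hom \<C> Y L. f = n \<cdot> f' \<and> g = n \<cdot> g'"
    if M: "M \<in> \<M>" and f: "f \<in> hom \<C> X M" and g: "g \<in> hom \<C> Y M" for M f g
  proof -
    obtain r :: "'u rel" and D d x where r: "directed_poset lM r" "diagram (full_subcat \<C> \<M>) r D d"
      "\<And>i. i \<in> Field r \<Longrightarrow> D i \<in> PM" "colimit (full_subcat \<C> \<M>) r D d M x"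
      using genM M by (auto simp: full_subcat_def)
    have "natLeq \<le>o lM"
    proof -
      have "natLeq \<le>o |Field lM|" using lM infinite_iff_natLeq_ordLeq
        by (auto simp: small_regular_cardinal_def)
      moreover have "|Field lM| =o lM"
        using lM card_of_Field_ordIso by (auto simp: small_regular_cardinal_def)
      ultimately show ?thesis by (rule ordLeq_ordIso_trans)
    qed
    then have directed: "directed_poset natLeq r"
      using r(1) by (rule directed_poset_mono[rotated])
    \<comment> \<open>The presentation of \<open>M\<close> lives in the subcategory; as its index
      poset is directed, the inclusion preserves the colimit.\<close>
    then have colim: "colimit \<C> r D d M x" using AECat r(2,4) unfolding AECat_def by blast
    have diag: "diagram \<C> r D d"
      using r(2) models_obj unfolding diagram_def by (auto simp: full_subcat_def hom_def)
    have "\<exists>L\<in>Q. \<exists>l. colimit \<C> (Restr r S) D d L l"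
      if "directed_poset natLeq (Restr r S)" "S \<subseteq> Field r" "|S| \<le>o |K|" for S
    proof (rule Q(3)[rule_format], intro conjI ballI that(1) diagram_Restr[OF diag])
      show "D i \<in> PM" if "i \<in> Field (Restr r S)" for i using r(3) that by (auto simp: Field_def)
      have "Field (Restr r S) \<subseteq> S" by (auto simp: Field_def)
      then show "|Field (Restr r S)| \<le>o |K|" using card_of_mono1 that(3) ordLeq_transitive by blast
    qed
    then have colims: "\<forall>S. directed_poset natLeq (Restr r S) \<and> S \<subseteq> Field r \<and> |S| \<le>o |K| \<longrightarrow>
        (\<exists>L\<in>Q. \<exists>l. colimit \<C> (Restr r S) D d L l)" by blast
    obtain p :: "'u rel" and L e \<psi> where p: "Partial_order p" "small TYPE('u) (Field p)"
      "\<forall>R. R \<subseteq> Field p \<and> |R| \<le>o |K| \<longrightarrow> (\<exists>u\<in>Field p. \<forall>k\<in>R. (k, u) \<in> p)"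
      "diagram \<C> p L e" "colimit \<C> p L e M \<psi>" "\<forall>k\<in>Field p. L k \<in> Q"
      using colimit_of_small_subdiagrams[OF K(1) directed diag colim colims] .
    have "|Field lC| \<le>o |K|" by (rule card_of_mono1) (auto simp: K_def)
    moreover have "lC =o |Field lC|"
      using lC card_of_Field_ordIso ordIso_symmetric by (auto simp: small_regular_cardinal_def)
    ultimately have lCK: "lC \<le>o |K|" using ordIso_ordLeq_trans by blast
    have dp: "directed_poset lC p"
      unfolding directed_poset_def
    proof (intro conjI allI impI p(1,2))
      fix S assume "S \<subseteq> Field p" "|S| <o lC"
      then show "\<exists>u\<in>Field p. \<forall>k\<in>S. (k, u) \<in> p"
        using p(3) ordLeq_transitive[OF ordLess_imp_ordLeq lCK] by blast
    qed
    have \<psi>: "\<psi> k \<in> hom \<C> (L k) M" if "k \<in> Field p" for k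
      using p(5) that by (simp add: colimit_def cocone_def)
    have presented: "\<exists>k\<in>Field p. \<exists>h\<in>hom \<C> Z (L k). u = \<psi> k \<cdot> h" if "Z \<in> PC" "u \<in> hom \<C> Z M" for Z u
      using PC that(1) dp p(4,5) that(2) unfolding presentable_def by blast
    have kX: "\<exists>k\<in>Field p. \<exists>h\<in>hom \<C> (DX i) (L k). f \<cdot> xX i = \<psi> k \<cdot> h" if "i \<in> Field rX" for i
    proof (rule presented[OF rX(3)[OF that]])
      have "xX i \<in> hom \<C> (DX i) X" using rX(4) that by (simp add: colimit_def cocone_def)
      then show "f \<cdot> xX i \<in> hom \<C> (DX i) M" using f by (rule comp_hom)
    qed
    have kY: "\<exists>k\<in>Field p. \<exists>h\<in>hom \<C> (DY i) (L k). g \<cdot> xY i = \<psi> k \<cdot> h" if "i \<in> Field rY" for i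
    proof (rule presented[OF rY(3)[OF that]])
      have "xY i \<in> hom \<C> (DY i) Y" using rY(4) that by (simp add: colimit_def cocone_def)
      then show "g \<cdot> xY i \<in> hom \<C> (DY i) M" using g by (rule comp_hom)
    qed
    obtain kx where kx: "\<And>i. i \<in> Field rX \<Longrightarrow> kx i \<in> Field p \<and> (\<exists>h\<in>hom \<C> (DX i) (L (kx i)). f \<cdot> xX i = \<psi> (kx i) \<cdot> h)"
      using kX by metis
    obtain ky where ky: "\<And>i. i \<in> Field rY \<Longrightarrow> ky i \<in> Field p \<and> (\<exists>h\<in>hom \<C> (DY i) (L (ky i)). g \<cdot> xY i = \<psi> (ky i) \<cdot> h)"
      using kY by metis
    let ?R = "kx ` Field rX \<union> ky ` Field rY"
    have "|kx ` Field rX| \<le>o |K|"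
      by (rule ordLeq_transitive[OF card_of_image card_of_mono1]) (auto simp: K_def)
    moreover have "|ky ` Field rY| \<le>o |K|"
      by (rule ordLeq_transitive[OF card_of_image card_of_mono1]) (auto simp: K_def)
    ultimately have "|?R| \<le>o |K|"
      using K(1) by (intro card_of_Un_ordLeq_infinite_Field card_of_Card_order) (simp_all add: Field_card_of)
    moreover have "?R \<subseteq> Field p" using kx ky by auto
    ultimately have "\<exists>u\<in>Field p. \<forall>k\<in>?R. (k, u) \<in> p" using p(3)[rule_format, of ?R] by simp
    then obtain u where u: "u \<in> Field p" "\<And>i. i \<in> Field rX \<Longrightarrow> (kx i, u) \<in> p"
      "\<And>i. i \<in> Field rY \<Longrightarrow> (ky i, u) \<in> p" by auto
    have lift: "\<exists>h\<in>hom \<C> Z (L u). v = \<psi> u \<cdot> h" if ku: "(k, u) \<in> p" and h: "h \<in> hom \<C> Z (L k)" "v = \<psi> k \<cdot> h" for k Z h v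
    proof -
      have e: "e k u \<in> hom \<C> (L k) (L u)" "\<psi> u \<cdot> e k u = \<psi> k"
        using p(4,5) ku by (auto simp: diagram_def colimit_def cocone_def)
      have "v = \<psi> u \<cdot> (e k u \<cdot> h)" using comp_assoc[OF h(1) e(1) \<psi>[OF u(1)]] e(2) h(2) by simp
      then show ?thesis using comp_hom[OF h(1) e(1)] by blast
    qed
    have "\<exists>h\<in>hom \<C> (DX i) (L u). f \<cdot> xX i = \<psi> u \<cdot> h" if "i \<in> Field rX" for i
      using kx[OF that] lift[OF u(2)[OF that]] by metis
    then obtain f' where f': "f' \<in> hom \<C> X (L u)" "f = \<psi> u \<cdot> f'"
      using factor_through_colimit[OF rX(2,4) f \<psi>[OF u(1)]] by metis
    have "\<exists>h\<in>hom \<C> (DY i) (L u). g \<cdot> xY i = \<psi> u \<cdot> h" if "i \<in> Field rY" for i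
      using ky[OF that] lift[OF u(3)[OF that]] by metis
    then obtain g' where g': "g' \<in> hom \<C> Y (L u)" "g = \<psi> u \<cdot> g'"
      using factor_through_colimit[OF rY(2,4) g \<psi>[OF u(1)]] by metis
    show ?thesis using p(6) u(1) \<psi>[OF u(1)] f' g' by blast
  qed
  then show thesis using that Q(1,2) by blast
qed

end

section \<open>Lascar types are bounded\<close>

context aecat
begin

definition lgtp_rel where
  "lgtp_rel A M c = {(a, b). a \<in> hom \<C> A M \<and> b \<in> hom \<C> A M \<and> lgtp_eq \<C> \<M> A M c a b}"

lemma lgtp_step_imp_lgtp_eq:
  assumes "lgtp_step \<C> \<M> A M c a b" "M \<in> \<M>" "c \<in> hom \<C> C M"
  shows "lgtp_eq \<C> \<M> A M c a b"
proof -
  interpret stable: extension_stable U \<C> \<M> A C "lgtp_step \<C> \<M> A"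
    by (rule lgtp_step_extension_stable)
  show ?thesis unfolding lgtp_eq_def using assms by (intro stable.R_tranclI) auto
qed

lemma lgtp_rel_equivalence: "equivalence_relation_over \<C> \<M> A C (lgtp_rel A)"
  unfolding equivalence_relation_over_def
proof (intro ballI equivI)
  interpret stable: extension_stable U \<C> \<M> A C "lgtp_step \<C> \<M> A"
    by (rule lgtp_step_extension_stable)
  fix M c assume M: "M \<in> \<M>" and c: "c \<in> hom \<C> C M"
  show "lgtp_rel A M c \<subseteq> hom \<C> A M \<times> hom \<C> A M" by (auto simp: lgtp_rel_def)
  \<comment> \<open>For reflexivity, \<open>M\<close> itself is the model through which
    \<open>c\<close> factors.\<close>
  have id: "Id \<C> M \<in> hom \<C> M M" using M models_obj id_hom by blast
  have cid: "sub_le \<C> c (Id \<C> M)" using sub_leI[OF c id] id_comp[OF c] by simp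
  show "refl_on (hom \<C> A M) (lgtp_rel A M c)"
  proof (rule refl_onI)
    fix a assume a: "a \<in> hom \<C> A M"
    have "gtp_eq \<C> \<M> [a, Id \<C> M] M [a, Id \<C> M] M"
      using a id id_comp by (intro gtp_eq_extend[OF id M M]) force
    then show "(a, a) \<in> lgtp_rel A M c"
      using lgtp_step_imp_lgtp_eq[OF lgtp_stepI[OF a a M c M id cid] M c] a by (simp add: lgtp_rel_def)
  qed
  show "sym (lgtp_rel A M c)"
    using stable.R_trancl_sym lgtp_step_sym unfolding sym_def lgtp_rel_def lgtp_eq_def by auto
  show "trans (lgtp_rel A M c)"
    using stable.R_trancl_trans[OF _ _ M c] unfolding trans_def lgtp_rel_def lgtp_eq_def by blast
qed

lemma lgtp_rel_invariant: "invariant_equivalence \<C> \<M> A C (lgtp_rel A)"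
  unfolding invariant_equivalence_def
proof (intro ballI impI)
  interpret stable: extension_stable U \<C> \<M> A C "lgtp_step \<C> \<M> A"
    by (rule lgtp_step_extension_stable)
  fix M M' a b c a' b' c'
  assume "a \<in> hom \<C> A M" "b \<in> hom \<C> A M" "c \<in> hom \<C> C M"
    "a' \<in> hom \<C> A M'" "b' \<in> hom \<C> A M'" "c' \<in> hom \<C> C M'"
    and gtp: "gtp_eq \<C> \<M> [a, b, c] M [a', b', c'] M'"
  then show "(a, b) \<in> lgtp_rel A M c \<longleftrightarrow> (a', b') \<in> lgtp_rel A M' c'"
    using stable.R_trancl_invariant[OF gtp] stable.R_trancl_invariant[OF gtp_eq_sym[OF gtp]]
    unfolding lgtp_rel_def lgtp_eq_def by blast
qed

text \<open>The class of \<open>a\<close> is determined by the type of \<open>a\<close> over a model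
  \<open>m\<close> through which \<open>c\<close> factors, and that type by a triple
  \<open>(L, a', m')\<close> in a small model. The small set \<open>T\<close> of such triples
  depends neither on \<open>M\<close> nor on \<open>c\<close>, which makes the bound
  uniform.\<close>

lemma lgtp_rel_bounded:
  assumes A: "A \<in> Obj \<C>" and C: "C \<in> Obj \<C>"
  shows "bounded_equivalence TYPE('u) \<C> \<M> A C (lgtp_rel A)"
proof -
  obtain Q where Q: "small TYPE('u) Q" "Q \<subseteq> \<M>"
    "\<And>M f g. M \<in> \<M> \<Longrightarrow> f \<in> hom \<C> C M \<Longrightarrow> g \<in> hom \<C> C M \<Longrightarrow>
      \<exists>L\<in>Q. \<exists>n\<in>hom \<C> L M. \<exists>f'\<in>hom \<C> C L. \<exists>g'\<in>hom \<C> C L. f = n \<cdot> f' \<and> g = n \<cdot> g'"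
    using Loewenheim_Skolem[OF C C] by metis
  \<comment> \<open>A second application, for each \<open>M0\<close>: it places \<open>a\<close>
    together with all of \<open>M0\<close> in one small model.\<close>
  have "\<exists>R. small TYPE('u) R \<and> R \<subseteq> \<M> \<and> (\<forall>M\<in>\<M>. \<forall>f\<in>hom \<C> A M. \<forall>g\<in>hom \<C> M0 M.
      \<exists>L\<in>R. \<exists>n\<in>hom \<C> L M. \<exists>f'\<in>hom \<C> A L. \<exists>g'\<in>hom \<C> M0 L. f = n \<cdot> f' \<and> g = n \<cdot> g')"
    if M0: "M0 \<in> Q" for M0
  proof -
    have "M0 \<in> Obj \<C>" using Q(2) M0 models_obj by blast
    from Loewenheim_Skolem[OF A this] show ?thesis by metis
  qed
  then obtain R where R: "\<And>M0. M0 \<in> Q \<Longrightarrow> small TYPE('u) (R M0) \<and> R M0 \<subseteq> \<M> \<and>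
      (\<forall>M\<in>\<M>. \<forall>f\<in>hom \<C> A M. \<forall>g\<in>hom \<C> M0 M.
      \<exists>L\<in>R M0. \<exists>n\<in>hom \<C> L M. \<exists>f'\<in>hom \<C> A L. \<exists>g'\<in>hom \<C> M0 L. f = n \<cdot> f' \<and> g = n \<cdot> g')"
    by metis
  define T where "T = (\<Union>M0\<in>Q. \<Union>L\<in>R M0. {L} \<times> hom \<C> A L \<times> hom \<C> M0 L)"
  have "small TYPE('u) {L}" for L :: 'o by (rule small_finite) simp
  then have "small TYPE('u) T"
    unfolding T_def using R by (intro small_UN small_Times Q(1) locally_small_hom) auto
  then obtain Y :: "'u set" where Y: "|T| =o |Y|" "small TYPE('u) Y" by (rule small_code)
  have "|hom \<C> A M // lgtp_rel A M c| \<le>o |Y|" if M: "M \<in> \<M>" and c: "c \<in> hom \<C> C M" for M c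
  proof -
    obtain M0 m c' where M0: "M0 \<in> Q" "m \<in> hom \<C> M0 M" "c' \<in> hom \<C> C M0" "c = m \<cdot> c'"
      using Q(3)[OF M c c] by metis
    have cm: "sub_le \<C> c m" by (rule sub_leI[OF M0(3,2,4)])
    have "\<exists>t. t \<in> T \<and> (\<exists>n\<in>hom \<C> (fst t) M. fst t \<in> \<M> \<and> fst (snd t) \<in> hom \<C> A (fst t) \<and>
        snd (snd t) \<in> hom \<C> M0 (fst t) \<and> a = n \<cdot> fst (snd t) \<and> m = n \<cdot> snd (snd t))"
      if a: "a \<in> hom \<C> A M" for a
    proof -
      obtain L n a' m' where "L \<in> R M0" "n \<in> hom \<C> L M" "a' \<in> hom \<C> A L" "m' \<in> hom \<C> M0 L"
        "a = n \<cdot> a'" "m = n \<cdot> m'"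
        using R[OF M0(1)] M a M0(2) by metis
      then show ?thesis using R[OF M0(1)] M0(1) by (intro exI[of _ "(L, a', m')"]) (auto simp: T_def)
    qed
    then obtain t where t: "\<And>a. a \<in> hom \<C> A M \<Longrightarrow> t a \<in> T \<and> (\<exists>n\<in>hom \<C> (fst (t a)) M. fst (t a) \<in> \<M> \<and>
        fst (snd (t a)) \<in> hom \<C> A (fst (t a)) \<and> snd (snd (t a)) \<in> hom \<C> M0 (fst (t a)) \<and>
        a = n \<cdot> fst (snd (t a)) \<and> m = n \<cdot> snd (snd (t a)))"
      by metis
    have equiv: "equiv (hom \<C> A M) (lgtp_rel A M c)"
      using lgtp_rel_equivalence M c by (simp add: equivalence_relation_over_def)
    \<comment> \<open>\<open>(a, m)\<close> and \<open>(b, m)\<close> are images of the same pair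
      \<open>(a', m')\<close> along possibly different maps from \<open>L\<close>, so both have its
      type.\<close>
    have same: "(a, b) \<in> lgtp_rel A M c"
      if a: "a \<in> hom \<C> A M" and b: "b \<in> hom \<C> A M" and ab: "t a = t b" for a b
    proof -
      obtain L a' m' where L: "t a = (L, a', m')" by (cases "t a") auto
      obtain n where n: "n \<in> hom \<C> L M" "L \<in> \<M>" "a' \<in> hom \<C> A L" "m' \<in> hom \<C> M0 L" "a = n \<cdot> a'" "m = n \<cdot> m'"
        using t[OF a] L by auto
      obtain n' where n': "n' \<in> hom \<C> L M" "b = n' \<cdot> a'" "m = n' \<cdot> m'"
        using t[OF b] L ab by auto
      have "gtp_eq \<C> \<M> [a', m'] L [a, m] M" using n by (intro gtp_eq_extend[OF n(1,2) M]) auto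
      moreover have "gtp_eq \<C> \<M> [a', m'] L [b, m] M"
        using n(3,4) n' by (intro gtp_eq_extend[OF n'(1) n(2) M]) auto
      ultimately have "gtp_eq \<C> \<M> [a, m] M [b, m] M" using gtp_eq_sym gtp_eq_trans by blast
      moreover have "M0 \<in> \<M>" using M0(1) Q(2) by blast
      ultimately have "lgtp_step \<C> \<M> A M c a b"
        using lgtp_stepI[OF a b M c _ M0(2) cm] by blast
      then show ?thesis using lgtp_step_imp_lgtp_eq M c a b by (auto simp: lgtp_rel_def)
    qed
    define rep where "rep q = (SOME a. a \<in> q)" for q :: "'a set"
    have rep: "rep q \<in> hom \<C> A M \<and> q = lgtp_rel A M c `` {rep q}" if q: "q \<in> hom \<C> A M // lgtp_rel A M c" for q
    proof -
      have "q \<noteq> {}" "q \<subseteq> hom \<C> A M" using in_quotient_imp_non_empty[OF equiv q] in_quotient_imp_subset[OF equiv q] .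
      then have "rep q \<in> q" unfolding rep_def by (simp add: some_in_eq)
      then show ?thesis
        using q equiv \<open>q \<subseteq> hom \<C> A M\<close> by (auto elim!: quotientE simp: equiv_class_eq_iff)
    qed
    have "inj_on (\<lambda>q. t (rep q)) (hom \<C> A M // lgtp_rel A M c)"
    proof (rule inj_onI)
      fix q q' assume "q \<in> hom \<C> A M // lgtp_rel A M c" "q' \<in> hom \<C> A M // lgtp_rel A M c" "t (rep q) = t (rep q')"
      then show "q = q'" using rep[of q] rep[of q'] same equiv_class_eq[OF equiv] by metis
    qed
    moreover have "(\<lambda>q. t (rep q)) ` (hom \<C> A M // lgtp_rel A M c) \<subseteq> T" using rep t by blast
    ultimately have "|hom \<C> A M // lgtp_rel A M c| \<le>o |T|" using card_of_ordLeq by blast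
    then show ?thesis using Y(1) by (rule ordLeq_ordIso_trans)
  qed
  then show ?thesis
    unfolding bounded_equivalence_def
    using Y(2) card_of_Card_order by (intro exI[of _ "|Y|"]) (simp add: Field_card_of)
qed

lemma bounded_equiv_imp_lgtp_eq:
  assumes "bounded_equiv TYPE('u) \<C> \<M> A C M c a b" "A \<in> Obj \<C>" "C \<in> Obj \<C>"
  shows "lgtp_eq \<C> \<M> A M c a b"
  using assms lgtp_rel_equivalence lgtp_rel_invariant lgtp_rel_bounded
  unfolding bounded_equiv_def lgtp_rel_def by blast

end

theorem theorem8p7:
  fixes \<C> :: "('o, 'a) cat" and \<M> :: "'o set"
    and I :: "('o, 'a) indep" and base :: "'o set"
    and A C M :: 'o and a b c :: 'a
  assumes "Grothendieck_universe TYPE('u)"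
    and "AECat TYPE('u) \<C> \<M>"
    and "amalgamation_property \<C> \<M>"
    and "basic_independence_relation TYPE('u) \<C> \<M> I base"
    and "three_amalgamation \<C> \<M> I"
    and "A \<in> Obj \<C>" and "C \<in> Obj \<C>" and "M \<in> \<M>"
    and "a \<in> hom \<C> A M" and "b \<in> hom \<C> A M" and "c \<in> hom \<C> C M"
  shows "(lgtp_eq \<C> \<M> A M c a b \<longleftrightarrow> bounded_equiv TYPE('u) \<C> \<M> A C M c a b) \<and>
         (bounded_equiv TYPE('u) \<C> \<M> A C M c a b \<longleftrightarrow> two_indisc_equiv TYPE('u) \<C> \<M> A M c a b)"
proof -
  interpret aecat "TYPE('u)" \<C> \<M>
    using assms(1-3) by unfold_locales (auto simp: AECat_def accessible_def)
  show ?thesis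
    using lgtp_eq_imp_two_indisc_equiv[OF assms(4,5,9-11)]
      two_indisc_equiv_imp_bounded_equiv[OF _ assms(8-11)]
      bounded_equiv_imp_lgtp_eq[OF _ assms(6,7)]
    by blast
qed

end
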